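(* Let $(X,d)$ be a compact metric space or a countable set of isolated points (complete separable). Let $\beta:\mathbb{R}_+\to[0,+\infty]$ be a lower-semicontinuous convex function with $\beta(0)=0$ and $\lim_{x\to\infty}\beta(x)/x=+\infty$. Let $\gamma:\mathbb{R}_+\to\mathbb{R}_+$ be lower-semicontinuous with $\gamma(0)=0$, $\gamma(u)>0$ for all $u>0$, and $\gamma(u+v)\le C(\gamma(u)+\gamma(v))$ for all $u,v\geq 0$ and some constant $C$. Let $\mu_0$ be a reference probability measure on $X$. Then for all $\mu,\nu\in\mathcal{P}_\gamma(X)$ absolutely continuous with respect to $\mu_0$, $$\widehat{\mathcal{T}}_\beta(\nu|\mu)=\sup_{\varphi\in\Phi_{\gamma,b}(X)}\left\{\int\widehat{Q}_\beta\varphi(x)\,\mu(dx)-\int\varphi(y)\,\nu(dy)\right\},$$ where for $x\in X$ and $\varphi\in\Phi_{\gamma,b}(X)$, $$\widehat{Q}_\beta\varphi(x):=\inf_{p\in\mathcal{P}_\gamma(X),\ p\ll\mu_0\text{ on }X\setminus\{x\}}\left\{\int\varphi(y)\,p(dy)+\int\beta\left(\gamma(d(x,y))\frac{dp}{d\mu_0}(y)\right)\mu_0(dy)\right\}.$$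
   Context: $\mathcal{P}_\gamma(X)$ is the set of Borel probability measures $\mu$ on $X$ with $\int\gamma(d(x,x_o))\,\mu(dx)<\infty$ for some (hence all) $x_o\in X$. $\Phi_{\gamma,b}(X)$ is the set of continuous functions $\varphi:X\to\mathbb{R}$, bounded from below, with $|\varphi(x)|\le a+b\,\gamma(d(x,x_o))$ for all $x$, for some $a,b\ge0$. Define the cost $$c(x,p)=\int\beta\left(\gamma(d(x,y))\frac{dp}{d\mu_0}(y)\right)\mu_0(dy)$$ if $p$ is absolutely continuous with respect to $\mu_0$ on $X\setminus\{x\}$, and $c(x,p)=+\infty$ otherwise (the integrand at $y=x$ is $\beta(0)=0$ since $\gamma(0)=0$, so only the density of $p$ on $X\setminus\{x\}$ matters). With $\Pi(\mu,\nu)$ the set of probability measures on $X\times X$ with first marginal $\mu$ and second marginal $\nu$, each disintegrated as $\pi(dxdy)=\mu(dx)p_x(dy)$, $$\widehat{\mathcal{T}}_\beta(\nu|\mu)=\inf_{\pi\in\Pi(\mu,\nu)}\int c(x,p_x)\,\mu(dx).$$ *)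

theory Defs
  imports "HOL-Probability.Probability"
begin

text \<open>
  The space is the carrier of a type of class \<^class>\<open>polish_space\<close>.  Functions on the half-line
  are functions on \<^typ>\<open>real\<close> that are only constrained, and only ever evaluated, on \<open>{0..}\<close>.
\<close>

definition lsc_on :: "'a::topological_space set \<Rightarrow> ('a \<Rightarrow> 'b::linorder) \<Rightarrow> bool" where
  "lsc_on S f \<longleftrightarrow> (\<forall>x\<in>S. \<forall>t. t < f x \<longrightarrow> (\<forall>\<^sub>F y in at x within S. t < f y))"

text \<open>\<^const>\<open>convex_on\<close> only covers real-valued functions.\<close>

definition ennreal_convex_on :: "real set \<Rightarrow> (real \<Rightarrow> ennreal) \<Rightarrow> bool" where
  "ennreal_convex_on S f \<longleftrightarrow> convex S \<and>
     (\<forall>x\<in>S. \<forall>y\<in>S. \<forall>t\<in>{0..1}.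
        f ((1 - t) * x + t * y) \<le> ennreal (1 - t) * f x + ennreal t * f y)"

text \<open>
  In \<open>P_gamma\<close> and \<open>Phi_gamma_b\<close> the base point \<open>xo\<close> is an explicit parameter; all statements are
  meant for an arbitrary choice of it.
\<close>

definition P_gamma :: "(real \<Rightarrow> real) \<Rightarrow> 'a::polish_space \<Rightarrow> 'a measure set" where
  "P_gamma \<gamma> xo =
     {p. prob_space p \<and> sets p = sets borel \<and> (\<integral>\<^sup>+ x. ennreal (\<gamma> (dist x xo)) \<partial>p) < \<infinity>}"

definition Phi_gamma_b :: "(real \<Rightarrow> real) \<Rightarrow> 'a::polish_space \<Rightarrow> ('a \<Rightarrow> real) set" where
  "Phi_gamma_b \<gamma> xo =
     {\<phi>. continuous_on UNIV \<phi> \<and> bdd_below (range \<phi>) \<and>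
         (\<exists>a\<ge>0. \<exists>b\<ge>0. \<forall>x. \<bar>\<phi> x\<bar> \<le> a + b * \<gamma> (dist x xo))}"

text \<open>The part of \<open>p\<close> carried by the complement of \<open>x\<close>.\<close>

definition off_point :: "'a::polish_space \<Rightarrow> 'a measure \<Rightarrow> 'a measure" where
  "off_point x p = density p (indicator (- {x}))"

definition ac_off :: "'a::polish_space measure \<Rightarrow> 'a \<Rightarrow> 'a measure \<Rightarrow> bool" where
  "ac_off \<mu>0 x p \<longleftrightarrow> absolutely_continuous \<mu>0 (off_point x p)"

text \<open>
  The density is that of \<open>off_point x p\<close>: \<open>p\<close> itself need not be absolutely continuous, and
  \<^const>\<open>RN_deriv\<close> is only meaningful for absolutely continuous measures.  At \<open>y = x\<close> the
  integrand is \<open>\<beta> 0\<close> whatever the density.  The density is finite almost everywhere, so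
  \<^const>\<open>enn2real\<close> loses nothing.
\<close>

definition beta_integral ::
  "(real \<Rightarrow> ennreal) \<Rightarrow> (real \<Rightarrow> real) \<Rightarrow> 'a::polish_space measure \<Rightarrow> 'a \<Rightarrow> 'a measure \<Rightarrow> ennreal"
where
  "beta_integral \<beta> \<gamma> \<mu>0 x p =
     (\<integral>\<^sup>+ y. \<beta> (\<gamma> (dist x y) * enn2real (RN_deriv \<mu>0 (off_point x p) y)) \<partial>\<mu>0)"

definition cost ::
  "(real \<Rightarrow> ennreal) \<Rightarrow> (real \<Rightarrow> real) \<Rightarrow> 'a::polish_space measure \<Rightarrow> 'a \<Rightarrow> 'a measure \<Rightarrow> ennreal"
where
  "cost \<beta> \<gamma> \<mu>0 x p = (if ac_off \<mu>0 x p then beta_integral \<beta> \<gamma> \<mu>0 x p else \<infinity>)"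

definition couplings ::
  "'a::polish_space measure \<Rightarrow> 'a measure \<Rightarrow> ('a \<times> 'a) measure set" where
  "couplings \<mu> \<nu> =
     {\<pi>. prob_space \<pi> \<and> sets \<pi> = sets (borel \<Otimes>\<^sub>M borel) \<and>
         distr \<pi> borel fst = \<mu> \<and> distr \<pi> borel snd = \<nu>}"

text \<open>\<open>\<pi>(dx dy) = \<mu>(dx) p\<^sub>x(dy)\<close> with \<open>p\<close> a probability kernel.\<close>

definition disintegrates ::
  "('a::polish_space \<times> 'a) measure \<Rightarrow> 'a measure \<Rightarrow> ('a \<Rightarrow> 'a measure) \<Rightarrow> bool" where
  "disintegrates \<pi> \<mu> p \<longleftrightarrow>
     p \<in> borel \<rightarrow>\<^sub>M prob_algebra borel \<and>
     (\<forall>A\<in>sets borel. \<forall>B\<in>sets borel.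
        emeasure \<pi> (A \<times> B) = (\<integral>\<^sup>+ x\<in>A. emeasure (p x) B \<partial>\<mu>))"

text \<open>
  The kernel of a coupling is unique up to a \<open>\<mu>\<close>-null set, so ranging over all disintegrations
  of each coupling does not change the infimum.
\<close>

definition T_hat ::
  "(real \<Rightarrow> ennreal) \<Rightarrow> (real \<Rightarrow> real) \<Rightarrow> 'a::polish_space measure \<Rightarrow> 'a measure \<Rightarrow> 'a measure \<Rightarrow> ennreal"
where
  "T_hat \<beta> \<gamma> \<mu>0 \<nu> \<mu> =
     Inf {(\<integral>\<^sup>+ x. cost \<beta> \<gamma> \<mu>0 x (p x) \<partial>\<mu>) | \<pi> p. \<pi> \<in> couplings \<mu> \<nu> \<and> disintegrates \<pi> \<mu> p}"

definition Q_hat ::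
  "(real \<Rightarrow> ennreal) \<Rightarrow> (real \<Rightarrow> real) \<Rightarrow> 'a::polish_space measure \<Rightarrow> 'a \<Rightarrow> ('a \<Rightarrow> real) \<Rightarrow> 'a \<Rightarrow> ereal"
where
  "Q_hat \<beta> \<gamma> \<mu>0 xo \<phi> x =
     (INF p\<in>{p \<in> P_gamma \<gamma> xo. ac_off \<mu>0 x p}.
        ereal (\<integral> y. \<phi> y \<partial>p) + enn2ereal (beta_integral \<beta> \<gamma> \<mu>0 x p))"

end

theory Submission
  imports Defs
begin

text \<open>
  A kernel of finite cost has the form \<open>p\<^sub>x = F(x, \<cdot>) \<mu>0 + (1 - \<integral> F(x, y) \<mu>0(dy)) \<delta>\<^sub>x\<close>, so the primal
  problem minimises the convex functional \<open>J F = \<integral>\<integral> \<beta> (\<gamma> (d(x, y)) F(x, y)) \<mu>0(dy) \<mu>(dx)\<close> under a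
  linear constraint on \<open>F\<close>.  No separation theorem is needed.  For finitely many test functions,
  an almost minimiser of \<open>J\<close> plus a large quadratic penalty on the constraints satisfies a first-order
  condition, in which the weighted constraint defects form a potential \<open>\<phi>\<close>; this bounds \<open>J F\<close> by the
  dual value.  A Komlos-type selection turns such almost couplings into an almost everywhere convergent
  sequence, and \<open>J\<close> is lower semicontinuous by Fatou.  The second marginal passes to the limit because
  \<open>\<beta>\<close> is superlinear and \<open>\<gamma>\<close> is bounded below away from the diagonal, while near the diagonal
  continuity of the test functions makes \<open>\<phi> y - \<phi> x\<close> small.  Both kinds of space are locally compact,
  which provides the test functions.

  \<open>Q_hat\<close> is the infimum over one countable family of measurable kernels, independent of \<open>\<phi>\<close>, which
  gives both its measurability and measurable near-optimal selections.
\<close>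

section \<open>Almost everywhere convergent selections\<close>

text \<open>Since \<gamma> vanishes at 0, a bound on \<open>J\<close> says little about the mass of
  F close to the diagonal. The densities of almost couplings therefore need not be uniformly
  integrable, and weak L1 compactness is out of reach. Almost everywhere convergence asks for less:
  the exponential functional is finite and strictly convex whatever the size of f. Mass that
  disappears in the limit reappears in the atom of \<open>mix\<close> at the starting point, which
  is where mass piling up on the diagonal belongs. Marginals are therefore compared through
  \<open>shift\<close>, whose integrand \<phi> y - \<phi> x does not see motion of length zero.

  The penalty uses finitely many bounded continuous functions, so the potential that it produces is
  a finite combination of them and lies in \<Phi>, where the dual bound applies. All further
  constraints are reached by letting their number grow while the tolerance shrinks.\<close>

text \<open>A finite sum bounds each of its terms, so the increments of h are at most a constant
  times 2 to the power -i. The weight \<open>4 ^ i\<close> is what lets L2 estimates yield pointwise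
  convergence.\<close>

lemma summable_power_bound_imp_convergent:
  fixes h :: "nat \<Rightarrow> real"
  assumes "(\<Sum>i. ennreal (4 ^ i * (h (Suc i) - h i)\<^sup>2)) < \<infinity>"
  shows "convergent h"
proof -
  define S where "S = enn2real (\<Sum>i. ennreal (4 ^ i * (h (Suc i) - h i)\<^sup>2))"
  have le: "4 ^ i * (h (Suc i) - h i)\<^sup>2 \<le> S" for i
  proof -
    have "ennreal (4 ^ i * (h (Suc i) - h i)\<^sup>2) \<le> (\<Sum>i. ennreal (4 ^ i * (h (Suc i) - h i)\<^sup>2))"
      using sum_le_suminf[OF summableI, of "{i}" "\<lambda>i. ennreal (4 ^ i * (h (Suc i) - h i)\<^sup>2)"]
      by (simp only: sum.insert finite.intros sum.empty empty_iff not_False_eq_True add_0_right zero_le simp_thms)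
    then have "enn2real (ennreal (4 ^ i * (h (Suc i) - h i)\<^sup>2)) \<le> S"
      unfolding S_def by (rule enn2real_mono[OF _ assms[unfolded infinity_ennreal_def]])
    then show ?thesis by simp
  qed
  have S0: "0 \<le> S" unfolding S_def by simp
  have bound: "\<bar>h (Suc i) - h i\<bar> \<le> sqrt S * (1/2) ^ i" for i
  proof -
    have "(2 ^ i * \<bar>h (Suc i) - h i\<bar>)\<^sup>2 \<le> S"
    proof -
      have "((2::real) ^ i)\<^sup>2 = (2\<^sup>2) ^ i" by (simp only: power_mult[symmetric] mult.commute)
      then have "((2::real) ^ i)\<^sup>2 = 4 ^ i" by simp
      then show ?thesis using le[of i] by (simp only: power_mult_distrib power2_abs)
    qed
    then have "2 ^ i * \<bar>h (Suc i) - h i\<bar> \<le> sqrt S"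
      using real_le_rsqrt by blast
    then have "(2 ^ i * \<bar>h (Suc i) - h i\<bar>) * (1/2) ^ i \<le> sqrt S * (1/2) ^ i"
      by (intro mult_right_mono) auto
    moreover have "(2::real) ^ i * (1/2) ^ i = 1" by (simp add: power_one_over)
    moreover have "(2 ^ i * \<bar>h (Suc i) - h i\<bar>) * (1/2) ^ i = \<bar>h (Suc i) - h i\<bar> * (2 ^ i * (1/2) ^ i)"
      by (simp only: ac_simps)
    ultimately show ?thesis by simp
  qed
  have "summable (\<lambda>i. sqrt S * (1/2) ^ i)"
    by (intro summable_mult summable_geometric) simp
  then have "summable (\<lambda>i. h (Suc i) - h i)"
    by (rule summable_comparison_test'[where N = 0]) (simp only: real_norm_def bound)
  then have "convergent (\<lambda>n. \<Sum>i<n. h (Suc i) - h i)"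
    by (simp add: summable_iff_convergent)
  then obtain L where "(\<lambda>n. h n - h 0) \<longlonglongrightarrow> L"
    unfolding sum_lessThan_telescope convergent_def by blast
  then have "(\<lambda>n. (h n - h 0) + h 0) \<longlonglongrightarrow> L + h 0" by (intro tendsto_add tendsto_const)
  then show ?thesis unfolding convergent_def by auto
qed

text \<open>The midpoint gap of the convex function exp (- x) is a perfect square. This is the
  quantitative strict convexity behind the selection, and the reason for the halved exponents in
  it.\<close>

lemma exp_midpoint_gap:
  fixes a b :: real
  shows "(exp (- a / 2) - exp (- b / 2))\<^sup>2 = exp (- a) + exp (- b) - 2 * exp (- ((a + b) / 2))"
proof -
  have sq: "exp (- c / 2) ^ 2 = exp (- c)" for c :: real
  proof -
    have "exp (- c / 2) ^ 2 = exp (2 * (- c / 2))" by (rule exp_double[symmetric])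
    also have "2 * (- c / 2) = - c" by simp
    finally show ?thesis .
  qed
  have "exp (- a / 2) * exp (- b / 2) = exp (- ((a + b) / 2))"
  proof -
    have "- a / 2 + - b / 2 = - ((a + b) / 2)" by (simp add: field_simps)
    then show ?thesis by (metis exp_add)
  qed
  then show ?thesis unfolding power2_diff sq by (simp only: mult.assoc)
qed

text \<open>A Komlos-type selection: nearly minimising the strictly convex functional
  \<open>\<integral> exp (- f)\<close> over \<open>C k\<close> forces \<open>exp (- f / 2)\<close> to be Cauchy in \<open>L\<^sup>2\<close>.\<close>

lemma (in prob_space) midpoint_convex_AE_convergent:
  fixes C :: "nat \<Rightarrow> ('a \<Rightarrow> real) set"
  assumes meas: "\<And>k f. f \<in> C k \<Longrightarrow> f \<in> borel_measurable M"
    and nonneg: "\<And>k f x. f \<in> C k \<Longrightarrow> 0 \<le> f x"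
    and ne: "\<And>k. C k \<noteq> {}"
    and dec: "\<And>k. C (Suc k) \<subseteq> C k"
    and mid: "\<And>k f g. f \<in> C k \<Longrightarrow> g \<in> C k \<Longrightarrow> (\<lambda>x. (f x + g x) / 2) \<in> C k"
  obtains G where "\<And>k. G k \<in> C k" "AE x in M. convergent (\<lambda>k. exp (- G k x / 2))"
proof -
  have anti: "C k \<subseteq> C j" if "j \<le> k" for j k
    using lift_Suc_antimono_le[of C, OF dec that] .
  define \<Psi> where "\<Psi> f = (\<integral>x. exp (- f x) \<partial>M)" for f :: "'a \<Rightarrow> real"
  have int: "integrable M (\<lambda>x. exp (- f x))" if "f \<in> C k" for f k
    using meas[OF that] nonneg[OF that]
    by (intro integrable_const_bound[where B = 1]) auto
  have \<Psi>0: "0 \<le> \<Psi> f" for f unfolding \<Psi>_def by simp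
  have bdd: "bdd_below (\<Psi> ` C k)" for k using \<Psi>0 by (intro bdd_belowI[where m = 0]) auto
  have \<Psi>1: "\<Psi> f \<le> 1" if "f \<in> C k" for f k
  proof -
    have "\<Psi> f \<le> (\<integral>x. 1 \<partial>M)"
      unfolding \<Psi>_def using nonneg[OF that] by (intro integral_mono int[OF that]) auto
    then show ?thesis by (simp add: prob_space)
  qed
  \<comment> \<open>The sets shrink, so these infima increase; they are at most 1 and hence
    converge.\<close>
  define s where "s k = (INF f\<in>C k. \<Psi> f)" for k
  have s_le: "s k \<le> \<Psi> f" if "f \<in> C k" for f k
    unfolding s_def using that bdd by (intro cINF_lower) auto
  have s1: "s k \<le> 1" for k
    using s_le \<Psi>1 ne by (meson all_not_in_conv order_trans)
  have "incseq s"
    unfolding s_def using ne bdd dec by (intro incseq_SucI cINF_superset_mono) auto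
  moreover have "bdd_above (range s)" using s1 by (intro bdd_aboveI[where M = 1]) auto
  ultimately obtain S where S: "s \<longlonglongrightarrow> S" "\<And>k. s k \<le> S"
    by (metis LIMSEQ_incseq_SUP cSUP_upper iso_tuple_UNIV_I)
  have "\<exists>f. f \<in> C k \<and> \<Psi> f < s k + 1 / real (Suc k)" for k
  proof -
    have "Inf (\<Psi> ` C k) < s k + 1 / real (Suc k)" unfolding s_def by simp
    then show ?thesis using ne[of k] bdd[of k] by (auto simp: cInf_less_iff)
  qed
  then obtain g where g: "\<And>k. g k \<in> C k" "\<And>k. \<Psi> (g k) < s k + 1 / real (Suc k)" by metis
  \<comment> \<open>Bounds the squared L2 distance from \<open>g j\<close> to any later
    \<open>g k\<close>. Their midpoint lies in \<open>C j\<close>, so \<Psi> there is at least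
    \<open>s j\<close>, while the two ends have \<Psi> at most \<open>s j\<close> and
    \<open>S\<close>, each up to \<open>1 / Suc j\<close>.\<close>
  define e where "e j = S - s j + 2 / real (Suc j)" for j
  have "(\<lambda>j. S - s j + 2 * (1 / real (Suc j))) \<longlonglongrightarrow> S - S + 2 * 0"
    by (intro tendsto_intros S LIMSEQ_Suc[OF lim_1_over_n])
  then have e0: "e \<longlonglongrightarrow> 0" unfolding e_def by simp
  define d where "d j k = (\<integral>x. (exp (- g j x / 2) - exp (- g k x / 2))\<^sup>2 \<partial>M)" for j k
  have int2: "integrable M (\<lambda>x. (exp (- g j x / 2) - exp (- g k x / 2))\<^sup>2)" if "j \<le> k" for j k
    unfolding exp_midpoint_gap
    using int[OF g(1)[of j]] int[OF g(1)[of k]]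
      int[OF mid[OF g(1)[of j] subsetD[OF anti[OF that] g(1)[of k]]]] by auto
  have d: "d j k \<le> e j" if "j \<le> k" for j k
  proof -
    have m: "(\<lambda>x. (g j x + g k x) / 2) \<in> C j" using mid[OF g(1)[of j] subsetD[OF anti[OF that] g(1)[of k]]] .
    have "d j k = \<Psi> (g j) + \<Psi> (g k) - 2 * \<Psi> (\<lambda>x. (g j x + g k x) / 2)"
      unfolding d_def \<Psi>_def exp_midpoint_gap
      using int[OF g(1)[of j]] int[OF g(1)[of k]] int[OF m] by simp
    also have "\<dots> \<le> (s j + 1 / real (Suc j)) + (S + 1 / real (Suc j)) - 2 * s j"
    proof -
      have "1 / real (Suc k) \<le> 1 / real (Suc j)" using that by (simp add: field_simps)
      then show ?thesis using g(2)[of j] g(2)[of k] S(2)[of k] s_le[OF m] by linarith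
    qed
    finally show ?thesis unfolding e_def by simp
  qed
  \<comment> \<open>The rate \<open>(1/8) ^ i\<close> outweighs the factor \<open>4 ^ i\<close> of
    the summability criterion and leaves \<open>(1/2) ^ i\<close>.\<close>
  have ex: "\<exists>n>m. \<forall>j\<ge>n. e j \<le> (1/8) ^ i" for i m
  proof -
    have "eventually (\<lambda>j. e j < (1/8) ^ i) sequentially" using order_tendstoD(2)[OF e0] by simp
    then obtain N where "\<forall>j\<ge>N. e j < (1/8) ^ i" by (auto simp: eventually_sequentially)
    then show ?thesis by (intro exI[of _ "max (Suc m) N"]) (auto intro: less_imp_le)
  qed
  have "\<exists>r. (\<forall>i. (\<forall>j\<ge>r i. e j \<le> (1/8) ^ i)) \<and> (\<forall>i. r i < (r (Suc i)::nat))"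
    using dependent_nat_choice[of "\<lambda>i n. \<forall>j\<ge>n. e j \<le> (1/8) ^ i" "\<lambda>i m n. m < n"] ex by metis
  then obtain r where r: "\<And>i. e (r i) \<le> (1/8) ^ i" "\<And>i. r i < r (Suc i)" by blast
  have "strict_mono r" using r(2) by (simp add: strict_mono_Suc_iff)
  then have rk: "k \<le> r k" for k by (rule seq_suble)
  define h where "h i x = exp (- g (r i) x / 2)" for i x
  have hm[measurable]: "h i \<in> borel_measurable M" for i
    unfolding h_def using meas[OF g(1)[of "r i"]] by measurable
  have "(\<integral>\<^sup>+x. (\<Sum>i. ennreal (4 ^ i * (h (Suc i) x - h i x)\<^sup>2)) \<partial>M)
      = (\<Sum>i. \<integral>\<^sup>+x. ennreal (4 ^ i * (h (Suc i) x - h i x)\<^sup>2) \<partial>M)"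
    by (intro nn_integral_suminf) measurable
  also have "\<dots> \<le> (\<Sum>i. ennreal ((1/2) ^ i))"
  proof (intro suminf_le allI)
    fix i
    have "(\<integral>\<^sup>+x. ennreal (4 ^ i * (h (Suc i) x - h i x)\<^sup>2) \<partial>M)
        = (\<integral>\<^sup>+x. ennreal (4 ^ i * (exp (- g (r i) x / 2) - exp (- g (r (Suc i)) x / 2))\<^sup>2) \<partial>M)"
      unfolding h_def by (simp add: power2_commute)
    also have "\<dots> = ennreal (4 ^ i * d (r i) (r (Suc i)))"
      unfolding d_def using int2[of "r i" "r (Suc i)"] r(2)[of i]
      by (subst nn_integral_eq_integral) auto
    also have "\<dots> \<le> ennreal (4 ^ i * (1/8) ^ i)"
      using d[of "r i" "r (Suc i)"] r(2)[of i] r(1)[of i] by (intro ennreal_leI mult_left_mono) auto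
    also have "(4::real) ^ i * (1/8) ^ i = (1/2) ^ i" by (simp flip: power_mult_distrib)
    finally show "(\<integral>\<^sup>+x. ennreal (4 ^ i * (h (Suc i) x - h i x)\<^sup>2) \<partial>M) \<le> ennreal ((1/2) ^ i)" .
  qed auto
  also have "\<dots> = ennreal (\<Sum>i. (1/2) ^ i)"
    by (intro suminf_ennreal2 summable_geometric) auto
  also have "\<dots> < \<infinity>" by simp
  finally have "AE x in M. (\<Sum>i. ennreal (4 ^ i * (h (Suc i) x - h i x)\<^sup>2)) \<noteq> \<infinity>"
    by (intro nn_integral_PInf_AE) auto
  then have "AE x in M. convergent (\<lambda>i. h i x)"
    by eventually_elim (intro summable_power_bound_imp_convergent, simp add: less_top)
  then show ?thesis
    using that[of "\<lambda>i. g (r i)"] g(1) anti[OF rk] unfolding h_def by blast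
qed

section \<open>Test functions on locally compact Polish spaces\<close>

lemma ex_open_basis_compact_closure:
  assumes "\<And>x::'a::polish_space. \<exists>W. open W \<and> x \<in> W \<and> compact (closure W)"
  obtains U :: "nat \<Rightarrow> 'a::polish_space set"
  where "topological_basis (range U)" "\<And>i. compact (closure (U i))"
proof -
  obtain B :: "'a set set" where B: "countable B" "topological_basis B"
    using ex_countable_basis by blast
  define B' where "B' = {b\<in>B. compact (closure b)}"
  have op: "open b" if "b \<in> B'" for b using that B topological_basis_open unfolding B'_def by blast
  have basis: "topological_basis B'"
  proof (rule topological_basisI[OF op])
    fix O' :: "'a set" and x assume O: "open O'" "x \<in> O'"
    obtain W where W: "open W" "x \<in> W" "compact (closure W)" using assms by blast
    have "open (O' \<inter> W)" using O W by auto
    then obtain b where b: "b \<in> B" "x \<in> b" "b \<subseteq> O' \<inter> W"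
      using topological_basisE[OF B(2)] O W by (metis IntI)
    then have "closure b \<subseteq> closure W" by (intro closure_mono) auto
    then have "compact (closure b)"
      using W(3) by (metis closed_closure closed_Int_compact inf.absorb1)
    then show "\<exists>b\<in>B'. x \<in> b \<and> b \<subseteq> O'" using b unfolding B'_def by blast
  qed
  have "B' \<noteq> {}"
    using topological_basisE[OF basis open_UNIV UNIV_I] by blast
  moreover have "countable B'" using B unfolding B'_def by simp
  ultimately have "range (from_nat_into B') = B'" by (rule range_from_nat_into)
  moreover have "compact (closure (from_nat_into B' i))" for i
    using from_nat_into[OF \<open>B' \<noteq> {}\<close>, of i] unfolding B'_def by simp
  ultimately show ?thesis using that[of "from_nat_into B'"] basis by simp
qed

abbreviation finU :: "(nat \<Rightarrow> 'a set) \<Rightarrow> nat list \<Rightarrow> 'a set" where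
  "finU U l \<equiv> \<Union>i\<in>set l. U i"

text \<open>Lists of indices code a countable family of open sets, and continuity from below
  recovers the measure of every open set from it.\<close>

lemma open_eq_increasing_finite_unions:
  assumes U: "topological_basis (range U)" and S: "open S"
  obtains l where "incseq (\<lambda>n. \<Union>i\<in>set (l n). U (i::nat))" "S = (\<Union>n. finU U (l n))"
proof
  let ?l = "\<lambda>n. filter (\<lambda>i. U i \<subseteq> S) [0..<n]"
  show "incseq (\<lambda>n. \<Union>i\<in>set (?l n). U i)" unfolding incseq_def
    by (intro allI impI UN_mono) auto
  show "S = (\<Union>n. \<Union>i\<in>set (?l n). U i)"
  proof (intro equalityI subsetI)
    fix x assume "x \<in> S"
    then obtain i where "x \<in> U i" "U i \<subseteq> S" using topological_basisE[OF U S] by blast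
    then show "x \<in> (\<Union>n. \<Union>i\<in>set (?l n). U i)" by (intro UN_I[of "Suc i"] UN_I[of i]) auto
  qed auto
qed

lemma borel_measure_eqI_open:
  fixes M N :: "'a::polish_space measure"
  assumes "sets M = sets borel" "sets N = sets borel" "finite_measure M"
    and eq: "\<And>S. open S \<Longrightarrow> emeasure M S = emeasure N S"
  shows "M = N"
proof (rule measure_eqI_generator_eq[where E = "{S. open S}" and \<Omega> = UNIV and A = "\<lambda>_. UNIV"])
  show "Int_stable {S::'a set. open S}" by (auto simp: Int_stable_def)
  show "sets M = sigma_sets UNIV {S. open S}" "sets N = sigma_sets UNIV {S. open S}"
    using assms by (simp_all add: borel_def)
  show "emeasure M UNIV \<noteq> \<infinity>" using finite_measure.emeasure_finite[OF assms(3)] by simp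
qed (use eq in auto)

text \<open>\<open>infdist\<close> to the empty set is 0 by convention, hence the separate case of
  the whole space.\<close>

definition bump :: "'a::metric_space set \<Rightarrow> nat \<Rightarrow> 'a \<Rightarrow> real" where
  "bump V n x = (if V = UNIV then 1 else min 1 (real n * infdist x (- V)))"

lemma bump_range: "0 \<le> bump V n x" "bump V n x \<le> 1"
  by (auto simp: bump_def infdist_nonneg)

lemma bump_zero: "x \<notin> V \<Longrightarrow> bump V n x = 0"
  by (auto simp: bump_def)

lemma continuous_bump: "continuous_on UNIV (bump V n)"
  unfolding bump_def by (cases "V = UNIV") (auto intro!: continuous_intros)

lemma bump_tendsto:
  assumes "open V"
  shows "(\<lambda>n. bump V n x) \<longlonglongrightarrow> indicator V x"
proof (cases "x \<in> V \<and> V \<noteq> UNIV")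
  case True
  then have pos: "0 < infdist x (- V)"
    using infdist_pos_not_in_closed[of "- V" x] assms by auto
  then obtain N where N: "1 < real N * infdist x (- V)" using ex_less_of_nat_mult by blast
  have "bump V n x = 1" if "n \<ge> N" for n
  proof -
    have "real N * infdist x (- V) \<le> real n * infdist x (- V)"
      using that pos by (intro mult_right_mono) auto
    then show ?thesis using N True by (auto simp: bump_def)
  qed
  then show ?thesis using True
    by (intro tendsto_eventually) (auto simp: eventually_sequentially)
next
  case False
  then show ?thesis by (cases "V = UNIV") (auto simp: bump_def[abs_def])
qed

lemma bump_measurable[measurable]:
  "bump V n \<in> borel_measurable borel"
  using continuous_bump by (rule borel_measurable_continuous_onI)

lemma integral_bump_tendsto:
  fixes M :: "'a::polish_space measure"
  assumes "open V" "prob_space M" "sets M = sets borel"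
  shows "(\<lambda>n. \<integral>x. bump V n x \<partial>M) \<longlonglongrightarrow> measure M V"
proof -
  interpret prob_space M by fact
  note [measurable_cong] = assms(3)
  have [measurable]: "V \<in> sets borel" using assms(1) by simp
  have "(\<lambda>n. \<integral>x. bump V n x \<partial>M) \<longlonglongrightarrow> (\<integral>x. indicator V x \<partial>M)"
    using bump_tendsto[OF assms(1)] assms(1)
    by (intro integral_dominated_convergence[where w = "\<lambda>_. 1"]) (auto simp: bump_range abs_of_nonneg)
  then show ?thesis using assms by simp
qed

lemma range_basis_open: "topological_basis (range U) \<Longrightarrow> open (U i)"
  using topological_basis_open by blast

text \<open>Through the last property, convergence of the integrals of the test functions controls tightness.\<close>

lemma ex_test_functions:
  assumes "\<And>x::'a::polish_space. \<exists>W. open W \<and> x \<in> W \<and> compact (closure W)"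
  obtains h :: "nat \<Rightarrow> 'a::polish_space \<Rightarrow> real"
  where "\<And>i. continuous_on UNIV (h i)" "\<And>i x. 0 \<le> h i x" "\<And>i x. h i x \<le> 1"
    "\<And>M N. prob_space M \<Longrightarrow> prob_space N \<Longrightarrow> sets M = sets borel \<Longrightarrow> sets N = sets borel \<Longrightarrow>
       (\<And>i. (\<integral>x. h i x \<partial>M) = (\<integral>x. h i x \<partial>N)) \<Longrightarrow> M = N"
    "\<And>M e. prob_space M \<Longrightarrow> sets M = sets borel \<Longrightarrow> 0 < e \<Longrightarrow>
       \<exists>K i. compact K \<and> (\<forall>x. x \<notin> K \<longrightarrow> h i x = 0) \<and> 1 - e < (\<integral>x. h i x \<partial>M)
         \<and> measure M (- K) < e"
proof -
  obtain U :: "nat \<Rightarrow> 'a set" where U: "topological_basis (range U)" "\<And>i. compact (closure (U i))"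
    using ex_open_basis_compact_closure[OF assms] by blast
  note Uo = range_basis_open[OF U(1)]
  define V where "V l = (\<Union>i\<in>set l. U i)" for l
  have Vo: "open (V l)" for l unfolding V_def using Uo by auto
  have Vc: "compact (closure (V l))" for l
    unfolding V_def using U(2) by (induction l) (auto simp: compact_Un)
  \<comment> \<open>A single enumeration runs through both the code of the open set and the
    steepness of the bump.\<close>
  define h where "h i = (case from_nat i of (l, n) \<Rightarrow> bump (V l) n)" for i
  have h: "h (to_nat (l, n)) = bump (V l) n" for l n unfolding h_def by simp
  show ?thesis
  proof
    show "continuous_on UNIV (h i)" for i
      unfolding h_def by (auto split: prod.split intro!: continuous_bump)
    show "0 \<le> h i x" "h i x \<le> 1" for i x
      unfolding h_def by (auto split: prod.split simp: bump_range)
  next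
    fix M N :: "'a measure"
    assume M: "prob_space M" "sets M = sets borel" and N: "prob_space N" "sets N = sets borel"
      and eq: "\<And>i. (\<integral>x. h i x \<partial>M) = (\<integral>x. h i x \<partial>N)"
    interpret M: prob_space M by fact
    interpret N: prob_space N by fact
    have Veq: "measure M (V l) = measure N (V l)" for l
    proof (rule LIMSEQ_unique)
      show "(\<lambda>n. \<integral>x. bump (V l) n x \<partial>M) \<longlonglongrightarrow> measure M (V l)"
        using integral_bump_tendsto[OF Vo M] .
      show "(\<lambda>n. \<integral>x. bump (V l) n x \<partial>M) \<longlonglongrightarrow> measure N (V l)"
        using integral_bump_tendsto[OF Vo N, of l] eq[of "to_nat (l, n :: nat)" for n] unfolding h by simp
    qed
    show "M = N"
    proof (rule borel_measure_eqI_open[OF M(2) N(2) M.finite_measure_axioms])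
      fix S :: "'a set" assume "open S"
      then obtain l where l: "incseq (\<lambda>n. V (l n))" "S = (\<Union>n. V (l n))"
        using open_eq_increasing_finite_unions[OF U(1), of S] unfolding V_def by metis
      have "(\<lambda>n. measure M (V (l n))) \<longlonglongrightarrow> measure M S"
        unfolding l(2) using M Vo by (intro M.finite_Lim_measure_incseq l(1)) auto
      moreover have "(\<lambda>n. measure N (V (l n))) \<longlonglongrightarrow> measure N S"
        unfolding l(2) using N Vo by (intro N.finite_Lim_measure_incseq l(1)) auto
      ultimately have "measure M S = measure N S"
        unfolding Veq by (rule LIMSEQ_unique)
      then show "emeasure M S = emeasure N S"
        by (simp add: M.emeasure_eq_measure N.emeasure_eq_measure)
    qed
  next
    fix M :: "'a measure" and e :: real
    assume M: "prob_space M" "sets M = sets borel" and e: "0 < e"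
    interpret M: prob_space M by fact
    obtain l where l: "incseq (\<lambda>n. V (l n))" "UNIV = (\<Union>n. V (l n))"
      using open_eq_increasing_finite_unions[OF U(1), of UNIV] unfolding V_def by auto
    have "(\<lambda>n. measure M (V (l n))) \<longlonglongrightarrow> measure M (\<Union>n. V (l n))"
      using M Vo by (intro M.finite_Lim_measure_incseq l(1)) auto
    then have "(\<lambda>n. measure M (V (l n))) \<longlonglongrightarrow> 1"
      using M.prob_space sets_eq_imp_space_eq[OF M(2)] by (simp flip: l(2))
    then obtain n where n: "1 - e < measure M (V (l n))"
      using order_tendstoD(1)[of _ 1 sequentially "1 - e"] e by (auto simp: eventually_sequentially)
    obtain m where m: "1 - e < (\<integral>x. bump (V (l n)) m x \<partial>M)"
      using order_tendstoD(1)[OF integral_bump_tendsto[OF Vo M, of "l n"] n]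
      by (auto simp: eventually_sequentially)
    have "measure M (- closure (V (l n))) \<le> measure M (space M - V (l n))"
      using M(2) sets_eq_imp_space_eq[OF M(2)] Vo closure_subset[of "V (l n)"] by (intro M.finite_measure_mono) auto
    also have "\<dots> < e" using n M(2) Vo by (subst M.prob_compl) auto
    finally have "measure M (- closure (V (l n))) < e" .
    moreover have "compact (closure (V (l n)))" by (rule Vc)
    moreover have "\<forall>x. x \<notin> closure (V (l n)) \<longrightarrow> h (to_nat (l n, m)) x = 0"
      unfolding h using bump_zero closure_subset by blast
    ultimately show "\<exists>K i. compact K \<and> (\<forall>x. x \<notin> K \<longrightarrow> h i x = 0) \<and> 1 - e < (\<integral>x. h i x \<partial>M)
         \<and> measure M (- K) < e"
      using m unfolding h[symmetric] by blast
  qed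
qed

text \<open>Outer regularity replaces A by an open set at the price e / 2, and the increasing coded
  sets exhaust that open set up to another e / 2. The countable family of codes is thus dense in
  measure.\<close>

lemma approx_by_finite_union:
  fixes M :: "'a::polish_space measure"
  assumes U: "topological_basis (range (U :: nat \<Rightarrow> 'a set))"
    and M: "prob_space M" "sets M = sets borel" and A: "A \<in> sets borel" and e: "0 < e"
  obtains l where "measure M (sym_diff A (finU U l)) < e"
proof -
  interpret M: prob_space M by fact
  note Uo = range_basis_open[OF U(1)]
  have sp: "space M = UNIV" using sets_eq_imp_space_eq[OF M(2)] by simp
  have "emeasure M A < emeasure M A + ennreal (e / 2)"
    using e by (simp add: M.emeasure_eq_measure ennreal_less_iff flip: ennreal_plus)
  moreover have "emeasure M A = (INF S\<in>{S. A \<subseteq> S \<and> open S}. emeasure M S)"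
    using M A by (intro outer_regular) auto
  ultimately have "\<exists>S. A \<subseteq> S \<and> open S \<and> emeasure M S < emeasure M A + ennreal (e / 2)"
    by (metis (mono_tags, lifting) INF_less_iff mem_Collect_eq)
  then obtain S where S: "open S" "A \<subseteq> S" and "emeasure M S < emeasure M A + ennreal (e / 2)" by blast
  then have "measure M S < measure M A + e / 2"
    using e by (simp add: M.emeasure_eq_measure ennreal_less_iff flip: ennreal_plus)
  moreover have Sm: "S \<in> sets M" "A \<in> sets M" using S A M by auto
  ultimately have SA: "measure M (S - A) < e / 2" using S by (simp add: M.finite_measure_Diff)
  obtain l where l: "incseq (\<lambda>n. finU U (l n))" "S = (\<Union>n. finU U (l n))"
    using open_eq_increasing_finite_unions[OF U(1) S(1)] by blast
  have "(\<lambda>n. measure M (finU U (l n))) \<longlonglongrightarrow> measure M (\<Union>n. finU U (l n))"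
    using M Uo by (intro M.finite_Lim_measure_incseq l(1)) auto
  then have "(\<lambda>n. measure M (finU U (l n))) \<longlonglongrightarrow> measure M S" using l(2) by simp
  then have "\<forall>\<^sub>F n in sequentially. measure M S - e/2 < measure M (finU U (l n))"
    using e by (intro order_tendstoD(1)) auto
  then obtain n where n: "measure M S - e/2 < measure M (finU U (l n))"
    by (auto simp: eventually_sequentially)
  let ?V = "finU U (l n)"
  have VS: "?V \<subseteq> S" using l(2) by blast
  have Vm: "?V \<in> sets M" using M Uo by auto
  have "measure M (sym_diff A ?V) \<le> measure M ((S - ?V) \<union> (S - A))"
    using S VS Vm Sm by (intro M.finite_measure_mono) auto
  also have "\<dots> \<le> measure M (S - ?V) + measure M (S - A)"
    using Vm Sm by (intro measure_Un_le) auto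
  also have "measure M (S - ?V) = measure M S - measure M ?V"
    using Vm Sm VS by (intro M.finite_measure_Diff) auto
  finally show ?thesis using n SA by (intro that[of "l n"]) linarith
qed

text \<open>Subtraction in \<open>ennreal\<close> truncates at 0, so this is a weight for every f,
  and the missing mass when f is a subdensity.\<close>

abbreviation stay :: "'a measure \<Rightarrow> ('a \<Rightarrow> real) \<Rightarrow> ennreal" where
  "stay M f \<equiv> 1 - (\<integral>\<^sup>+ y. f y \<partial>M)"

section \<open>Kernels with an atom at the starting point\<close>

text \<open>The kernels of the couplings under consideration: move according to \<open>f\<close>, otherwise stay at \<open>x\<close>.\<close>

definition mix :: "'a::polish_space measure \<Rightarrow> ('a \<Rightarrow> real) \<Rightarrow> 'a \<Rightarrow> 'a measure" where
  "mix M f x = measure_of UNIV (sets borel)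
     (\<lambda>B. (\<integral>\<^sup>+ y. ennreal (f y) * indicator B y \<partial>M) + stay M f * indicator B x)"

lemma sets_mix[simp, measurable_cong]: "sets (mix M f x) = sets borel"
  unfolding mix_def by (simp add: sigma_algebra.sets_measure_of_eq[OF sets.sigma_algebra_axioms[of borel, simplified]])

lemma space_mix[simp]: "space (mix M f x) = UNIV"
  using sets_eq_imp_space_eq[OF sets_mix] by simp

lemma emeasure_mix:
  assumes M: "sets M = sets borel" and f: "f \<in> borel_measurable borel" and B: "B \<in> sets borel"
  shows "emeasure (mix M f x) B =
    (\<integral>\<^sup>+ y. ennreal (f y) * indicator B y \<partial>M) + stay M f * indicator B x"
proof -
  let ?n = "\<lambda>B. (\<integral>\<^sup>+ y. ennreal (f y) * indicator B y \<partial>M) + stay M f * indicator B x"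
  note [measurable_cong] = M
  note [measurable] = f
  let ?D = "density M (\<lambda>y. ennreal (f y))"
  have D: "(\<integral>\<^sup>+ y. ennreal (f y) * indicator A y \<partial>M) = emeasure ?D A" if "A \<in> sets borel" for A
    using that M by (subst emeasure_density) auto
  have R: "stay M f * indicator A x = stay M f * emeasure (return borel x) A"
    if "A \<in> sets borel" for A using that by simp
  show ?thesis
  proof (rule emeasure_measure_of_sigma[where \<Omega> = UNIV and M = "sets borel" and A = B and
        \<mu> = ?n,
        folded mix_def])
    show "sigma_algebra UNIV (sets (borel :: 'a measure))"
      using sets.sigma_algebra_axioms[of "borel :: 'a measure"] by simp
    show "positive (sets borel) ?n"
      by (simp add: positive_def)
    show "countably_additive (sets borel) ?n"
    proof (rule countably_additiveI)
      fix A :: "nat \<Rightarrow> 'a set"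
      assume A: "range A \<subseteq> sets borel" "disjoint_family A" "(\<Union>i. A i) \<in> sets borel"
      then have Ai: "A i \<in> sets borel" for i by auto
      have 1: "(\<Sum>i. emeasure ?D (A i)) = emeasure ?D (\<Union>i. A i)"
        using A M by (intro suminf_emeasure) auto
      have 2: "(\<Sum>i. emeasure (return borel x) (A i)) = emeasure (return borel x) (\<Union>i. A i)"
        using A by (intro suminf_emeasure) auto
      show "(\<Sum>i. (\<integral>\<^sup>+ y. ennreal (f y) * indicator (A i) y \<partial>M) + stay M f * indicator (A i) x)
        = (\<integral>\<^sup>+ y. ennreal (f y) * indicator (\<Union>i. A i) y \<partial>M) + stay M f * indicator (\<Union>i. A i) x"
        unfolding D[OF Ai] D[OF A(3)] R[OF Ai] R[OF A(3)]
        by (subst suminf_add[symmetric, OF summableI summableI]) (simp only: 1 2 ennreal_suminf_cmult)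
    qed
  qed (use B in auto)
qed

lemma nn_integral_mix:
  assumes M: "sets M = sets borel" and f: "f \<in> borel_measurable borel"
    and g: "g \<in> borel_measurable borel"
  shows "(\<integral>\<^sup>+ y. g y \<partial>mix M f x) = (\<integral>\<^sup>+ y. ennreal (f y) * g y \<partial>M) + stay M f * g x"
proof -
  note [measurable_cong] = M
  note [measurable] = f
  show ?thesis
    using g
  proof (induction g rule: borel_measurable_induct)
    case (cong f g)
    then show ?case by (simp cong: nn_integral_cong)
  next
    case (set A)
    then show ?case using M f by (simp add: emeasure_mix)
  next
    case (mult u c)
    note [measurable] = mult(2)
    have "(\<integral>\<^sup>+ y. ennreal (f y) * (c * u y) \<partial>M) = (\<integral>\<^sup>+ y. c * (ennreal (f y) * u y) \<partial>M)"
      by (simp add: mult.left_commute)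
    also have "\<dots> = c * (\<integral>\<^sup>+ y. ennreal (f y) * u y \<partial>M)"
      by (rule nn_integral_cmult) measurable
    finally show ?case using mult by (simp add: nn_integral_cmult distrib_left mult.left_commute)
  next
    case (add u v)
    have [measurable]: "u \<in> borel_measurable borel" "v \<in> borel_measurable borel" using add by auto
    have "(\<integral>\<^sup>+ y. ennreal (f y) * (v y + u y) \<partial>M) = (\<integral>\<^sup>+ y. ennreal (f y) * v y + ennreal (f y) * u y \<partial>M)"
      by (simp add: distrib_left)
    also have "\<dots> = (\<integral>\<^sup>+ y. ennreal (f y) * v y \<partial>M) + (\<integral>\<^sup>+ y. ennreal (f y) * u y \<partial>M)"
      by (rule nn_integral_add) measurable
    finally show ?case using add by (simp add: nn_integral_add distrib_left add_ac)
  next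
    case (seq U)
    note [measurable] = seq(1)
    have inc: "incseq (\<lambda>i y. ennreal (f y) * U i y)"
      using seq(3) by (auto simp: incseq_def le_fun_def intro: mult_left_mono)
    have "(\<integral>\<^sup>+ y. ennreal (f y) * (SUP i. U i) y \<partial>M) = (\<integral>\<^sup>+ y. (SUP i. ennreal (f y) * U i y) \<partial>M)"
      by (simp only: SUP_apply SUP_mult_left_ennreal)
    also have "\<dots> = (SUP i. \<integral>\<^sup>+ y. ennreal (f y) * U i y \<partial>M)"
      by (rule nn_integral_monotone_convergence_SUP[OF inc]) measurable
    finally have 1: "(\<integral>\<^sup>+ y. ennreal (f y) * (SUP i. U i) y \<partial>M) = (SUP i. \<integral>\<^sup>+ y. ennreal (f y) * U i y \<partial>M)" .
    have "(\<integral>\<^sup>+ y. (SUP i. U i) y \<partial>mix M f x) = (SUP i. \<integral>\<^sup>+ y. U i y \<partial>mix M f x)"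
      unfolding SUP_apply using seq(3) by (intro nn_integral_monotone_convergence_SUP) auto
    also have "\<dots> = (SUP i. (\<integral>\<^sup>+ y. ennreal (f y) * U i y \<partial>M) + stay M f * U i x)"
      using seq by simp
    also have "\<dots> = (SUP i. \<integral>\<^sup>+ y. ennreal (f y) * U i y \<partial>M) + (SUP i. stay M f * U i x)"
      using seq(3) by (intro ennreal_SUP_add)
        (auto simp: incseq_def le_fun_def intro!: nn_integral_mono mult_left_mono)
    also have "(SUP i. stay M f * U i x) = stay M f * (SUP i. U i) x"
      by (simp only: SUP_apply SUP_mult_left_ennreal)
    finally show ?case unfolding 1 .
  qed
qed

lemma prob_space_mix:
  assumes M: "sets M = sets borel" and f: "f \<in> borel_measurable borel"
    and le: "(\<integral>\<^sup>+ y. f y \<partial>M) \<le> 1"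
  shows "prob_space (mix M f x)"
proof (rule prob_spaceI)
  show "emeasure (mix M f x) (space (mix M f x)) = 1"
    using emeasure_mix[OF M f, of UNIV x] le by (simp add: ennreal_add_diff_cancel_right add_diff_inverse_ennreal)
qed

lemma integral_mix_nonneg:
  assumes M: "sets M = sets borel" and f: "f \<in> borel_measurable borel" "\<And>y. 0 \<le> f y"
    and le: "(\<integral>\<^sup>+ y. f y \<partial>M) \<le> 1"
    and h: "h \<in> borel_measurable borel" "\<And>y. 0 \<le> h y" and int: "integrable (mix M f x) h"
  shows "integrable M (\<lambda>y. f y * h y)"
    "(\<integral>y. h y \<partial>mix M f x) = (\<integral>y. f y * h y \<partial>M) + (1 - (\<integral>y. f y \<partial>M)) * h x"
proof -
  note [measurable_cong] = M
  note [measurable] = f(1) h(1)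
  have eq: "ennreal (\<integral>y. h y \<partial>mix M f x) = (\<integral>\<^sup>+ y. ennreal (f y * h y) \<partial>M) + stay M f * ennreal (h x)"
    using nn_integral_mix[OF M f(1), of "\<lambda>y. ennreal (h y)" x] h f(2) nn_integral_eq_integral[OF int]
    by (simp add: ennreal_mult)
  show int1: "integrable M (\<lambda>y. f y * h y)"
  proof (rule integrableI_bounded)
    have "(\<integral>\<^sup>+ y. ennreal (norm (f y * h y)) \<partial>M) = (\<integral>\<^sup>+ y. ennreal (f y * h y) \<partial>M)"
      using f(2) h(2) by simp
    also have "\<dots> \<le> ennreal (\<integral>y. h y \<partial>mix M f x)" unfolding eq by simp
    also have "\<dots> < \<infinity>" by simp
    finally show "(\<integral>\<^sup>+ y. ennreal (norm (f y * h y)) \<partial>M) < \<infinity>" .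
  qed measurable
  have intf: "integrable M f"
    using f le by (intro integrableI_bounded) (auto intro: le_less_trans)
  have f1: "(\<integral>\<^sup>+ y. f y \<partial>M) = ennreal (\<integral>y. f y \<partial>M)"
    using intf f by (intro nn_integral_eq_integral) auto
  have f2: "(\<integral>y. f y \<partial>M) \<le> 1" using le unfolding f1 by simp
  have f3: "0 \<le> (\<integral>y. f y \<partial>M)" using f(2) by simp
  have f4: "0 \<le> (\<integral>y. f y * h y \<partial>M)" using f(2) h(2) by simp
  have f5: "0 \<le> (\<integral>y. h y \<partial>mix M f x)" using h(2) by simp
  have "ennreal (\<integral>y. h y \<partial>mix M f x) = ennreal ((\<integral>y. f y * h y \<partial>M) + (1 - (\<integral>y. f y \<partial>M)) * h x)"
    unfolding eq f1 using int1 f(2) h(2) f2 f3 f4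
    by (subst nn_integral_eq_integral) (auto simp: ennreal_mult ennreal_plus ennreal_minus ennreal_1[symmetric] simp del: ennreal_1)
  then show "(\<integral>y. h y \<partial>mix M f x) = (\<integral>y. f y * h y \<partial>M) + (1 - (\<integral>y. f y \<partial>M)) * h x"
    using f2 f4 f5 h(2)[of x] by (subst (asm) ennreal_inj) auto
qed

text \<open>The formula is written with the differences \<open>h y - h x\<close>: the atom collects
  exactly the mass that does not move, and for continuous h what remains is small near the diagonal.
  Positive and negative parts are treated separately because integrability under the product with f
  has to be derived first.\<close>

lemma integral_mix:
  assumes M: "sets M = sets borel" and f: "f \<in> borel_measurable borel" "\<And>y. 0 \<le> f y"
    and le: "(\<integral>\<^sup>+ y. f y \<partial>M) \<le> 1"
    and h: "h \<in> borel_measurable borel" and int: "integrable (mix M f x) h"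
  shows "integrable M (\<lambda>y. (h y - h x) * f y)"
    "(\<integral>y. h y \<partial>mix M f x) = h x + (\<integral>y. (h y - h x) * f y \<partial>M)"
proof -
  note [measurable_cong] = M
  note [measurable] = f(1) h(1)
  let ?p = "\<lambda>y. max 0 (h y)" and ?n = "\<lambda>y. max 0 (- h y)"
  have i: "integrable (mix M f x) ?p" "integrable (mix M f x) ?n"
    using int by auto
  note p = integral_mix_nonneg[OF M f le _ _ i(1)] integral_mix_nonneg[OF M f le _ _ i(2)]
  have p1: "integrable M (\<lambda>y. f y * ?p y)" "integrable M (\<lambda>y. f y * ?n y)"
    by (rule p; simp)+
  have e1: "(\<integral>y. ?p y \<partial>mix M f x) = (\<integral>y. f y * ?p y \<partial>M) + (1 - (\<integral>y. f y \<partial>M)) * ?p x"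
    "(\<integral>y. ?n y \<partial>mix M f x) = (\<integral>y. f y * ?n y \<partial>M) + (1 - (\<integral>y. f y \<partial>M)) * ?n x"
    by (rule p; simp)+
  have d: "?p y - ?n y = h y" for y by auto
  have d': "f y * h y = f y * ?p y - f y * ?n y" for y
    by (metis d right_diff_distrib)
  have if1: "integrable M (\<lambda>y. f y * h y)" unfolding d' by (intro Bochner_Integration.integrable_diff p1)
  have intf: "integrable M f"
    using f le by (intro integrableI_bounded) (auto intro: le_less_trans)
  have r: "(h y - h x) * f y = f y * h y - h x * f y" for y by (simp add: algebra_simps)
  show "integrable M (\<lambda>y. (h y - h x) * f y)"
    unfolding r using if1 intf by auto
  have "(\<integral>y. h y \<partial>mix M f x) = (\<integral>y. ?p y - ?n y \<partial>mix M f x)" unfolding d ..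
  also have "\<dots> = (\<integral>y. ?p y \<partial>mix M f x) - (\<integral>y. ?n y \<partial>mix M f x)"
    by (rule Bochner_Integration.integral_diff[OF i])
  also have "\<dots> = (\<integral>y. f y * h y \<partial>M) + (1 - (\<integral>y. f y \<partial>M)) * (?p x - ?n x)"
    unfolding e1 d' Bochner_Integration.integral_diff[OF p1] by (simp only: algebra_simps)
  also have "\<dots> = h x + (\<integral>y. (h y - h x) * f y \<partial>M)"
    unfolding r d using if1 intf by (simp add: algebra_simps)
  finally show "(\<integral>y. h y \<partial>mix M f x) = h x + (\<integral>y. (h y - h x) * f y \<partial>M)" .
qed

abbreviation (input) borel2 :: "('a::topological_space \<times> 'a) measure" where
  "borel2 \<equiv> borel \<Otimes>\<^sub>M borel"

lemma mix_kernel: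
  assumes M: "sets M = sets borel" "sigma_finite_measure M" and F: "F \<in> borel_measurable borel2"
    and le: "\<And>x. (\<integral>\<^sup>+ y. ennreal (F (x, y)) \<partial>M) \<le> 1"
  shows "(\<lambda>x. mix M (\<lambda>y. F (x, y)) x) \<in> borel \<rightarrow>\<^sub>M prob_algebra borel"
proof (rule measurable_prob_algebraI)
  interpret sigma_finite_measure M by fact
  note [measurable_cong] = M(1)
  note [measurable] = F
  have Fx: "(\<lambda>y. F (x, y)) \<in> borel_measurable borel" for x by measurable
  show p: "prob_space (mix M (\<lambda>y. F (x, y)) x)" for x
    by (rule prob_space_mix[OF M(1) Fx le])
  show "(\<lambda>x. mix M (\<lambda>y. F (x, y)) x) \<in> borel \<rightarrow>\<^sub>M subprob_algebra borel"
  proof (rule measurable_subprob_algebra)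
    show "subprob_space (mix M (\<lambda>y. F (x, y)) x)" for x
      using p by (rule prob_space_imp_subprob_space)
    fix A :: "'a set" assume [measurable]: "A \<in> sets borel"
    show "(\<lambda>x. emeasure (mix M (\<lambda>y. F (x, y)) x) A) \<in> borel_measurable borel"
      by (subst emeasure_mix[OF M(1) Fx]) (measurable)
  qed simp
qed

section \<open>The cost of a kernel\<close>

text \<open>Composition with \<open>max 0\<close> extends a function on the half-line to the real
  line, where lower semicontinuity becomes openness of the superlevel sets.\<close>

lemma lsc_on_open_superlevel:
  fixes f :: "real \<Rightarrow> 'b::linorder"
  assumes "lsc_on {0..} f"
  shows "open {t. a < f (max 0 t)}"
proof (subst open_subopen, intro ballI)
  fix x assume x: "x \<in> {t. a < f (max 0 t)}"
  have "\<forall>\<^sub>F y in at (max 0 x) within {0..}. a < f y"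
    using assms x unfolding lsc_on_def by auto
  then have "\<forall>\<^sub>F y in nhds (max 0 x). 0 \<le> y \<longrightarrow> a < f y"
    unfolding eventually_at_filter using x by (auto elim!: eventually_mono)
  moreover have "filterlim (\<lambda>t. max 0 t) (nhds (max 0 x)) (nhds x)"
    by (intro tendsto_max tendsto_const) (simp add: filterlim_ident)
  ultimately have "\<forall>\<^sub>F t in nhds x. 0 \<le> max 0 t \<longrightarrow> a < f (max 0 t)"
    unfolding filterlim_iff by blast
  then have "\<forall>\<^sub>F t in nhds x. t \<in> {t. a < f (max 0 t)}" by simp
  then show "\<exists>T. open T \<and> x \<in> T \<and> T \<subseteq> {t. a < f (max 0 t)}"
    unfolding eventually_nhds by blast
qed

lemma lsc_on_borel_measurable:
  fixes f :: "real \<Rightarrow> 'b::{linorder_topology, second_countable_topology}"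
  assumes "lsc_on {0..} f" and g: "g \<in> borel_measurable M" "\<And>x. x \<in> space M \<Longrightarrow> 0 \<le> g x"
  shows "(\<lambda>x. f (g x)) \<in> borel_measurable M"
proof -
  have "(\<lambda>t. f (max 0 t)) \<in> borel_measurable borel"
    using lsc_on_open_superlevel[OF assms(1)] by (intro borel_measurableI_greater) auto
  then have "(\<lambda>x. f (max 0 (g x))) \<in> borel_measurable M"
    using g(1) by (rule measurable_compose_rev)
  then show ?thesis by (rule measurable_cong[THEN iffD1, rotated]) (use g(2) in auto)
qed

locale weak_transport =
  fixes \<beta> :: "real \<Rightarrow> ennreal" and \<gamma> :: "real \<Rightarrow> real" and \<mu>0 :: "'a::polish_space measure" and xo :: 'a
  assumes beta_lsc: "lsc_on {0..} \<beta>"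
    and beta_convex: "ennreal_convex_on {0..} \<beta>"
    and beta_0: "\<beta> 0 = 0"
    and beta_superlinear: "((\<lambda>x. \<beta> x / ennreal x) \<longlongrightarrow> \<infinity>) at_top"
    and gamma_nonneg: "\<And>u. u \<ge> 0 \<Longrightarrow> \<gamma> u \<ge> 0"
    and gamma_lsc: "lsc_on {0..} \<gamma>"
    and gamma_0: "\<gamma> 0 = 0"
    and gamma_pos: "\<And>u. u > 0 \<Longrightarrow> \<gamma> u > 0"
    and prob_\<mu>0: "prob_space \<mu>0" and sets_\<mu>0[measurable_cong]: "sets \<mu>0 = sets borel"
begin

sublocale \<mu>0: prob_space \<mu>0 by (rule prob_\<mu>0)

lemma space_\<mu>0[simp]: "space \<mu>0 = UNIV"
  using sets_eq_imp_space_eq[OF sets_\<mu>0] by simp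

lemma beta_convexD:
  assumes "0 \<le> x" "0 \<le> y" "0 \<le> t" "t \<le> 1"
  shows "\<beta> ((1 - t) * x + t * y) \<le> ennreal (1 - t) * \<beta> x + ennreal t * \<beta> y"
  using beta_convex assms unfolding ennreal_convex_on_def by simp

text \<open>s is a convex combination of 0 and t, and \<beta> vanishes at 0.\<close>

lemma beta_mono:
  assumes "0 \<le> s" "s \<le> t"
  shows "\<beta> s \<le> \<beta> t"
proof (cases "t = 0")
  case False
  then have t: "0 < t" using assms by simp
  then have "\<beta> s \<le> ennreal (s / t) * \<beta> t"
    using beta_convexD[of 0 t "s / t"] assms by (simp add: beta_0)
  also have "\<dots> \<le> 1 * \<beta> t" using assms t by (intro mult_right_mono) auto
  finally show ?thesis by simp
qed (use assms in auto)

lemma beta_measurable[measurable (raw)]: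
  assumes "g \<in> borel_measurable M" "\<And>x. 0 \<le> g x"
  shows "(\<lambda>x. \<beta> (g x)) \<in> borel_measurable M"
  by (rule lsc_on_borel_measurable[OF beta_lsc assms])

abbreviation \<gamma>d :: "'a \<times> 'a \<Rightarrow> real" where
  "\<gamma>d z \<equiv> \<gamma> (dist (fst z) (snd z))"

lemma gamma_dist_nonneg[simp]: "0 \<le> \<gamma> (dist x y)"
  by (simp add: gamma_nonneg)

lemma gamma_dist_pos: "x \<noteq> y \<Longrightarrow> 0 < \<gamma> (dist x y)"
  by (simp add: gamma_pos)

lemma gamma_dist_measurable[measurable (raw)]:
  assumes [measurable]: "f \<in> M \<rightarrow>\<^sub>M borel" "g \<in> M \<rightarrow>\<^sub>M (borel :: 'a measure)"
  shows "(\<lambda>x. \<gamma> (dist (f x) (g x))) \<in> borel_measurable M"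
  by (rule lsc_on_borel_measurable[OF gamma_lsc]) auto

lemma beta_le_liminf:
  assumes "(u \<longlongrightarrow> l) sequentially" "\<And>k. 0 \<le> u k"
  shows "\<beta> l \<le> liminf (\<lambda>k. \<beta> (u k))"
proof (rule le_Liminf_iff[THEN iffD2], intro allI impI)
  fix a assume a: "a < \<beta> l"
  have l: "0 \<le> l" using assms by (intro LIMSEQ_le_const) auto
  have "open {t. a < \<beta> (max 0 t)}" using lsc_on_open_superlevel[OF beta_lsc] .
  then have "\<forall>\<^sub>F k in sequentially. u k \<in> {t. a < \<beta> (max 0 t)}"
    using assms(1) a l by (intro topological_tendstoD) auto
  then show "\<forall>\<^sub>F k in sequentially. a < \<beta> (u k)"
    using assms(2) by (auto elim!: eventually_mono)
qed

lemma beta_superlinearD: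
  assumes "0 \<le> L"
  obtains R where "0 < R" "\<And>t. R \<le> t \<Longrightarrow> ennreal (L * t) \<le> \<beta> t"
proof -
  have "\<forall>\<^sub>F x in at_top. ennreal L < \<beta> x / ennreal x"
    using beta_superlinear by (intro order_tendstoD(1)) auto
  then obtain R where R: "\<And>x. R \<le> x \<Longrightarrow> ennreal L < \<beta> x / ennreal x"
    by (auto simp: eventually_at_top_linorder)
  show ?thesis
  proof
    show "0 < max R 1" by simp
    fix t assume t: "max R 1 \<le> t"
    then have "ennreal L * ennreal t \<le> \<beta> t / ennreal t * ennreal t"
      using R[of t] by (intro mult_right_mono) auto
    also have "\<dots> = \<beta> t * (ennreal t / ennreal t)"
      by (simp add: ennreal_times_divide mult.commute)
    also have "ennreal t / ennreal t = 1" using t by (simp add: divide_ennreal)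
    finally show "ennreal (L * t) \<le> \<beta> t" using assms t by (simp add: ennreal_mult)
  qed
qed

text \<open>Distances of points of K that are at least \<delta> fill part of a compact interval of
  positive numbers. Open superlevel sets of \<gamma> cover it because \<gamma> is positive there,
  and finitely many of them suffice.\<close>

lemma gamma_dist_bounded_below:
  assumes "compact (K :: 'a set)" "0 < \<delta>"
  obtains c where "0 < c" "\<And>x y. x \<in> K \<Longrightarrow> y \<in> K \<Longrightarrow> \<delta> \<le> dist x y \<Longrightarrow> c \<le> \<gamma> (dist x y)"
proof -
  obtain R where R: "\<And>x y. x \<in> K \<Longrightarrow> y \<in> K \<Longrightarrow> dist x y \<le> R"
    using compact_imp_bounded[OF assms(1)] unfolding bounded_two_points by blast
  define S where "S n = {t. 1 / real (Suc n) < \<gamma> (max 0 t)}" for n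
  have "{\<delta>..R} \<subseteq> (\<Union>n. S n)"
  proof
    fix t assume "t \<in> {\<delta>..R}"
    then have "0 < \<gamma> t" "0 \<le> t" using assms(2) gamma_pos by auto
    then show "t \<in> (\<Union>n. S n)" using nat_approx_posE[of "\<gamma> t"] unfolding S_def by auto
  qed
  moreover have "open (S n)" for n unfolding S_def by (rule lsc_on_open_superlevel[OF gamma_lsc])
  ultimately obtain I where I: "finite I" "{\<delta>..R} \<subseteq> (\<Union>n\<in>I. S n)"
    using compact_Icc[of \<delta> R] by (elim compactE_image[of _ UNIV S]) auto
  show ?thesis
  proof
    show "0 < 1 / real (Suc (Max (insert 0 I)))" by simp
    fix x y assume "x \<in> K" "y \<in> K" "\<delta> \<le> dist x y"
    then have "dist x y \<in> {\<delta>..R}" using R by simp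
    then obtain n where n: "n \<in> I" "dist x y \<in> S n" using I(2) by blast
    then have "1 / real (Suc (Max (insert 0 I))) \<le> 1 / real (Suc n)"
      using I(1) by (intro divide_left_mono) auto
    then show "1 / real (Suc (Max (insert 0 I))) \<le> \<gamma> (dist x y)"
      using n(2) unfolding S_def by simp
  qed
qed

definition bint :: "'a \<Rightarrow> ('a \<Rightarrow> real) \<Rightarrow> ennreal" where
  "bint x f = (\<integral>\<^sup>+ y. \<beta> (\<gamma> (dist x y) * f y) \<partial>\<mu>0)"

definition subdensity :: "('a \<Rightarrow> real) \<Rightarrow> bool" where
  "subdensity f \<longleftrightarrow> f \<in> borel_measurable borel \<and> (\<forall>y. 0 \<le> f y) \<and> (\<integral>\<^sup>+ y. f y \<partial>\<mu>0) \<le> 1"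

lemma subdensityD:
  assumes "subdensity f"
  shows "f \<in> borel_measurable borel" "0 \<le> f y" "(\<integral>\<^sup>+ y. f y \<partial>\<mu>0) \<le> 1"
    "integrable \<mu>0 f" "(\<integral>y. f y \<partial>\<mu>0) \<le> 1"
proof -
  show f: "f \<in> borel_measurable borel" "\<And>y. 0 \<le> f y" and le: "(\<integral>\<^sup>+ y. f y \<partial>\<mu>0) \<le> 1"
    using assms unfolding subdensity_def by auto
  show i: "integrable \<mu>0 f"
    using f le by (intro integrableI_bounded) (auto intro: le_less_trans)
  have "ennreal (\<integral>y. f y \<partial>\<mu>0) = (\<integral>\<^sup>+ y. f y \<partial>\<mu>0)"
    using i f(2) by (intro nn_integral_eq_integral[symmetric]) auto
  also have "\<dots> \<le> 1" by (rule le)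
  finally show "(\<integral>y. f y \<partial>\<mu>0) \<le> 1" by simp
qed

text \<open>The off-point part of \<open>mix\<close> has density f away from x, and Radon-Nikodym
  densities are unique almost everywhere. At y = x, which may carry \<mu>0-mass, the factor \<gamma>
  0 = 0 hides any disagreement.\<close>

lemma mix_subdensity:
  assumes "subdensity f"
  shows "ac_off \<mu>0 x (mix \<mu>0 f x)" "beta_integral \<beta> \<gamma> \<mu>0 x (mix \<mu>0 f x) = bint x f"
proof -
  note f = subdensityD[OF assms]
  note [measurable] = f(1)
  let ?g = "\<lambda>y. ennreal (f y) * indicator (- {x}) y"
  have off: "off_point x (mix \<mu>0 f x) = density \<mu>0 ?g"
  proof (rule measure_eqI)
    fix A assume "A \<in> sets (off_point x (mix \<mu>0 f x))"
    then have [measurable]: "A \<in> sets borel" by (simp add: off_point_def)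
    have "emeasure (off_point x (mix \<mu>0 f x)) A = (\<integral>\<^sup>+ y. indicator (- {x}) y * indicator A y \<partial>mix \<mu>0 f x)"
      unfolding off_point_def by (subst emeasure_density) auto
    also have "\<dots> = (\<integral>\<^sup>+ y. ennreal (f y) * (indicator (- {x}) y * indicator A y) \<partial>\<mu>0)"
      by (subst nn_integral_mix[OF sets_\<mu>0 f(1)]) auto
    also have "\<dots> = emeasure (density \<mu>0 ?g) A"
      by (subst emeasure_density) (auto simp: mult.assoc)
    finally show "emeasure (off_point x (mix \<mu>0 f x)) A = emeasure (density \<mu>0 ?g) A" .
  qed (simp add: off_point_def sets_\<mu>0)
  show "ac_off \<mu>0 x (mix \<mu>0 f x)"
    unfolding ac_off_def off by (rule absolutely_continuousI_density) measurable
  have "AE y in \<mu>0. ?g y = RN_deriv \<mu>0 (density \<mu>0 ?g) y"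
    by (rule \<mu>0.RN_deriv_unique) auto
  then have "AE y in \<mu>0. \<beta> (\<gamma> (dist x y) * enn2real (RN_deriv \<mu>0 (density \<mu>0 ?g) y)) = \<beta> (\<gamma> (dist x y) * f y)"
  proof eventually_elim
    case (elim y)
    have "\<gamma> (dist x y) * enn2real (?g y) = \<gamma> (dist x y) * f y"
      using f(2)[of y] by (cases "y = x") (auto simp: gamma_0)
    then show ?case unfolding elim[symmetric] by (rule arg_cong)
  qed
  then show "beta_integral \<beta> \<gamma> \<mu>0 x (mix \<mu>0 f x) = bint x f"
    unfolding beta_integral_def bint_def off by (rule nn_integral_cong_AE)
qed

text \<open>The converse of \<open>mix_subdensity\<close>, which turns the infimum in
  \<open>Q_hat\<close> into one over subdensities. f is a finite version of the Radon-Nikodym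
  derivative of the off-point part, and the mass that it lacks is the mass of p at x.\<close>

lemma ac_off_eq_mix:
  assumes p: "prob_space p" "sets p = sets borel" and ac: "ac_off \<mu>0 x p"
  obtains f where "subdensity f" "p = mix \<mu>0 f x"
proof -
  interpret p: prob_space p by fact
  note [measurable_cong] = p(2)
  have sp: "space p = UNIV" using sets_eq_imp_space_eq[OF p(2)] by simp
  let ?o = "off_point x p"
  have so: "sets ?o = sets \<mu>0" by (simp add: off_point_def p sets_\<mu>0)
  have eo: "emeasure ?o B = emeasure p (B - {x})" if [measurable]: "B \<in> sets borel" for B
  proof -
    have "emeasure ?o B = (\<integral>\<^sup>+ y. indicator (- {x}) y * indicator B y \<partial>p)"
      unfolding off_point_def by (subst emeasure_density) auto
    also have "\<dots> = (\<integral>\<^sup>+ y. indicator (B - {x}) y \<partial>p)"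
      by (intro nn_integral_cong) (auto split: split_indicator)
    finally show ?thesis by simp
  qed
  have "finite_measure ?o"
    using eo[of UNIV] p.emeasure_finite by (intro finite_measureI) (auto simp: off_point_def sp)
  then have sf: "sigma_finite_measure ?o" by (rule finite_measure.axioms(1))
  define f where "f y = enn2real (RN_deriv \<mu>0 ?o y)" for y
  have [measurable]: "f \<in> borel_measurable borel" unfolding f_def by measurable
  have "AE y in \<mu>0. ennreal (f y) = RN_deriv \<mu>0 ?o y"
    using \<mu>0.RN_deriv_finite[OF sf ac[unfolded ac_off_def] so]
    by eventually_elim (simp add: f_def less_top)
  then have "density \<mu>0 (\<lambda>y. ennreal (f y)) = density \<mu>0 (RN_deriv \<mu>0 ?o)"
    by (intro density_cong) auto
  then have D: "density \<mu>0 (\<lambda>y. ennreal (f y)) = ?o"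
    using \<mu>0.density_RN_deriv[OF ac[unfolded ac_off_def] so] by simp
  have fB: "(\<integral>\<^sup>+ y. ennreal (f y) * indicator B y \<partial>\<mu>0) = emeasure p (B - {x})" if [measurable]: "B \<in> sets borel" for B
  proof -
    have "(\<integral>\<^sup>+ y. ennreal (f y) * indicator B y \<partial>\<mu>0) = emeasure (density \<mu>0 (\<lambda>y. ennreal (f y))) B"
      by (subst emeasure_density) auto
    then show ?thesis unfolding D using eo by simp
  qed
  have f1: "(\<integral>\<^sup>+ y. f y \<partial>\<mu>0) = emeasure p (- {x})" using fB[of UNIV] by (simp add: Compl_eq_Diff_UNIV)
  have sub: "subdensity f"
    unfolding subdensity_def f1 using p.emeasure_le_1 by (auto simp: f_def)
  have px: "1 - emeasure p (- {x}) = emeasure p {x}"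
  proof -
    have "emeasure p (- {x}) + emeasure p {x} = emeasure p UNIV"
      by (subst plus_emeasure) (auto simp: p intro: arg_cong[where f = "emeasure p"])
    then have "emeasure p {x} + emeasure p (- {x}) = 1" using p.emeasure_space_1 sp by (simp add: add.commute)
    then show ?thesis using p.emeasure_finite by (metis ennreal_add_diff_cancel_right infinity_ennreal_def)
  qed
  have "p = mix \<mu>0 f x"
  proof (rule measure_eqI)
    fix B assume "B \<in> sets p"
    then have B[measurable]: "B \<in> sets borel" by (simp add: p)
    have "emeasure p B = emeasure p ((B - {x}) \<union> (B \<inter> {x}))" by (rule arg_cong[where f = "emeasure p"]) auto
    also have "\<dots> = emeasure p (B - {x}) + emeasure p (B \<inter> {x})"
      by (rule plus_emeasure[symmetric]) (auto simp: p)
    also have "emeasure p (B \<inter> {x}) = emeasure p {x} * indicator B x"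
      by (cases "x \<in> B") auto
    finally show "emeasure p B = emeasure (mix \<mu>0 f x) B"
      by (subst emeasure_mix[OF sets_\<mu>0 _ B]) (simp_all add: fB f1 px)
  qed (simp add: p)
  then show ?thesis using that sub by blast
qed


section \<open>A countable family of kernels\<close>

abbreviation "\<Phi> \<equiv> Phi_gamma_b \<gamma> xo"

abbreviation "\<P> \<equiv> P_gamma \<gamma> xo"

lemma PhiE:
  assumes "\<phi> \<in> \<Phi>"
  obtains a b where "0 \<le> a" "0 \<le> b" "\<And>x. \<bar>\<phi> x\<bar> \<le> a + b * \<gamma> (dist x xo)"
  using assms unfolding Phi_gamma_b_def by auto

lemma Phi_measurable[measurable_dest]:
  "\<phi> \<in> \<Phi> \<Longrightarrow> \<phi> \<in> borel_measurable borel"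
  unfolding Phi_gamma_b_def by (auto intro: borel_measurable_continuous_onI)

lemma P_gammaD:
  assumes "p \<in> \<P>"
  shows "prob_space p" "sets p = sets borel" "(\<integral>\<^sup>+ x. ennreal (\<gamma> (dist x xo)) \<partial>p) < \<infinity>"
    "integrable p (\<lambda>x. \<gamma> (dist x xo))"
proof -
  show p: "prob_space p" "sets p = sets borel" "(\<integral>\<^sup>+ x. ennreal (\<gamma> (dist x xo)) \<partial>p) < \<infinity>"
    using assms unfolding P_gamma_def by auto
  note [measurable_cong] = p(2)
  show "integrable p (\<lambda>x. \<gamma> (dist x xo))"
    using p(3) by (intro integrableI_bounded) auto
qed

lemma Phi_integrable:
  assumes \<phi>: "\<phi> \<in> \<Phi>" and p: "p \<in> \<P>"
  shows "integrable p \<phi>"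
proof -
  note P = P_gammaD[OF p]
  interpret prob_space p by (rule P)
  note [measurable_cong] = P(2)
  obtain a b where ab: "0 \<le> a" "0 \<le> b" "\<And>x. \<bar>\<phi> x\<bar> \<le> a + b * \<gamma> (dist x xo)" by (rule PhiE[OF \<phi>]) blast
  have [measurable]: "\<phi> \<in> borel_measurable borel" by (rule Phi_measurable[OF \<phi>])
  show ?thesis
    by (rule Bochner_Integration.integrable_bound[of _ "\<lambda>x. a + b * \<gamma> (dist x xo)"])
       (use ab P(4) in \<open>auto intro!: AE_I2 order_trans[OF ab(3)]\<close>)
qed

text \<open>The objective of \<open>Q_hat\<close> at \<open>mix \<mu>0 f x\<close>, as a real
  number. An infinite \<open>bint\<close> would be read as 0 here, so the comparisons with
  \<open>Q_hat\<close> rely on a finite one.\<close>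

definition free_energy :: "('a \<Rightarrow> real) \<Rightarrow> 'a \<Rightarrow> ('a \<Rightarrow> real) \<Rightarrow> real" where
  "free_energy \<phi> x f = \<phi> x + (\<integral>y. (\<phi> y - \<phi> x) * f y \<partial>\<mu>0) + enn2real (bint x f)"

lemma Q_hat_le_free_energy:
  assumes \<phi>: "\<phi> \<in> \<Phi>" and f: "subdensity f" "mix \<mu>0 f x \<in> \<P>" and fin: "bint x f < \<infinity>"
  shows "Q_hat \<beta> \<gamma> \<mu>0 xo \<phi> x \<le> ereal (free_energy \<phi> x f)"
proof -
  note F = subdensityD[OF f(1)]
  have "Q_hat \<beta> \<gamma> \<mu>0 xo \<phi> x \<le> ereal (\<integral> y. \<phi> y \<partial>mix \<mu>0 f x) + enn2ereal (beta_integral \<beta> \<gamma> \<mu>0 x (mix \<mu>0 f x))"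
    unfolding Q_hat_def using f mix_subdensity(1)[OF f(1)] by (intro INF_lower) auto
  also have "\<dots> = ereal (\<phi> x + (\<integral>y. (\<phi> y - \<phi> x) * f y \<partial>\<mu>0)) + enn2ereal (bint x f)"
    unfolding mix_subdensity(2)[OF f(1)]
    by (subst integral_mix(2)[OF sets_\<mu>0 F(1,2,3) Phi_measurable[OF \<phi>] Phi_integrable[OF \<phi> f(2)]]) simp
  also have "\<dots> = ereal (free_energy \<phi> x f)"
    using fin unfolding free_energy_def by (cases "bint x f") (auto simp: enn2ereal_ennreal)
  finally show ?thesis .
qed

text \<open>A discretised layer-cake sum: each entry of L codes one level set and contributes the
  height \<open>1 / Suc q\<close>. With level sets coded by lists there are only countably many such
  functions.\<close>

definition step :: "(nat \<Rightarrow> 'a set) \<Rightarrow> nat \<Rightarrow> nat list list \<Rightarrow> 'a \<Rightarrow> real" where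
  "step U q L y = (\<Sum>l\<leftarrow>L. indicator (finU U l) y) / real (Suc q)"

lemma step_nonneg: "0 \<le> step U q L y"
  unfolding step_def by (intro divide_nonneg_nonneg sum_list_nonneg) auto

lemma step_le: "step U q L y \<le> real (length L) / real (Suc q)"
proof -
  have "(\<Sum>l\<leftarrow>L. indicator (finU U l) y) \<le> (\<Sum>l\<leftarrow>L. 1::real)"
    by (intro sum_list_mono) (auto split: split_indicator)
  then show ?thesis unfolding step_def by (intro divide_right_mono) (auto simp: sum_list_triv)
qed

lemma step_measurable[measurable]:
  assumes "\<And>i. open (U i)"
  shows "step U q L \<in> borel_measurable borel"
proof -
  have "(\<lambda>y. \<Sum>l\<leftarrow>L. indicator (finU U l) y :: real) \<in> borel_measurable borel"
  proof (induction L)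
    case (Cons l L)
    have "finU U l \<in> sets borel" using assms by (intro borel_open) auto
    then have "(\<lambda>y. indicator (finU U l) y :: real) \<in> borel_measurable borel" by measurable
    then show ?case using Cons by simp
  qed simp
  then show ?thesis unfolding step_def[abs_def] by measurable
qed

text \<open>The sum is the integer part of t, because the second hypothesis puts that integer part
  within 1..K or at 0.\<close>

lemma count_levels:
  assumes "0 \<le> t" "\<not> real (Suc K) \<le> t"
  shows "(\<Sum>k=1..K. if real k \<le> t then 1 else 0 :: real) \<le> t"
    "t \<le> (\<Sum>k=1..K. if real k \<le> t then 1 else 0 :: real) + 1"
proof -
  define j where "j = nat \<lfloor>t\<rfloor>"
  have j: "real j \<le> t" "t < real j + 1" unfolding j_def using assms(1) by linarith+
  have "(\<Sum>k=1..K. if real k \<le> t then 1 else 0 :: real) = (\<Sum>k\<in>{1..j}. 1)"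
  proof (rule sum.mono_neutral_cong_right)
    show "{1..j} \<subseteq> {1..K}" using j assms(2) by auto
  qed (use j in auto)
  then have "(\<Sum>k=1..K. if real k \<le> t then 1 else 0 :: real) = real j" by simp
  then show "(\<Sum>k=1..K. if real k \<le> t then 1 else 0 :: real) \<le> t"
    "t \<le> (\<Sum>k=1..K. if real k \<le> t then 1 else 0 :: real) + 1" using j by auto
qed

text \<open>The height \<open>length L / Suc q\<close> is kept inside the domain of \<open>\<beta>\<close> by discarding the null level
  sets: on any level set of positive measure \<open>\<beta> \<circ> g\<close> is finite somewhere.\<close>

lemma ex_step_approx:
  assumes U: "topological_basis (range U)" and g[measurable]: "g \<in> borel_measurable borel"
    and gN: "\<And>y. 0 \<le> g y" "\<And>y. g y \<le> real N" and fin: "(\<integral>\<^sup>+ y. \<beta> (g y) \<partial>\<mu>0) < \<infinity>" and e: "0 < e"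
  obtains q L where "\<beta> (real (length L) / real (Suc q)) < \<infinity>"
    "(\<integral>y. \<bar>step U q L y - g y\<bar> \<partial>\<mu>0) < e"
    "(\<integral>\<^sup>+ y. \<beta> (step U q L y) \<partial>\<mu>0) \<le> (\<integral>\<^sup>+ y. \<beta> (g y) \<partial>\<mu>0) + ennreal e"
proof -
  let ?I = "\<integral>\<^sup>+ y. \<beta> (g y) \<partial>\<mu>0"
  note Uo = range_basis_open[OF U(1)]
  note [measurable] = step_measurable[of U, OF Uo]
  obtain q where q: "1 / real (Suc q) < e / 2" using nat_approx_posE[of "e / 2"] e by auto
  let ?Q = "real (Suc q)"
  define A where "A k = {y. real k \<le> ?Q * g y}" for k
  have A[measurable]: "A k \<in> sets borel" for k unfolding A_def by measurable
  have "\<exists>K. K \<le> N * Suc q \<and> measure \<mu>0 (A (Suc K)) = 0 \<and> \<beta> (real K / ?Q) < \<infinity>"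
  proof (cases "measure \<mu>0 (A 1) = 0")
    case True
    then show ?thesis by (intro exI[of _ 0]) (simp add: beta_0)
  next
    case False
    let ?S = "{k. 0 < k \<and> measure \<mu>0 (A k) \<noteq> 0}"
    have S: "k \<le> N * Suc q" if "k \<in> ?S" for k
    proof (rule ccontr)
      assume "\<not> k \<le> N * Suc q"
      then have "real (N * Suc q) < real k" by (simp only: of_nat_less_iff not_le)
      moreover have "?Q * g y \<le> real (N * Suc q)" for y
        using mult_left_mono[OF gN(2)[of y], of ?Q] by (simp only: of_nat_mult of_nat_0_le_iff mult.commute)
      ultimately have "\<not> real k \<le> ?Q * g y" for y by (meson le_less_trans not_le)
      then have "A k = {}" unfolding A_def by blast
      then show False using that by simp
    qed
    then have fS: "finite ?S" by (meson finite_nat_set_iff_bounded_le)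
    define K where "K = Max ?S"
    have K: "K \<in> ?S" unfolding K_def using False fS by (intro Max_in) auto
    have "Suc K \<notin> ?S" using Max_ge[OF fS, of "Suc K"] unfolding K_def[symmetric] by auto
    moreover have "\<beta> (real K / ?Q) < \<infinity>"
    proof -
      have "AE y in \<mu>0. \<beta> (g y) \<noteq> \<infinity>"
        using fin gN by (intro nn_integral_PInf_AE) auto
      moreover have "\<not> (AE y in \<mu>0. y \<notin> A K)"
        using K by (simp add: \<mu>0.prob_eq_0 sets_\<mu>0)
      ultimately obtain y where y: "y \<in> A K" "\<beta> (g y) \<noteq> \<infinity>"
        by (metis (mono_tags, lifting) AE_mp AE_I2)
      have "real K / ?Q \<le> g y" using y(1) unfolding A_def by (simp add: field_simps)
      then have "\<beta> (real K / ?Q) \<le> \<beta> (g y)" by (intro beta_mono) auto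
      then show ?thesis using y(2) by (simp add: less_top[symmetric]) (metis top.extremum_unique)
    qed
    ultimately show ?thesis using K S[OF K] by auto
  qed
  then obtain K where K: "K \<le> N * Suc q" "measure \<mu>0 (A (Suc K)) = 0" "\<beta> (real K / ?Q) < \<infinity>" by blast
  define b where "b = enn2real (\<beta> (real K / ?Q))"
  have b: "\<beta> (real K / ?Q) = ennreal b" "0 \<le> b" unfolding b_def using K(3) by auto
  \<comment> \<open>The exceptional set \<open>P\<close> will have measure at most
    \<open>K * e'\<close> and enters the two estimates with the factors N and b. c dominates
    \<open>K * (N + b)\<close>, and the added ones keep it positive; both contributions together
    then stay below e / 2.\<close>
  define c where "c = (real K + 1) * (real N + b + 1)"
  have c: "0 < c" "real K * (real N + b) \<le> c"
    unfolding c_def using b(2) by (auto intro!: mult_pos_pos mult_mono)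
  define e' where "e' = e / (2 * c)"
  have e': "0 < e'" unfolding e'_def using e c by auto
  have "\<exists>l. measure \<mu>0 (sym_diff (A k) (finU U l)) < e'" for k
    using approx_by_finite_union[OF U prob_\<mu>0 sets_\<mu>0 A e'] by metis
  then obtain l where l: "\<And>k. measure \<mu>0 (sym_diff (A k) (finU U (l k))) < e'"
    by metis
  define P where "P = (\<Union>k\<in>{1..K}. sym_diff (A k) (finU U (l k)))"
  have [measurable]: "finU U (l k) \<in> sets borel" for k using Uo by (intro borel_open) auto
  have P[measurable]: "P \<in> sets borel" unfolding P_def by measurable
  have "measure \<mu>0 P \<le> (\<Sum>k=1..K. measure \<mu>0 (sym_diff (A k) (finU U (l k))))"
    unfolding P_def by (intro measure_UNION_le) (auto simp: sets_\<mu>0)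
  also have "\<dots> \<le> (\<Sum>k=1..K. e')" using l by (intro sum_mono) (auto intro: less_imp_le)
  finally have P1: "measure \<mu>0 P \<le> real K * e'" by simp
  have "measure \<mu>0 P * (real N + b) \<le> real K * e' * (real N + b)"
    using b(2) by (intro mult_right_mono P1) auto
  also have "\<dots> = e' * (real K * (real N + b))" by (simp only: ac_simps)
  also have "\<dots> \<le> e' * c" using c(2) e' by (intro mult_left_mono) auto
  also have "\<dots> = e / 2" unfolding e'_def using c(1) by simp
  finally have P2: "measure \<mu>0 P * real N + measure \<mu>0 P * b \<le> e / 2" by (simp only: distrib_left)
  have PN: "measure \<mu>0 P * real N \<le> e / 2" and Pb: "measure \<mu>0 P * b \<le> e"
    using P2 e mult_nonneg_nonneg[OF measure_nonneg[of \<mu>0 P] b(2)]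
      mult_nonneg_nonneg[OF measure_nonneg[of \<mu>0 P] of_nat_0_le_iff[of N]] by linarith+
  define L where "L = map l [1..<Suc K]"
  have len: "length L = K" unfolding L_def by simp
  have step: "step U q L y = (\<Sum>k=1..K. indicator (finU U (l k)) y) / ?Q" for y
    unfolding step_def L_def by (simp only: map_map o_def sum_list_distinct_conv_sum_set distinct_upt set_upt atLeastLessThanSuc_atLeastAtMost)
  have off: "step U q L y = (\<Sum>k=1..K. if real k \<le> ?Q * g y then 1 else 0) / ?Q" if "y \<notin> P" for y
  proof -
    have "indicator (finU U (l k)) y = (if real k \<le> ?Q * g y then 1 else 0 :: real)" if "k \<in> {1..K}" for k
    proof -
      have "y \<in> A k \<longleftrightarrow> y \<in> finU U (l k)" using \<open>y \<notin> P\<close> that unfolding P_def by blast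
      then show ?thesis unfolding A_def by (simp add: indicator_def)
    qed
    then show ?thesis unfolding step by (intro arg_cong2[where f = "(/)"] sum.cong) auto
  qed
  have AEK: "AE y in \<mu>0. \<not> real (Suc K) \<le> ?Q * g y"
    using K(2) by (subst (asm) \<mu>0.prob_eq_0) (auto simp: sets_\<mu>0 A_def)
  have KN: "real K / ?Q \<le> real N"
  proof -
    have "real K \<le> real (N * Suc q)" using K(1) by (simp only: of_nat_le_iff)
    then show ?thesis by (simp add: field_simps)
  qed
  \<comment> \<open>Off \<open>P\<close> the step function is g rounded down to a multiple of
    \<open>1 / Suc q\<close>, up to the null set of levels above K. On \<open>P\<close> both
    functions lie between 0 and N.\<close>
  have bnd: "AE y in \<mu>0. \<bar>step U q L y - g y\<bar> \<le> 1 / ?Q + real N * indicator P y"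
    using AEK
  proof eventually_elim
    case (elim y)
    show ?case
    proof (cases "y \<in> P")
      case True
      have "\<bar>step U q L y - g y\<bar> \<le> real N"
        using step_nonneg[of U q L y] step_le[of U q L y] KN gN(1)[of y] gN(2)[of y] unfolding len by linarith
      moreover have "0 \<le> 1 / ?Q" by simp
      ultimately have "\<bar>step U q L y - g y\<bar> \<le> 1 / ?Q + real N" by linarith
      then show ?thesis using True by simp
    next
      case False
      have t: "0 \<le> ?Q * g y" using gN(1) by simp
      let ?S = "\<Sum>k=1..K. if real k \<le> ?Q * g y then 1 else 0 :: real"
      have "?S \<le> ?Q * g y" "?Q * g y \<le> ?S + 1"
        using count_levels[OF t elim] by auto
      then have "?S / ?Q \<le> g y" "g y \<le> ?S / ?Q + 1 / ?Q"
        by (simp_all add: field_simps)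
      then show ?thesis using False off[OF False] by simp
    qed
  qed
  show ?thesis
  proof
    show "\<beta> (real (length L) / ?Q) < \<infinity>" unfolding len by (rule K(3))
    have "(\<integral>y. \<bar>step U q L y - g y\<bar> \<partial>\<mu>0) \<le> (\<integral>y. 1 / ?Q + real N * indicator P y \<partial>\<mu>0)"
    proof (rule integral_mono_AE)
      show "integrable \<mu>0 (\<lambda>y. \<bar>step U q L y - g y\<bar>)"
      proof (rule \<mu>0.integrable_const_bound[where B = "1 / ?Q + real N"])
        show "AE y in \<mu>0. norm \<bar>step U q L y - g y\<bar> \<le> 1 / ?Q + real N"
          using bnd by eventually_elim (auto split: split_indicator_asm)
      qed measurable
      show "integrable \<mu>0 (\<lambda>y. 1 / ?Q + real N * indicator P y)"
        by (rule \<mu>0.integrable_const_bound[where B = "1 / ?Q + real N"]) (auto split: split_indicator)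
    qed (rule bnd)
    also have "\<dots> = 1 / ?Q + real N * measure \<mu>0 P"
    proof -
      have "integrable \<mu>0 (indicator P :: 'a \<Rightarrow> real)"
        by (rule integrable_real_indicator) (auto simp: sets_\<mu>0 \<mu>0.emeasure_eq_measure)
      then show ?thesis
        by (subst Bochner_Integration.integral_add) (auto simp: \<mu>0.prob_space[simplified])
    qed
    also have "\<dots> < e" using q PN by (simp add: mult.commute)
    finally show "(\<integral>y. \<bar>step U q L y - g y\<bar> \<partial>\<mu>0) < e" .
    \<comment> \<open>Rounding down does not increase \<beta>, so only \<open>P\<close> costs
      anything: at most b, the value of \<beta> at the greatest height
      \<open>K / Suc q\<close>.\<close>
    have "(\<integral>\<^sup>+ y. \<beta> (step U q L y) \<partial>\<mu>0) \<le> (\<integral>\<^sup>+ y. \<beta> (g y) + ennreal b * indicator P y \<partial>\<mu>0)"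
    proof (rule nn_integral_mono_AE)
      show "AE y in \<mu>0. \<beta> (step U q L y) \<le> \<beta> (g y) + ennreal b * indicator P y"
        using AEK
      proof eventually_elim
        case (elim y)
        show ?case
        proof (cases "y \<in> P")
          case True
          have "\<beta> (step U q L y) \<le> ennreal b"
            using step_le[of U q L y] unfolding b(1)[symmetric] len by (intro beta_mono step_nonneg)
          then show ?thesis using True by (simp add: add_increasing)
        next
          case False
          have t: "0 \<le> ?Q * g y" using gN(1) by simp
          have "step U q L y \<le> g y"
            unfolding off[OF False] using count_levels(1)[OF t elim] by (simp add: field_simps)
          then show ?thesis using False by (simp add: beta_mono step_nonneg)
        qed
      qed
    qed
    also have "\<dots> = ?I + ennreal b * emeasure \<mu>0 P"
      using gN by (subst nn_integral_add) (auto simp: nn_integral_cmult_indicator sets_\<mu>0)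
    also have "\<dots> \<le> ?I + ennreal e"
      using Pb b(2) by (intro add_left_mono) (simp add: \<mu>0.emeasure_eq_measure ennreal_mult[symmetric] mult.commute ennreal_leI)
    finally show "(\<integral>\<^sup>+ y. \<beta> (step U q L y) \<partial>\<mu>0) \<le> ?I + ennreal e" .
  qed
qed


section \<open>Step densities cut off near the diagonal and at infinity\<close>

definition raw_cell :: "(nat \<Rightarrow> 'a set) \<Rightarrow> nat \<Rightarrow> nat \<Rightarrow> nat list list \<Rightarrow> 'a \<Rightarrow> 'a \<Rightarrow> real" where
  "raw_cell U n q L x y =
     (if 1 / real (Suc n) \<le> \<gamma> (dist x y) \<and> \<gamma> (dist y xo) \<le> real n
      then step U q L y / \<gamma> (dist x y) else 0)"

text \<open>The cost sees a density only through its product with \<gamma>, so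
  \<open>raw_cell\<close> discretises that product and divides \<gamma> out again; its cutoffs keep
  the quotient bounded and the \<gamma>-moment finite. Dividing by the mass where it exceeds 1 gives
  a subdensity for every code at every x, and the fallback 0 guarantees a finite cost.\<close>

definition cell :: "(nat \<Rightarrow> 'a set) \<Rightarrow> nat \<times> nat \<times> nat list list \<Rightarrow> 'a \<Rightarrow> 'a \<Rightarrow> real" where
  "cell U t x y = (case t of (n, q, L) \<Rightarrow>
     if \<beta> (real (length L) / real (Suc q)) < \<infinity>
     then raw_cell U n q L x y / max 1 (\<integral>z. raw_cell U n q L x z \<partial>\<mu>0) else 0)"

lemma raw_cell_measurable[measurable]:
  assumes "\<And>i. open (U i)"
  shows "(\<lambda>z. raw_cell U n q L (fst z) (snd z)) \<in> borel_measurable borel2"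
proof -
  note [measurable] = step_measurable[of U, OF assms]
  show ?thesis unfolding raw_cell_def[abs_def] by measurable
qed

lemma cell_measurable:
  assumes "\<And>i. open (U i)"
  shows "(\<lambda>z. cell U t (fst z) (snd z)) \<in> borel_measurable borel2"
proof -
  obtain n q L where t: "t = (n, q, L)" by (cases t)
  note [measurable] = raw_cell_measurable[of U, OF assms]
  have [measurable]: "(\<lambda>x. \<integral>z. raw_cell U n q L x z \<partial>\<mu>0) \<in> borel_measurable borel"
    using \<mu>0.borel_measurable_lebesgue_integral[of "\<lambda>x z. raw_cell U n q L x z" borel]
      raw_cell_measurable[of U n q L, OF assms]
    by (simp add: case_prod_unfold cong: measurable_cong_sets sets_pair_measure_cong)
  show ?thesis unfolding t cell_def[abs_def] prod.case by measurable
qed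

lemma raw_cell_bounds:
  shows "0 \<le> raw_cell U n q L x y"
    "raw_cell U n q L x y \<le> real (length L) / real (Suc q) * real (Suc n)"
    "\<gamma> (dist x y) * raw_cell U n q L x y \<le> step U q L y"
proof -
  show "0 \<le> raw_cell U n q L x y" unfolding raw_cell_def by (simp add: step_nonneg)
  show "raw_cell U n q L x y \<le> real (length L) / real (Suc q) * real (Suc n)"
  proof (cases "1 / real (Suc n) \<le> \<gamma> (dist x y)")
    case True
    have p: "0 < 1 / real (Suc n)" by simp
    have "step U q L y / \<gamma> (dist x y) \<le> (real (length L) / real (Suc q)) / (1 / real (Suc n))"
      using True p by (intro frac_le step_le) auto
    then show ?thesis unfolding raw_cell_def by (auto simp: step_nonneg)
  qed (simp add: raw_cell_def)
  show "\<gamma> (dist x y) * raw_cell U n q L x y \<le> step U q L y"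
    unfolding raw_cell_def by (auto simp: step_nonneg)
qed

lemma raw_cell_measurable_snd:
  assumes "\<And>i. open (U i)"
  shows "raw_cell U n q L x \<in> borel_measurable borel"
  using measurable_Pair2[OF raw_cell_measurable[of U n q L, OF assms], of x] by simp

lemma raw_cell_integrable:
  assumes "\<And>i. open (U i)"
  shows "integrable \<mu>0 (raw_cell U n q L x)"
  using raw_cell_measurable_snd[of U, OF assms] raw_cell_bounds
  by (intro \<mu>0.integrable_const_bound[where B = "real (length L) / real (Suc q) * real (Suc n)"]) auto

lemma cell_bounds:
  shows "0 \<le> cell U t x y" "cell U (n, q, L) x y \<le> raw_cell U n q L x y"
proof -
  have 1: "1 \<le> max 1 (\<integral>z. raw_cell U n q L x z \<partial>\<mu>0)" for n q L by simp
  show "0 \<le> cell U t x y"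
    unfolding cell_def using raw_cell_bounds(1)
    by (auto split: prod.split intro!: divide_nonneg_nonneg)
  show "cell U (n, q, L) x y \<le> raw_cell U n q L x y"
    unfolding cell_def using raw_cell_bounds(1)[of U n q L x y] divide_left_mono[OF 1[of n q L] raw_cell_bounds(1)[of U n q L x y]]
    by auto
qed

lemma subdensity_cell:
  assumes "\<And>i. open (U i)"
  shows "subdensity (cell U t x)"
proof -
  obtain n q L where t: "t = (n, q, L)" by (cases t)
  have m[measurable]: "cell U t x \<in> borel_measurable borel"
    using measurable_Pair2[OF cell_measurable[of U t, OF assms], of x] by simp
  have [measurable]: "raw_cell U n q L x \<in> borel_measurable borel"
    by (rule raw_cell_measurable_snd[OF assms])
  note i = raw_cell_integrable[of U n q L x, OF assms]
  let ?c = "max 1 (\<integral>z. raw_cell U n q L x z \<partial>\<mu>0)"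
  have "(\<integral>\<^sup>+ y. cell U t x y \<partial>\<mu>0) \<le> (\<integral>\<^sup>+ y. ennreal (raw_cell U n q L x y / ?c) \<partial>\<mu>0)"
    unfolding t cell_def using raw_cell_bounds(1)
    by (intro nn_integral_mono ennreal_leI) (auto intro!: divide_nonneg_nonneg)
  also have "\<dots> = ennreal (\<integral>y. raw_cell U n q L x y / ?c \<partial>\<mu>0)"
    using i raw_cell_bounds(1) by (intro nn_integral_eq_integral) (auto intro!: AE_I2 divide_nonneg_nonneg)
  also have "(\<integral>y. raw_cell U n q L x y / ?c \<partial>\<mu>0) \<le> 1"
  proof -
    have "0 < ?c" by (rule less_le_trans[OF zero_less_one max.cobounded1])
    then show ?thesis by (simp add: divide_le_eq_1)
  qed
  finally show ?thesis using m cell_bounds(1) unfolding subdensity_def by (auto simp: ennreal_leI)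
qed

lemma bint_mono:
  assumes "\<And>y. 0 \<le> f y" "\<And>y. f y \<le> g y"
  shows "bint x f \<le> bint x g"
  unfolding bint_def using assms by (intro nn_integral_mono beta_mono mult_left_mono mult_nonneg_nonneg) auto

lemma bint_cell_finite: "bint x (cell U t x) < \<infinity>"
proof -
  obtain n q L where t: "t = (n, q, L)" by (cases t)
  show ?thesis
  proof (cases "\<beta> (real (length L) / real (Suc q)) < \<infinity>")
    case True
    have "\<gamma> (dist x y) * cell U t x y \<le> real (length L) / real (Suc q)" for y
      using mult_left_mono[OF cell_bounds(2)[of U n q L x y] gamma_dist_nonneg[of x y]]
        raw_cell_bounds(3)[of x y U n q L] step_le[of U q L y] unfolding t by linarith
    then have "bint x (cell U t x) \<le> (\<integral>\<^sup>+ y. \<beta> (real (length L) / real (Suc q)) \<partial>\<mu>0)"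
      unfolding bint_def by (intro nn_integral_mono beta_mono) (auto simp: cell_bounds)
    also have "\<dots> = \<beta> (real (length L) / real (Suc q))" using \<mu>0.emeasure_space_1 by simp
    finally show ?thesis using True by (rule le_less_trans)
  qed (simp add: t cell_def bint_def beta_0)
qed

lemma mix_cell_in_P_gamma:
  assumes "\<And>i. open (U i)"
  shows "mix \<mu>0 (cell U t x) x \<in> \<P>"
proof -
  obtain n q L where t: "t = (n, q, L)" by (cases t)
  note s = subdensityD[OF subdensity_cell[of U t x, OF assms]]
  have le: "ennreal (cell U t x y) * ennreal (\<gamma> (dist y xo)) \<le> ennreal (real n) * ennreal (cell U t x y)" for y
  proof -
    have "cell U t x y * \<gamma> (dist y xo) \<le> real n * cell U t x y"
    proof (cases "\<gamma> (dist y xo) \<le> real n")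
      case True
      then show ?thesis using mult_right_mono[OF True cell_bounds(1)[of U t x y]] by (simp add: mult.commute)
    next
      case False
      then have "cell U t x y = 0" unfolding t cell_def raw_cell_def by simp
      then show ?thesis by simp
    qed
    then show ?thesis by (simp add: ennreal_mult[symmetric] cell_bounds(1) ennreal_leI)
  qed
  have "(\<integral>\<^sup>+ y. ennreal (\<gamma> (dist y xo)) \<partial>mix \<mu>0 (cell U t x) x)
     = (\<integral>\<^sup>+ y. ennreal (cell U t x y) * ennreal (\<gamma> (dist y xo)) \<partial>\<mu>0)
       + (1 - (\<integral>\<^sup>+ y. cell U t x y \<partial>\<mu>0)) * ennreal (\<gamma> (dist x xo))"
    by (rule nn_integral_mix[OF sets_\<mu>0 s(1)]) measurable
  also have "\<dots> \<le> ennreal (real n) * 1 + 1 * ennreal (\<gamma> (dist x xo))"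
  proof (intro add_mono mult_right_mono)
    have "(\<integral>\<^sup>+ y. ennreal (cell U t x y) * ennreal (\<gamma> (dist y xo)) \<partial>\<mu>0)
        \<le> (\<integral>\<^sup>+ y. ennreal (real n) * ennreal (cell U t x y) \<partial>\<mu>0)"
      by (intro nn_integral_mono le)
    also have "\<dots> = ennreal (real n) * (\<integral>\<^sup>+ y. cell U t x y \<partial>\<mu>0)"
      using s(1) by (intro nn_integral_cmult) auto
    also have "\<dots> \<le> ennreal (real n) * 1" using s(3) by (intro mult_left_mono) auto
    finally show "(\<integral>\<^sup>+ y. ennreal (cell U t x y) * ennreal (\<gamma> (dist y xo)) \<partial>\<mu>0) \<le> ennreal (real n) * 1" .
    show "1 - (\<integral>\<^sup>+ y. cell U t x y \<partial>\<mu>0) \<le> (1 :: ennreal)" by (rule diff_le_self_ennreal)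
  qed auto
  also have "\<dots> < \<infinity>" by (simp add: ennreal_mult_less_top ennreal_add_eq_top less_top[symmetric])
  finally show ?thesis
    unfolding P_gamma_def using prob_space_mix[OF sets_\<mu>0 s(1) s(3)] by simp
qed

lemma truncate_subdensity:
  assumes u: "u \<in> borel_measurable borel" and f: "subdensity f"
    and int: "integrable \<mu>0 (\<lambda>y. (u y - u x) * f y)" and e: "0 < e"
  obtains N where "\<bar>(\<integral>y. (u y - u x) * (if \<gamma> (dist x y) * f y \<le> real N \<and> 1 / real (Suc N) \<le> \<gamma> (dist x y)
        \<and> \<gamma> (dist y xo) \<le> real N then f y else 0) \<partial>\<mu>0) - (\<integral>y. (u y - u x) * f y \<partial>\<mu>0)\<bar> < e"
proof -
  note [measurable] = u subdensityD(1)[OF f]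
  define F where "F N y = (if \<gamma> (dist x y) * f y \<le> real N \<and> 1 / real (Suc N) \<le> \<gamma> (dist x y)
        \<and> \<gamma> (dist y xo) \<le> real N then f y else 0)" for N y
  have "(\<lambda>N. \<integral>y. (u y - u x) * F N y \<partial>\<mu>0) \<longlonglongrightarrow> (\<integral>y. (u y - u x) * f y \<partial>\<mu>0)"
  proof (rule integral_dominated_convergence[where w = "\<lambda>y. norm ((u y - u x) * f y)"])
    show "AE y in \<mu>0. (\<lambda>N. (u y - u x) * F N y) \<longlonglongrightarrow> (u y - u x) * f y"
    proof (rule AE_I2)
      fix y
      show "(\<lambda>N. (u y - u x) * F N y) \<longlonglongrightarrow> (u y - u x) * f y"
      \<comment> \<open>At y = x the factor \<open>u y - u x\<close> vanishes, so it is harmless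
        that the lower cutoff on \<gamma> always removes this point.\<close>
      proof (cases "y = x")
        case False
        then have "0 < \<gamma> (dist x y)" by (intro gamma_dist_pos) auto
        then obtain n1 where n1: "1 / real (Suc n1) < \<gamma> (dist x y)" by (rule nat_approx_posE)
        obtain n2 where n2: "\<gamma> (dist x y) * f y \<le> real n2" using real_arch_simple by blast
        obtain n3 where n3: "\<gamma> (dist y xo) \<le> real n3" using real_arch_simple by blast
        have "F N y = f y" if N: "N \<ge> max n1 (max n2 n3)" for N
        proof -
          have "real n2 \<le> real N" "real n3 \<le> real N" using N by auto
          moreover have "1 / real (Suc N) \<le> 1 / real (Suc n1)"
            using N by (intro divide_left_mono) auto
          ultimately show ?thesis unfolding F_def using n1 n2 n3 by auto
        qed
        then have "\<forall>\<^sub>F N in sequentially. (u y - u x) * F N y = (u y - u x) * f y"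
          unfolding eventually_sequentially by metis
        then show ?thesis by (rule tendsto_eventually)
      qed simp
    qed
    show "AE y in \<mu>0. norm ((u y - u x) * F N y) \<le> norm ((u y - u x) * f y)" for N
      unfolding F_def by auto
    show "(\<lambda>y. (u y - u x) * F N y) \<in> borel_measurable \<mu>0" for N
      unfolding F_def by measurable
  qed (use int in auto)
  then obtain N where "dist (\<integral>y. (u y - u x) * F N y \<partial>\<mu>0) (\<integral>y. (u y - u x) * f y \<partial>\<mu>0) < e"
    using e unfolding tendsto_iff eventually_sequentially by blast
  then show ?thesis using that unfolding F_def dist_real_def by blast
qed

text \<open>Four changes lead from f to a cell: cutting off, replacing the product with \<gamma> by
  a step function, dividing \<gamma> out, and normalising. Cutting off and normalising only lower
  the density and hence the cost. The linear term moves by L1 errors times a bound for \<phi> y -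
  \<phi> x, which the cutoff at infinity makes available for unbounded \<phi>.\<close>

lemma free_energy_cell_approx:
  assumes U: "topological_basis (range U)" and \<phi>: "\<phi> \<in> \<Phi>" and f: "subdensity f"
    and int: "integrable \<mu>0 (\<lambda>y. (\<phi> y - \<phi> x) * f y)" and fin: "bint x f < \<infinity>" and e: "0 < e"
  obtains t where "free_energy \<phi> x (cell U t x) \<le> free_energy \<phi> x f + e"
proof -
  note Uo = range_basis_open[OF U(1)]
  note F = subdensityD[OF f]
  note [measurable] = Phi_measurable[OF \<phi>] F(1) step_measurable[of U, OF Uo]
  obtain a b where ab: "0 \<le> a" "0 \<le> b" "\<And>x. \<bar>\<phi> x\<bar> \<le> a + b * \<gamma> (dist x xo)" by (rule PhiE[OF \<phi>]) blast
  define D where "D N y \<longleftrightarrow> 1 / real (Suc N) \<le> \<gamma> (dist x y) \<and> \<gamma> (dist y xo) \<le> real N" for N y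
  obtain N where N: "\<bar>(\<integral>y. (\<phi> y - \<phi> x) * (if \<gamma> (dist x y) * f y \<le> real N \<and> D N y then f y else 0) \<partial>\<mu>0)
      - (\<integral>y. (\<phi> y - \<phi> x) * f y \<partial>\<mu>0)\<bar> < e / 3"
    using truncate_subdensity[OF Phi_measurable[OF \<phi>] f int, of "e / 3"] e unfolding D_def by auto
  have [measurable]: "Measurable.pred borel (D N)" unfolding D_def by measurable
  define h where "h y = (if \<gamma> (dist x y) * f y \<le> real N \<and> D N y then f y else 0)" for y
  have [measurable]: "h \<in> borel_measurable borel" unfolding h_def by measurable
  have h: "0 \<le> h y" "h y \<le> f y" for y unfolding h_def using F(2) by auto
  define g where "g y = \<gamma> (dist x y) * h y" for y
  have g: "0 \<le> g y" "g y \<le> real N" for y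
    unfolding g_def h_def using F(2) by auto
  have [measurable]: "g \<in> borel_measurable borel" unfolding g_def by measurable
  have gf: "(\<integral>\<^sup>+ y. \<beta> (g y) \<partial>\<mu>0) \<le> bint x f"
    using bint_mono[of h f x] h unfolding bint_def g_def by auto
  have gfin: "(\<integral>\<^sup>+ y. \<beta> (g y) \<partial>\<mu>0) < \<infinity>" using gf fin by (rule le_less_trans)
  \<comment> \<open>Bounds \<phi> y - \<phi> x in absolute value wherever the cutoff lets a density
    be nonzero.\<close>
  define Z where "Z = a + b * real N + \<bar>\<phi> x\<bar>"
  have Z0: "0 \<le> Z" unfolding Z_def using ab by auto
  \<comment> \<open>Division by \<gamma> \<ge> 1 / Suc N magnifies the L1 error by
    \<open>Suc N\<close>. Discretisation and normalisation each contribute Z times the magnified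
    error, together at most e / 3. The cost takes another e1 \<le> e / 3, and the truncation the
    last third.\<close>
  define e1 where "e1 = e / (3 * (2 * Z + 1) * real (Suc N))"
  have e1: "0 < e1" unfolding e1_def using e Z0 by auto
  have e1Z: "2 * Z * (real (Suc N) * e1) \<le> e / 3"
  proof -
    have "2 * Z * (real (Suc N) * e1) = e / 3 * (2 * Z / (2 * Z + 1))"
      unfolding e1_def using Z0 by (simp add: divide_simps)
    also have "\<dots> \<le> e / 3 * 1" using e Z0 by (intro mult_left_mono) auto
    finally show ?thesis by simp
  qed
  have e1e: "e1 \<le> e / 3"
  proof -
    have "1 * 1 \<le> (2 * Z + 1) * real (Suc N)" using Z0 by (intro mult_mono) auto
    then have "e / 3 / ((2 * Z + 1) * real (Suc N)) \<le> e / 3 / 1"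
      using e by (intro divide_left_mono) auto
    then show ?thesis unfolding e1_def by (simp only: divide_divide_eq_left mult.assoc div_by_1)
  qed
  obtain q L where qL: "\<beta> (real (length L) / real (Suc q)) < \<infinity>"
    "(\<integral>y. \<bar>step U q L y - g y\<bar> \<partial>\<mu>0) < e1"
    "(\<integral>\<^sup>+ y. \<beta> (step U q L y) \<partial>\<mu>0) \<le> (\<integral>\<^sup>+ y. \<beta> (g y) \<partial>\<mu>0) + ennreal e1"
    using ex_step_approx[OF U \<open>g \<in> borel_measurable borel\<close> g gfin e1] by blast
  define r where "r = raw_cell U N q L x"
  have r[measurable]: "r \<in> borel_measurable borel" unfolding r_def by (rule raw_cell_measurable_snd[OF Uo])
  have ri: "integrable \<mu>0 r" unfolding r_def by (rule raw_cell_integrable[OF Uo])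
  have r0: "0 \<le> r y" for y unfolding r_def by (rule raw_cell_bounds)
  have hi: "integrable \<mu>0 h"
    by (rule Bochner_Integration.integrable_bound[OF F(4)]) (use h F(2) in auto)
  have si: "integrable \<mu>0 (\<lambda>y. \<bar>step U q L y - g y\<bar>)"
  proof (rule \<mu>0.integrable_const_bound[where B = "real (length L) / real (Suc q) + real N"])
    show "AE y in \<mu>0. norm \<bar>step U q L y - g y\<bar> \<le> real (length L) / real (Suc q) + real N"
    proof (rule AE_I2)
      fix y
      show "norm \<bar>step U q L y - g y\<bar> \<le> real (length L) / real (Suc q) + real N"
        using step_nonneg[of U q L y] step_le[of U q L y] g(1)[of y] g(2)[of y] unfolding real_norm_def by linarith
    qed
  qed measurable
  have rh: "\<bar>r y - h y\<bar> \<le> real (Suc N) * \<bar>step U q L y - g y\<bar>" for y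
  proof (cases "D N y")
    case True
    then have p: "1 / real (Suc N) \<le> \<gamma> (dist x y)" unfolding D_def by simp
    have "0 < 1 / real (Suc N)" by simp
    then have p0: "0 < \<gamma> (dist x y)" using p by linarith
    have "r y - h y = (step U q L y - g y) / \<gamma> (dist x y)"
      unfolding r_def raw_cell_def g_def using True p0 unfolding D_def by (simp add: diff_divide_distrib)
    then have "\<bar>r y - h y\<bar> = \<bar>step U q L y - g y\<bar> / \<gamma> (dist x y)" using p0 by (simp add: abs_divide)
    also have "\<dots> \<le> \<bar>step U q L y - g y\<bar> / (1 / real (Suc N))"
      using p p0 by (intro divide_left_mono) auto
    finally show ?thesis by (simp add: mult.commute)
  next
    case False
    then show ?thesis unfolding r_def raw_cell_def h_def D_def by auto
  qed
  define e2 where "e2 = real (Suc N) * e1"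
  have rh2: "(\<integral>y. \<bar>r y - h y\<bar> \<partial>\<mu>0) \<le> e2"
  proof -
    have "(\<integral>y. \<bar>r y - h y\<bar> \<partial>\<mu>0) \<le> (\<integral>y. real (Suc N) * \<bar>step U q L y - g y\<bar> \<partial>\<mu>0)"
      using ri hi si by (intro integral_mono rh) auto
    also have "\<dots> = real (Suc N) * (\<integral>y. \<bar>step U q L y - g y\<bar> \<partial>\<mu>0)" by simp
    also have "\<dots> \<le> e2" unfolding e2_def using qL(2) by (intro mult_left_mono) auto
    finally show ?thesis .
  qed
  define c where "c = max 1 (\<integral>y. r y \<partial>\<mu>0)"
  have c1: "1 \<le> c" unfolding c_def by simp
  have "(\<integral>y. r y \<partial>\<mu>0) \<le> (\<integral>y. \<bar>r y - h y\<bar> + f y \<partial>\<mu>0)"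
  proof (rule integral_mono)
    show "r y \<le> \<bar>r y - h y\<bar> + f y" for y using h(2)[of y] by linarith
  qed (use ri hi F(4) in auto)
  also have "\<dots> = (\<integral>y. \<bar>r y - h y\<bar> \<partial>\<mu>0) + (\<integral>y. f y \<partial>\<mu>0)"
    using ri hi F(4) by (intro Bochner_Integration.integral_add) auto
  \<comment> \<open>f has mass at most 1, so the normalising constant exceeds 1 by no more than the
    L1 error already committed.\<close>
  finally have c2: "c \<le> 1 + e2" using rh2 F(5) e1 unfolding c_def e2_def by auto
  define w where "w y = r y / c" for y
  have w: "cell U (N, q, L) x = w"
    unfolding cell_def w_def c_def r_def using qL(1) by auto
  have [measurable]: "w \<in> borel_measurable borel" unfolding w_def by measurable
  have w0: "0 \<le> w y" "w y \<le> r y" for y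
    unfolding w_def using r0[of y] c1 mult_right_mono[OF c1 r0[of y]]
    by (auto simp: field_simps)
  have wi: "integrable \<mu>0 w" unfolding w_def using ri by simp
  have wr: "(\<integral>y. \<bar>w y - r y\<bar> \<partial>\<mu>0) \<le> e2"
  proof -
    have "(\<integral>y. \<bar>w y - r y\<bar> \<partial>\<mu>0) = (\<integral>y. (1 - 1 / c) * r y \<partial>\<mu>0)"
    proof (rule Bochner_Integration.integral_cong)
      show "\<bar>w y - r y\<bar> = (1 - 1 / c) * r y" for y
        using w0(2)[of y] unfolding w_def by (simp add: left_diff_distrib)
    qed simp
    also have "\<dots> = (1 - 1 / c) * (\<integral>y. r y \<partial>\<mu>0)" by simp
    also have "\<dots> \<le> (1 - 1 / c) * c" using c1 unfolding c_def by (intro mult_left_mono) auto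
    also have "\<dots> = c - 1" using c1 by (simp add: field_simps)
    finally show ?thesis using c2 by simp
  qed
  have wh: "\<bar>(\<phi> y - \<phi> x) * w y - (\<phi> y - \<phi> x) * h y\<bar> \<le> Z * (\<bar>w y - r y\<bar> + \<bar>r y - h y\<bar>)" for y
  proof (cases "D N y")
    case True
    then have "\<gamma> (dist y xo) \<le> real N" unfolding D_def by simp
    then have "\<bar>\<phi> y\<bar> \<le> a + b * real N" using ab(3)[of y] mult_left_mono[of "\<gamma> (dist y xo)" "real N" b] ab(2) by linarith
    then have z: "\<bar>\<phi> y - \<phi> x\<bar> \<le> Z" unfolding Z_def by linarith
    have "\<bar>(\<phi> y - \<phi> x) * w y - (\<phi> y - \<phi> x) * h y\<bar> = \<bar>\<phi> y - \<phi> x\<bar> * \<bar>w y - h y\<bar>"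
      by (simp flip: right_diff_distrib add: abs_mult)
    also have "\<dots> \<le> Z * (\<bar>w y - r y\<bar> + \<bar>r y - h y\<bar>)"
      using z Z0 by (intro mult_mono) auto
    finally show ?thesis .
  next
    case False
    then have "h y = 0" "r y = 0" unfolding h_def r_def raw_cell_def D_def by auto
    then show ?thesis unfolding w_def by simp
  qed
  have hint: "integrable \<mu>0 (\<lambda>y. (\<phi> y - \<phi> x) * h y)"
    by (rule Bochner_Integration.integrable_bound[OF int])
       (use h F(2) in \<open>auto simp: abs_mult intro!: AE_I2 mult_left_mono\<close>)
  have whi: "integrable \<mu>0 (\<lambda>y. (\<phi> y - \<phi> x) * w y - (\<phi> y - \<phi> x) * h y)"
    by (rule Bochner_Integration.integrable_bound[of _ "\<lambda>y. Z * (\<bar>w y - r y\<bar> + \<bar>r y - h y\<bar>)"])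
       (use wh ri hi wi Z0 in \<open>auto intro!: AE_I2 order_trans[OF wh]\<close>)
  have wint: "integrable \<mu>0 (\<lambda>y. (\<phi> y - \<phi> x) * w y)"
    using Bochner_Integration.integrable_add[OF whi hint] by simp
  have "(\<integral>y. (\<phi> y - \<phi> x) * w y \<partial>\<mu>0) - (\<integral>y. (\<phi> y - \<phi> x) * h y \<partial>\<mu>0)
      = (\<integral>y. (\<phi> y - \<phi> x) * w y - (\<phi> y - \<phi> x) * h y \<partial>\<mu>0)"
    using wint hint by simp
  also have "\<dots> \<le> (\<integral>y. Z * (\<bar>w y - r y\<bar> + \<bar>r y - h y\<bar>) \<partial>\<mu>0)"
  proof (rule integral_mono[OF whi])
    show "(\<phi> y - \<phi> x) * w y - (\<phi> y - \<phi> x) * h y \<le> Z * (\<bar>w y - r y\<bar> + \<bar>r y - h y\<bar>)" for y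
      using wh[of y] by linarith
  qed (use ri hi wi in auto)
  also have "\<dots> = Z * ((\<integral>y. \<bar>w y - r y\<bar> \<partial>\<mu>0) + (\<integral>y. \<bar>r y - h y\<bar> \<partial>\<mu>0))"
    using ri hi wi by simp
  also have "\<dots> \<le> Z * (e2 + e2)" using wr rh2 Z0 by (intro mult_left_mono add_mono) auto
  also have "\<dots> \<le> e / 3" using e1Z unfolding e2_def by (simp add: algebra_simps)
  finally have I: "(\<integral>y. (\<phi> y - \<phi> x) * w y \<partial>\<mu>0) \<le> (\<integral>y. (\<phi> y - \<phi> x) * f y \<partial>\<mu>0) + 2 * (e / 3)"
    using N unfolding h_def[symmetric] by linarith
  have "bint x w \<le> bint x r" using w0 by (intro bint_mono)
  also have "bint x r \<le> (\<integral>\<^sup>+ y. \<beta> (step U q L y) \<partial>\<mu>0)"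
    unfolding bint_def using r0 raw_cell_bounds(3)[of x _ U N q L]
    by (intro nn_integral_mono beta_mono) (auto simp: r_def)
  also have "\<dots> \<le> bint x f + ennreal e1" using qL(3) gf by (meson add_right_mono order_trans)
  finally have "enn2real (bint x w) \<le> enn2real (bint x f + ennreal e1)"
    using fin by (intro enn2real_mono) auto
  also have "\<dots> = enn2real (bint x f) + e1"
    using fin e1 by (subst enn2real_plus) auto
  finally have "free_energy \<phi> x w \<le> free_energy \<phi> x f + e"
    unfolding free_energy_def using I e1e by linarith
  then show ?thesis using that[of "(N, q, L)"] unfolding w by blast
qed


section \<open>The infimal functional over the countable family\<close>

lemma subdensity_zero: "subdensity (\<lambda>y. 0)"
  unfolding subdensity_def by simp

lemma Q_hat_eq_INF_cells:
  assumes U: "topological_basis (range U)" and \<phi>: "\<phi> \<in> \<Phi>"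
  shows "Q_hat \<beta> \<gamma> \<mu>0 xo \<phi> x = (INF t. ereal (free_energy \<phi> x (cell U t x)))"
proof (rule antisym)
  let ?I = "INF t. ereal (free_energy \<phi> x (cell U t x))"
  note Uo = range_basis_open[OF U(1)]
  show "Q_hat \<beta> \<gamma> \<mu>0 xo \<phi> x \<le> ?I"
    by (intro INF_greatest Q_hat_le_free_energy \<phi> subdensity_cell mix_cell_in_P_gamma Uo bint_cell_finite)
  show "?I \<le> Q_hat \<beta> \<gamma> \<mu>0 xo \<phi> x"
    unfolding Q_hat_def
  proof (rule INF_greatest)
    fix p assume p: "p \<in> {p \<in> \<P>. ac_off \<mu>0 x p}"
    then have pP: "p \<in> \<P>" by simp
    obtain f where f: "subdensity f" "p = mix \<mu>0 f x"
      using ac_off_eq_mix[OF P_gammaD(1,2)[OF pP]] p by blast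
    note F = subdensityD[OF f(1)]
    note I = integral_mix[OF sets_\<mu>0 F(1,2,3) Phi_measurable[OF \<phi>] Phi_integrable[OF \<phi> pP, unfolded f(2)]]
    have b: "beta_integral \<beta> \<gamma> \<mu>0 x p = bint x f" unfolding f(2) by (rule mix_subdensity(2)[OF f(1)])
    show "?I \<le> ereal (\<integral> y. \<phi> y \<partial>p) + enn2ereal (beta_integral \<beta> \<gamma> \<mu>0 x p)"
    proof (cases "bint x f < \<infinity>")
      case True
      have eq: "ereal (\<integral> y. \<phi> y \<partial>p) + enn2ereal (beta_integral \<beta> \<gamma> \<mu>0 x p) = ereal (free_energy \<phi> x f)"
        unfolding free_energy_def f(2) I(2) mix_subdensity(2)[OF f(1)] using True by (cases "bint x f") (auto simp: enn2ereal_ennreal)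
      show ?thesis unfolding eq
      proof (rule ereal_le_epsilon2)
        fix e :: real assume "0 < e"
        then obtain t where t: "free_energy \<phi> x (cell U t x) \<le> free_energy \<phi> x f + e"
          using free_energy_cell_approx[OF U \<phi> f(1) I(1) True] by blast
        have "?I \<le> ereal (free_energy \<phi> x (cell U t x))"
          by (rule INF_lower) simp
        also have "\<dots> \<le> ereal (free_energy \<phi> x f) + ereal e" using t by simp
        finally show "?I \<le> ereal (free_energy \<phi> x f) + ereal e" .
      qed
    next
      case False
      then have "bint x f = \<infinity>" by (simp add: less_top[symmetric])
      then show ?thesis unfolding b by simp
    qed
  qed
qed

definition Q_real :: "('a \<Rightarrow> real) \<Rightarrow> 'a \<Rightarrow> real" where
  "Q_real \<phi> x = real_of_ereal (Q_hat \<beta> \<gamma> \<mu>0 xo \<phi> x)"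

text \<open>The zero subdensity leaves all mass at x free of charge, which gives the upper bound.
  With the lower bound, \<open>Q_hat\<close> is finite and \<open>real_of_ereal\<close> loses
  nothing.\<close>

lemma Q_hat_bounds:
  assumes \<phi>: "\<phi> \<in> \<Phi>" and B: "\<And>x. B \<le> \<phi> x"
  shows "ereal B \<le> Q_hat \<beta> \<gamma> \<mu>0 xo \<phi> x" "Q_hat \<beta> \<gamma> \<mu>0 xo \<phi> x \<le> ereal (\<phi> x)"
    "Q_hat \<beta> \<gamma> \<mu>0 xo \<phi> x = ereal (Q_real \<phi> x)" "B \<le> Q_real \<phi> x" "Q_real \<phi> x \<le> \<phi> x"
proof -
  show lo: "ereal B \<le> Q_hat \<beta> \<gamma> \<mu>0 xo \<phi> x"
    unfolding Q_hat_def
  proof (rule INF_greatest)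
    fix p assume p: "p \<in> {p \<in> \<P>. ac_off \<mu>0 x p}"
    then have pP: "p \<in> \<P>" by simp
    interpret p: prob_space p by (rule P_gammaD(1)[OF pP])
    have "(\<integral>y. B \<partial>p) \<le> (\<integral>y. \<phi> y \<partial>p)" by (intro integral_mono Phi_integrable[OF \<phi> pP] B) auto
    then have "ereal B + 0 \<le> ereal (\<integral> y. \<phi> y \<partial>p) + enn2ereal (beta_integral \<beta> \<gamma> \<mu>0 x p)"
      by (intro add_mono) (auto simp: p.prob_space)
    then show "ereal B \<le> ereal (\<integral> y. \<phi> y \<partial>p) + enn2ereal (beta_integral \<beta> \<gamma> \<mu>0 x p)" by simp
  qed
  have b0: "bint x (\<lambda>y. 0) = 0" unfolding bint_def by (simp add: beta_0)
  have "(\<integral>\<^sup>+ y. ennreal (\<gamma> (dist y xo)) \<partial>mix \<mu>0 (\<lambda>y. 0) x) = ennreal (\<gamma> (dist x xo))"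
    by (subst nn_integral_mix[OF sets_\<mu>0]) auto
  then have "mix \<mu>0 (\<lambda>y. 0) x \<in> \<P>"
    unfolding P_gamma_def using prob_space_mix[OF sets_\<mu>0, of "\<lambda>y. 0" x] by simp
  from Q_hat_le_free_energy[OF \<phi> subdensity_zero this] b0
  show hi: "Q_hat \<beta> \<gamma> \<mu>0 xo \<phi> x \<le> ereal (\<phi> x)" unfolding free_energy_def by simp
  show eq: "Q_hat \<beta> \<gamma> \<mu>0 xo \<phi> x = ereal (Q_real \<phi> x)"
    unfolding Q_real_def using lo hi by (cases "Q_hat \<beta> \<gamma> \<mu>0 xo \<phi> x") auto
  show "B \<le> Q_real \<phi> x" "Q_real \<phi> x \<le> \<phi> x" using lo hi unfolding eq by auto
qed

lemma PhiB:
  assumes "\<phi> \<in> \<Phi>"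
  obtains B where "0 \<le> B" "\<And>x. - B \<le> \<phi> x"
proof -
  obtain m where m: "\<And>x. m \<le> \<phi> x" using assms unfolding Phi_gamma_b_def bdd_below_def by auto
  then have "- \<bar>m\<bar> \<le> \<phi> x" for x by (meson abs_le_D2 abs_ge_minus_self minus_le_iff order_trans abs_ge_self order_refl)
  then show ?thesis using that[of "\<bar>m\<bar>"] by simp
qed

lemma ex_nat_basis: "\<exists>U :: nat \<Rightarrow> 'a set. topological_basis (range U)"
proof -
  obtain B :: "'a set set" where B: "countable B" "topological_basis B" using ex_countable_basis by blast
  have "B \<noteq> {}" using topological_basisE[OF B(2) open_UNIV UNIV_I] by blast
  then show ?thesis using range_from_nat_into[of B] B by metis
qed

lemma free_energy_cell_measurable:
  assumes Uo: "\<And>i. open (U i)" and \<phi>: "\<phi> \<in> borel_measurable borel"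
  shows "(\<lambda>x. free_energy \<phi> x (cell U t x)) \<in> borel_measurable borel"
proof -
  note [measurable] = \<phi>
  have c: "(\<lambda>z. cell U t (fst z) (snd z)) \<in> borel_measurable borel2"
    by (rule cell_measurable[of U, OF Uo])
  have [measurable]: "(\<lambda>z. cell U t (fst z) (snd z)) \<in> borel_measurable (borel \<Otimes>\<^sub>M \<mu>0)"
    using c by (simp cong: measurable_cong_sets sets_pair_measure_cong add: sets_\<mu>0)
  have 1: "(\<lambda>x. \<integral>y. (\<phi> y - \<phi> x) * cell U t x y \<partial>\<mu>0) \<in> borel_measurable borel"
    by (rule \<mu>0.borel_measurable_lebesgue_integral) (simp add: case_prod_unfold, measurable)
  have "(\<lambda>x. \<integral>\<^sup>+ y. (\<lambda>z. \<beta> (\<gamma>d z * cell U t (fst z) (snd z))) (x, y) \<partial>\<mu>0) \<in> borel_measurable borel"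
    by (intro \<mu>0.borel_measurable_nn_integral_fst beta_measurable mult_nonneg_nonneg)
       (measurable, auto simp: cell_bounds)
  then have 2: "(\<lambda>x. bint x (cell U t x)) \<in> borel_measurable borel" unfolding bint_def by simp
  show ?thesis unfolding free_energy_def using 1 2 by measurable
qed

lemma Q_real_measurable[measurable_dest]:
  assumes \<phi>: "\<phi> \<in> \<Phi>"
  shows "Q_real \<phi> \<in> borel_measurable borel"
proof -
  obtain U :: "nat \<Rightarrow> 'a set" where U: "topological_basis (range U)" using ex_nat_basis by blast
  note Uo = range_basis_open[OF U(1)]
  note [measurable] = free_energy_cell_measurable[of U, OF Uo Phi_measurable[OF \<phi>]]
  show ?thesis unfolding Q_real_def[abs_def] Q_hat_eq_INF_cells[OF U \<phi>]
    by measurable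
qed

lemma near_optimal_kernel:
  assumes \<phi>: "\<phi> \<in> \<Phi>" and e: "0 < e"
  obtains F where "F \<in> borel_measurable borel2" "\<And>x. subdensity (\<lambda>y. F (x, y))"
    "\<And>x. bint x (\<lambda>y. F (x, y)) < \<infinity>" "\<And>x. free_energy \<phi> x (\<lambda>y. F (x, y)) \<le> Q_real \<phi> x + e"
proof -
  obtain U :: "nat \<Rightarrow> 'a set" where U: "topological_basis (range U)" using ex_nat_basis by blast
  note Uo = range_basis_open[OF U(1)]
  obtain B where B: "\<And>x. - B \<le> \<phi> x" using PhiB[OF \<phi>] by blast
  define c where "c i = cell U (from_nat i)" for i
  define P where "P x i \<longleftrightarrow> free_energy \<phi> x (c i x) \<le> Q_real \<phi> x + e" for x i
  have ex: "\<exists>i. P x i" for x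
  proof -
    have "(INF t. ereal (free_energy \<phi> x (cell U t x))) < ereal (Q_real \<phi> x + e)"
      unfolding Q_hat_eq_INF_cells[OF U \<phi>, symmetric] Q_hat_bounds(3)[OF \<phi> B] using e by simp
    then obtain t where "free_energy \<phi> x (cell U t x) < Q_real \<phi> x + e"
      unfolding INF_less_iff by auto
    then have "P x (to_nat t)" unfolding P_def c_def by simp
    then show ?thesis by blast
  qed
  \<comment> \<open>Taking the first good code gives a countably valued choice, measurable in x
    because each condition \<open>P x i\<close> is.\<close>
  define j where "j x = (LEAST i. P x i)" for x
  have j: "P x (j x)" for x unfolding j_def using ex by (rule LeastI_ex)
  have Pm[measurable]: "Measurable.pred borel (\<lambda>x. P x i)" for i
    unfolding P_def c_def
    using free_energy_cell_measurable[of U, OF Uo Phi_measurable[OF \<phi>]] Q_real_measurable[OF \<phi>] by measurable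
  have jm: "j \<in> borel \<rightarrow>\<^sub>M count_space UNIV" unfolding j_def by measurable
  show ?thesis
  proof
    let ?F = "\<lambda>z. c (j (fst z)) (fst z) (snd z)"
    show "?F \<in> borel_measurable borel2"
      unfolding c_def
      by (rule measurable_compose_countable[of "\<lambda>i z. cell U (from_nat i) (fst z) (snd z)",
            OF cell_measurable[of U, OF Uo] measurable_compose[OF measurable_fst jm]])
    show "subdensity (\<lambda>y. ?F (x, y))" for x using subdensity_cell[of U, OF Uo] unfolding c_def by simp
    show "bint x (\<lambda>y. ?F (x, y)) < \<infinity>" for x using bint_cell_finite[of x U] unfolding c_def by simp
    show "free_energy \<phi> x (\<lambda>y. ?F (x, y)) \<le> Q_real \<phi> x + e" for x
      using j[of x] unfolding P_def by simp
  qed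
qed


section \<open>Weak duality\<close>

lemma disintegrates_snd_eq_bind:
  assumes \<pi>: "\<pi> \<in> couplings \<mu> \<nu>" and d: "disintegrates \<pi> \<mu> p" and \<mu>: "prob_space \<mu>" "sets \<mu> = sets borel"
    and \<nu>: "sets \<nu> = sets borel"
  shows "\<nu> = \<mu> \<bind> p"
proof -
  interpret \<mu>: prob_space \<mu> by fact
  have p: "p \<in> \<mu> \<rightarrow>\<^sub>M subprob_algebra borel"
    using d \<mu>(2) unfolding disintegrates_def
    by (auto intro: measurable_prob_algebraD cong: measurable_cong_sets)
  have sp: "space \<pi> = UNIV" and \<pi>s: "sets \<pi> = sets borel2" and \<pi>2: "distr \<pi> borel snd = \<nu>"
    using \<pi> sets_eq_imp_space_eq[of \<pi> "borel2"] unfolding couplings_def by (auto simp: space_pair_measure)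
  have sm: "space \<mu> = UNIV" using sets_eq_imp_space_eq[OF \<mu>(2)] by simp
  show ?thesis
  proof (rule measure_eqI)
    show "sets \<nu> = sets (\<mu> \<bind> p)" using sets_bind_measurable[OF p \<mu>.not_empty] \<nu> by simp
    fix B assume "B \<in> sets \<nu>"
    then have B: "B \<in> sets borel" using \<nu> by simp
    have "emeasure \<nu> B = emeasure \<pi> (snd -` B \<inter> space \<pi>)"
      unfolding \<pi>2[symmetric] using B
      by (intro emeasure_distr) (auto simp: measurable_cong_sets[OF \<pi>s refl])
    also have "snd -` B \<inter> space \<pi> = UNIV \<times> B" using sp by auto
    also have "emeasure \<pi> (UNIV \<times> B) = (\<integral>\<^sup>+ x\<in>UNIV. emeasure (p x) B \<partial>\<mu>)"
      using conjunct2[OF d[unfolded disintegrates_def]] B sets.top[of "borel :: 'a measure"] by simp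
    also have "\<dots> = emeasure (\<mu> \<bind> p) B"
      using emeasure_bind[OF \<mu>.not_empty p B] by simp
    finally show "emeasure \<nu> B = emeasure (\<mu> \<bind> p) B" .
  qed
qed

lemma Q_real_integrable:
  assumes \<phi>: "\<phi> \<in> \<Phi>" and \<mu>: "\<mu> \<in> \<P>"
  shows "integrable \<mu> (Q_real \<phi>)"
proof -
  note [measurable_cong] = P_gammaD(2)[OF \<mu>]
  note [measurable] = Q_real_measurable[OF \<phi>]
  interpret \<mu>: prob_space \<mu> by (rule P_gammaD(1)[OF \<mu>])
  obtain B where B: "0 \<le> B" "\<And>x. - B \<le> \<phi> x" using PhiB[OF \<phi>] by blast
  show ?thesis
  proof (rule Bochner_Integration.integrable_bound[of _ "\<lambda>x. \<bar>\<phi> x\<bar> + B"])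
    show "integrable \<mu> (\<lambda>x. \<bar>\<phi> x\<bar> + B)" using Phi_integrable[OF \<phi> \<mu>] by auto
    have "\<bar>Q_real \<phi> x\<bar> \<le> \<bar>\<phi> x\<bar> + B" for x
      using Q_hat_bounds(4,5)[OF \<phi> B(2), of x] B(1) by linarith
    then show "AE x in \<mu>. norm (Q_real \<phi> x) \<le> norm (\<bar>\<phi> x\<bar> + B)" using B(1) by auto
  qed measurable
qed

lemma Phi_nn_integral:
  assumes \<phi>: "\<phi> \<in> \<Phi>" and p: "p \<in> \<P>" and B: "\<And>x. 0 \<le> \<phi> x + B"
  shows "(\<integral>\<^sup>+ y. ennreal (\<phi> y + B) \<partial>p) = ennreal ((\<integral>y. \<phi> y \<partial>p) + B)" "0 \<le> (\<integral>y. \<phi> y \<partial>p) + B"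
proof -
  interpret p: prob_space p by (rule P_gammaD(1)[OF p])
  note i = Phi_integrable[OF \<phi> p]
  have eq: "(\<integral>y. \<phi> y + B \<partial>p) = (\<integral>y. \<phi> y \<partial>p) + B" using i by (simp add: p.prob_space)
  show "(\<integral>\<^sup>+ y. ennreal (\<phi> y + B) \<partial>p) = ennreal ((\<integral>y. \<phi> y \<partial>p) + B)"
    unfolding eq[symmetric] using i B by (intro nn_integral_eq_integral) auto
  have "0 \<le> (\<integral>y. \<phi> y + B \<partial>p)" using B by simp
  then show "0 \<le> (\<integral>y. \<phi> y \<partial>p) + B" unfolding eq .
qed

lemma weak_duality:
  assumes \<phi>: "\<phi> \<in> \<Phi>" and \<mu>: "\<mu> \<in> \<P>" and \<nu>: "\<nu> \<in> \<P>"
    and \<pi>: "\<pi> \<in> couplings \<mu> \<nu>" and d: "disintegrates \<pi> \<mu> p"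
  shows "ereal ((\<integral>x. Q_real \<phi> x \<partial>\<mu>) - (\<integral>y. \<phi> y \<partial>\<nu>)) \<le> enn2ereal (\<integral>\<^sup>+ x. cost \<beta> \<gamma> \<mu>0 x (p x) \<partial>\<mu>)"
proof -
  let ?T = "\<integral>\<^sup>+ x. cost \<beta> \<gamma> \<mu>0 x (p x) \<partial>\<mu>"
  note M = P_gammaD[OF \<mu>]
  note N = P_gammaD[OF \<nu>]
  interpret \<mu>: prob_space \<mu> by (rule M)
  interpret \<nu>: prob_space \<nu> by (rule N)
  note [measurable_cong] = M(2) N(2)
  note [measurable] = Q_real_measurable[OF \<phi>] Phi_measurable[OF \<phi>]
  obtain B where B: "0 \<le> B" "\<And>x. - B \<le> \<phi> x" using PhiB[OF \<phi>] by blast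
  have B': "0 \<le> \<phi> x + B" for x using B(2)[of x] by linarith
  have pk: "p \<in> borel \<rightarrow>\<^sub>M prob_algebra borel" using d unfolding disintegrates_def by blast
  have p: "p \<in> borel \<rightarrow>\<^sub>M subprob_algebra borel" using pk by (rule measurable_prob_algebraD)
  have p': "p \<in> \<mu> \<rightarrow>\<^sub>M subprob_algebra borel" using p by measurable
  have px: "prob_space (p x)" "sets (p x) = sets borel" for x
    using measurable_space[OF pk, of x] by (auto simp: space_prob_algebra)
  have nb: "\<nu> = \<mu> \<bind> p" by (rule disintegrates_snd_eq_bind[OF \<pi> d M(1,2) N(2)])
  have nn: "(\<integral>\<^sup>+ y. g y \<partial>\<nu>) = (\<integral>\<^sup>+ x. \<integral>\<^sup>+ y. g y \<partial>p x \<partial>\<mu>)" if "g \<in> borel_measurable borel" for g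
    unfolding nb by (rule nn_integral_bind[OF that p'])
  have im: "(\<lambda>x. \<integral>\<^sup>+ y. g y \<partial>p x) \<in> borel_measurable \<mu>" if "g \<in> borel_measurable borel" for g
    using measurable_compose[OF p' nn_integral_measurable_subprob_algebra[OF that]] .
  have gm: "(\<lambda>y. ennreal (\<gamma> (dist y xo))) \<in> borel_measurable borel" by measurable
  have "(\<integral>\<^sup>+ x. \<integral>\<^sup>+ y. ennreal (\<gamma> (dist y xo)) \<partial>p x \<partial>\<mu>) < \<infinity>"
    using N(3) unfolding nn[OF gm] .
  then have "AE x in \<mu>. (\<integral>\<^sup>+ y. ennreal (\<gamma> (dist y xo)) \<partial>p x) \<noteq> \<infinity>"
    using im[OF gm] by (intro nn_integral_PInf_AE) auto
  \<comment> \<open>The \<gamma>-moment of \<nu> is the average of those of the kernel, so almost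
    every \<open>p x\<close> is a competitor in \<open>Q_hat\<close>.\<close>
  then have AEp: "AE x in \<mu>. p x \<in> \<P>"
    by eventually_elim (use px in \<open>auto simp: P_gamma_def less_top\<close>)
  define I where "I x = (\<integral>\<^sup>+ y. ennreal (\<phi> y + B) \<partial>p x)" for x
  have [measurable]: "I \<in> borel_measurable \<mu>" unfolding I_def by (rule im) measurable
  have In: "(\<integral>\<^sup>+ x. I x \<partial>\<mu>) = ennreal ((\<integral>y. \<phi> y \<partial>\<nu>) + B)"
  proof -
    have "(\<integral>\<^sup>+ x. I x \<partial>\<mu>) = (\<integral>\<^sup>+ y. ennreal (\<phi> y + B) \<partial>\<nu>)"
      unfolding I_def by (rule nn[symmetric]) measurable
    also have "\<dots> = ennreal ((\<integral>y. \<phi> y \<partial>\<nu>) + B)" by (rule Phi_nn_integral(1)[OF \<phi> \<nu> B'])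
    finally show ?thesis .
  qed
  \<comment> \<open>Measurability in x of the cost along the kernel is not established. Addition
    under the integral is applied only to this truncated difference, which is measurable; the cost
    enters by monotonicity alone.\<close>
  have AEc: "AE x in \<mu>. ennreal (Q_real \<phi> x + B) - I x \<le> cost \<beta> \<gamma> \<mu>0 x (p x)"
    using AEp
  proof eventually_elim
    case (elim x)
    interpret px: prob_space "p x" by (rule px)
    show ?case
    proof (cases "ac_off \<mu>0 x (p x) \<and> beta_integral \<beta> \<gamma> \<mu>0 x (p x) < \<infinity>")
      case True
      then have c: "cost \<beta> \<gamma> \<mu>0 x (p x) = beta_integral \<beta> \<gamma> \<mu>0 x (p x)" by (simp add: cost_def)
      obtain c where c': "beta_integral \<beta> \<gamma> \<mu>0 x (p x) = ennreal c" "0 \<le> c"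
        using True by (cases "beta_integral \<beta> \<gamma> \<mu>0 x (p x)") auto
      have "ereal (Q_real \<phi> x) \<le> ereal (\<integral>y. \<phi> y \<partial>p x) + enn2ereal (beta_integral \<beta> \<gamma> \<mu>0 x (p x))"
        unfolding Q_hat_bounds(3)[OF \<phi> B(2), symmetric] Q_hat_def using elim True by (intro INF_lower) auto
      then have q: "Q_real \<phi> x \<le> (\<integral>y. \<phi> y \<partial>p x) + c" unfolding c' using c'(2) by (simp add: enn2ereal_ennreal)
      have I: "I x = ennreal ((\<integral>y. \<phi> y \<partial>p x) + B)"
        unfolding I_def by (rule Phi_nn_integral(1)[OF \<phi> elim B'])
      have "0 \<le> (\<integral>y. \<phi> y \<partial>p x) + B" by (rule Phi_nn_integral(2)[OF \<phi> elim B'])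
      then have "ennreal (Q_real \<phi> x + B) - I x = ennreal (Q_real \<phi> x + B - ((\<integral>y. \<phi> y \<partial>p x) + B))"
        unfolding I by (rule ennreal_minus)
      also have "\<dots> \<le> ennreal c" using q by (intro ennreal_leI) simp
      finally show ?thesis unfolding c c' .
    next
      case False
      then have "cost \<beta> \<gamma> \<mu>0 x (p x) = \<infinity>" unfolding cost_def by (auto simp: less_top[symmetric])
      then show ?thesis by simp
    qed
  qed
  have "ennreal ((\<integral>x. Q_real \<phi> x \<partial>\<mu>) + B) = ennreal (\<integral>x. Q_real \<phi> x + B \<partial>\<mu>)"
    using Q_real_integrable[OF \<phi> \<mu>] by (simp add: \<mu>.prob_space)
  also have "\<dots> = (\<integral>\<^sup>+ x. ennreal (Q_real \<phi> x + B) \<partial>\<mu>)"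
  proof (rule nn_integral_eq_integral[symmetric])
    have "0 \<le> Q_real \<phi> x + B" for x using Q_hat_bounds(4)[OF \<phi> B(2), of x] by linarith
    then show "AE x in \<mu>. 0 \<le> Q_real \<phi> x + B" by simp
  qed (use Q_real_integrable[OF \<phi> \<mu>] in auto)
  also have "\<dots> \<le> (\<integral>\<^sup>+ x. (ennreal (Q_real \<phi> x + B) - I x) + I x \<partial>\<mu>)"
  proof (rule nn_integral_mono)
    have ge: "a \<le> (a - b) + b" for a b :: ennreal
      by (cases "b \<le> a") (auto simp: diff_add_cancel_ennreal intro: add_increasing)
    show "ennreal (Q_real \<phi> x + B) \<le> (ennreal (Q_real \<phi> x + B) - I x) + I x" for x by (rule ge)
  qed
  also have "\<dots> = (\<integral>\<^sup>+ x. (ennreal (Q_real \<phi> x + B) - I x) \<partial>\<mu>) + (\<integral>\<^sup>+ x. I x \<partial>\<mu>)"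
    by (intro nn_integral_add) measurable
  also have "\<dots> \<le> ?T + ennreal ((\<integral>y. \<phi> y \<partial>\<nu>) + B)"
    unfolding In by (intro add_right_mono nn_integral_mono_AE AEc)
  finally have main: "ennreal ((\<integral>x. Q_real \<phi> x \<partial>\<mu>) + B)
     \<le> ?T + ennreal ((\<integral>y. \<phi> y \<partial>\<nu>) + B)" .
  have n0: "0 \<le> (\<integral>y. \<phi> y \<partial>\<nu>) + B" by (rule Phi_nn_integral(2)[OF \<phi> \<nu> B'])
  show ?thesis
  proof (cases ?T)
    case (real T)
    then have "(\<integral>x. Q_real \<phi> x \<partial>\<mu>) + B \<le> T + ((\<integral>y. \<phi> y \<partial>\<nu>) + B)"
      using main n0 by (simp add: ennreal_plus[symmetric] ennreal_le_iff del: ennreal_plus)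
    then show ?thesis using real by (simp add: enn2ereal_ennreal)
  qed simp
qed

end

section \<open>Strong duality\<close>

locale weak_transport_source = weak_transport \<beta> \<gamma> \<mu>0 xo
  for \<beta> :: "real \<Rightarrow> ennreal" and \<gamma> :: "real \<Rightarrow> real" and \<mu>0 :: "'a::polish_space measure" and xo :: 'a +
  fixes \<mu> :: "'a measure"
  assumes mu_P: "\<mu> \<in> \<P>"
begin

section \<open>Admissible densities on the product space and their cost\<close>

lemma sets_mu[measurable_cong]: "sets \<mu> = sets borel"
  by (rule P_gammaD(2)[OF mu_P])

sublocale mu: prob_space \<mu> by (rule P_gammaD(1)[OF mu_P])

sublocale pr: pair_prob_space \<mu> \<mu>0 ..

lemma space_mu[simp]: "space \<mu> = UNIV"
  using sets_eq_imp_space_eq[OF sets_mu] by simp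

abbreviation m :: "('a \<times> 'a) measure" where "m \<equiv> \<mu> \<Otimes>\<^sub>M \<mu>0"

lemma sets_m: "sets m = sets borel2"
  by (intro sets_pair_measure_cong sets_mu sets_\<mu>0)

text \<open>The mass bound is imposed for every x, not just almost every x, so that
  \<open>mix\<close> yields a probability kernel without modification on a null set.\<close>

definition adm :: "('a \<times> 'a \<Rightarrow> real) \<Rightarrow> bool" where
  "adm F \<longleftrightarrow> F \<in> borel_measurable borel2 \<and> (\<forall>z. 0 \<le> F z) \<and> (\<forall>x. (\<integral>\<^sup>+ y. F (x, y) \<partial>\<mu>0) \<le> 1)"

definition J :: "('a \<times> 'a \<Rightarrow> real) \<Rightarrow> ennreal" where
  "J F = (\<integral>\<^sup>+ z. \<beta> (\<gamma>d z * F z) \<partial>m)"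

text \<open>The change in the integral of \<phi> between \<mu> and the second marginal generated by
  F; see \<open>integral_bind_mix\<close>.\<close>

definition shift :: "('a \<Rightarrow> real) \<Rightarrow> ('a \<times> 'a \<Rightarrow> real) \<Rightarrow> real" where
  "shift \<phi> F = (\<integral>z. (\<phi> (snd z) - \<phi> (fst z)) * F z \<partial>m)"

lemma admD:
  assumes "adm F"
  shows "F \<in> borel_measurable borel2" "F \<in> borel_measurable m" "0 \<le> F z" "subdensity (\<lambda>y. F (x, y))"
    "(\<integral>\<^sup>+ z. F z \<partial>m) \<le> 1" "integrable m F" "(\<integral>z. F z \<partial>m) \<le> 1"
proof -
  show F: "F \<in> borel_measurable borel2" "\<And>z. 0 \<le> F z"
    using assms unfolding adm_def by auto
  have le: "(\<integral>\<^sup>+ y. F (x, y) \<partial>\<mu>0) \<le> 1" for x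
    using assms unfolding adm_def by auto
  show Fm: "F \<in> borel_measurable m" using F(1) by (simp add: measurable_cong_sets[OF sets_m refl])
  show "subdensity (\<lambda>y. F (x, y))"
    unfolding subdensity_def using F le measurable_Pair2[OF F(1)] by simp
  have "(\<integral>\<^sup>+ z. F z \<partial>m) = (\<integral>\<^sup>+ x. \<integral>\<^sup>+ y. F (x, y) \<partial>\<mu>0 \<partial>\<mu>)"
    using \<mu>0.nn_integral_fst[OF measurable_compose[OF Fm measurable_ennreal]] by simp
  also have "\<dots> \<le> (\<integral>\<^sup>+ x. 1 \<partial>\<mu>)" by (intro nn_integral_mono le)
  finally show le1: "(\<integral>\<^sup>+ z. F z \<partial>m) \<le> 1" using mu.emeasure_space_1 by simp
  show i: "integrable m F"
    using Fm F(2) le1 by (intro integrableI_bounded) (auto intro: le_less_trans)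
  have "ennreal (\<integral>z. F z \<partial>m) = (\<integral>\<^sup>+ z. F z \<partial>m)"
    using i F(2) by (intro nn_integral_eq_integral[symmetric]) auto
  then show "(\<integral>z. F z \<partial>m) \<le> 1" using le1 by (metis ennreal_le_1)
qed

lemma J_measurable_integrand:
  assumes "adm F"
  shows "(\<lambda>z. \<beta> (\<gamma>d z * F z)) \<in> borel_measurable m"
proof -
  note [measurable] = admD(2)[OF assms]
  show ?thesis by (intro beta_measurable mult_nonneg_nonneg admD(3)[OF assms] gamma_dist_nonneg) measurable
qed

lemma J_eq_bint:
  assumes "adm F"
  shows "J F = (\<integral>\<^sup>+ x. bint x (\<lambda>y. F (x, y)) \<partial>\<mu>)"
  unfolding J_def bint_def using \<mu>0.nn_integral_fst[OF J_measurable_integrand[OF assms]] by simp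

lemma adm_integrable_mult:
  assumes F: "adm F" and u: "u \<in> borel_measurable m" "\<And>z. \<bar>u z\<bar> \<le> c"
  shows "integrable m (\<lambda>z. u z * F z)"
proof (rule Bochner_Integration.integrable_bound[of _ "\<lambda>z. c * F z"])
  show "integrable m (\<lambda>z. c * F z)" using admD(6)[OF F] by simp
  show "(\<lambda>z. u z * F z) \<in> borel_measurable m" using u(1) admD(2)[OF F] by measurable
  have "\<bar>u z\<bar> \<le> \<bar>c\<bar>" for z using u(2)[of z] by linarith
  then show "AE z in m. norm (u z * F z) \<le> norm (c * F z)"
    by (simp add: abs_mult mult_right_mono)
qed

lemma shift_integrable:
  assumes F: "adm F" and u: "u \<in> borel_measurable borel" "\<And>x. \<bar>u x\<bar> \<le> c"
  shows "integrable m (\<lambda>z. (u (snd z) - u (fst z)) * F z)"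
proof (rule adm_integrable_mult[OF F, where c = "2 * c"])
  note [measurable] = u(1)
  show "(\<lambda>z. u (snd z) - u (fst z)) \<in> borel_measurable m" by measurable
  show "\<bar>u (snd z) - u (fst z)\<bar> \<le> 2 * c" for z
    using u(2)[of "snd z"] u(2)[of "fst z"] by linarith
qed

lemma shift_fubini:
  assumes F: "adm F" and u: "u \<in> borel_measurable borel" "\<And>x. \<bar>u x\<bar> \<le> c"
  shows "shift u F = (\<integral>x. \<integral>y. (u y - u x) * F (x, y) \<partial>\<mu>0 \<partial>\<mu>)"
    "integrable \<mu> (\<lambda>x. \<integral>y. (u y - u x) * F (x, y) \<partial>\<mu>0)"
  using pr.integrable_fst'[OF shift_integrable[OF assms]] pr.integral_fst'[OF shift_integrable[OF assms]]
  unfolding shift_def by simp_all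

lemma adm_convex:
  assumes F: "adm F" and G: "adm G" and t: "0 \<le> t" "t \<le> 1"
  shows "adm (\<lambda>z. (1 - t) * F z + t * G z)"
proof -
  note [measurable] = admD(1)[OF F] admD(1)[OF G]
  have "(\<integral>\<^sup>+ y. ennreal ((1 - t) * F (x, y) + t * G (x, y)) \<partial>\<mu>0) \<le> 1" for x
  proof -
    have "(\<integral>\<^sup>+ y. ennreal ((1 - t) * F (x, y) + t * G (x, y)) \<partial>\<mu>0)
        = (\<integral>\<^sup>+ y. ennreal (1 - t) * ennreal (F (x, y)) + ennreal t * ennreal (G (x, y)) \<partial>\<mu>0)"
      using t admD(3)[OF F] admD(3)[OF G] by (intro nn_integral_cong) (simp add: ennreal_mult ennreal_plus)
    also have "\<dots> = ennreal (1 - t) * (\<integral>\<^sup>+ y. F (x, y) \<partial>\<mu>0) + ennreal t * (\<integral>\<^sup>+ y. G (x, y) \<partial>\<mu>0)"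
      by (simp add: nn_integral_add nn_integral_cmult)
    also have "\<dots> \<le> ennreal (1 - t) * 1 + ennreal t * 1"
      using subdensityD(3)[OF admD(4)[OF F]] subdensityD(3)[OF admD(4)[OF G]] by (intro add_mono mult_left_mono) auto
    also have "\<dots> = 1" using t by (simp add: ennreal_plus[symmetric] del: ennreal_plus)
    finally show ?thesis .
  qed
  then show ?thesis unfolding adm_def using t admD(3)[OF F] admD(3)[OF G] by auto
qed

lemma J_convex:
  assumes F: "adm F" and G: "adm G" and t: "0 \<le> t" "t \<le> 1"
  shows "J (\<lambda>z. (1 - t) * F z + t * G z) \<le> ennreal (1 - t) * J F + ennreal t * J G"
proof -
  note [measurable] = J_measurable_integrand[OF F] J_measurable_integrand[OF G]
  have "J (\<lambda>z. (1 - t) * F z + t * G z) \<le> (\<integral>\<^sup>+ z. ennreal (1 - t) * \<beta> (\<gamma>d z * F z)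
      + ennreal t * \<beta> (\<gamma>d z * G z) \<partial>m)"
    unfolding J_def
  proof (rule nn_integral_mono)
    fix z
    have e: "\<gamma>d z * ((1 - t) * F z + t * G z)
      = (1 - t) * (\<gamma>d z * F z) + t * (\<gamma>d z * G z)"
      by (simp add: algebra_simps)
    show "\<beta> (\<gamma>d z * ((1 - t) * F z + t * G z)) \<le> ennreal (1 - t) * \<beta> (\<gamma>d z * F z)
      + ennreal t * \<beta> (\<gamma>d z * G z)"
      unfolding e by (intro beta_convexD mult_nonneg_nonneg gamma_dist_nonneg t admD(3)[OF F] admD(3)[OF G])
  qed
  also have "\<dots> = ennreal (1 - t) * J F + ennreal t * J G"
    unfolding J_def by (simp add: nn_integral_add nn_integral_cmult)
  finally show ?thesis .
qed

lemma shift_affine: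
  assumes F: "adm F" and G: "adm G" and u: "u \<in> borel_measurable borel" "\<And>x. \<bar>u x\<bar> \<le> c"
  shows "shift u (\<lambda>z. (1 - t) * F z + t * G z) = (1 - t) * shift u F + t * shift u G"
proof -
  have "shift u (\<lambda>z. (1 - t) * F z + t * G z) = (\<integral>z. (1 - t) * ((u (snd z) - u (fst z)) * F z)
      + t * ((u (snd z) - u (fst z)) * G z) \<partial>m)"
    unfolding shift_def by (intro Bochner_Integration.integral_cong refl) (simp add: algebra_simps)
  also have "\<dots> = (1 - t) * shift u F + t * shift u G"
    unfolding shift_def using shift_integrable[OF F u] shift_integrable[OF G u] by simp
  finally show ?thesis .
qed

lemma adm_zero: "adm (\<lambda>z. 0)" "J (\<lambda>z. 0) = 0"
  unfolding adm_def J_def by (simp_all add: beta_0)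

lemma adm_kernel:
  assumes F: "adm F"
  shows "(\<lambda>x. mix \<mu>0 (\<lambda>y. F (x, y)) x) \<in> borel \<rightarrow>\<^sub>M prob_algebra borel"
    "(\<lambda>x. mix \<mu>0 (\<lambda>y. F (x, y)) x) \<in> \<mu> \<rightarrow>\<^sub>M subprob_algebra borel"
proof -
  show pk: "(\<lambda>x. mix \<mu>0 (\<lambda>y. F (x, y)) x) \<in> borel \<rightarrow>\<^sub>M prob_algebra borel"
    using subdensityD(3)[OF admD(4)[OF F]]
    by (intro mix_kernel[OF sets_\<mu>0 \<mu>0.sigma_finite_measure_axioms admD(1)[OF F]]) auto
  show "(\<lambda>x. mix \<mu>0 (\<lambda>y. F (x, y)) x) \<in> \<mu> \<rightarrow>\<^sub>M subprob_algebra borel"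
    using measurable_prob_algebraD[OF pk] by measurable
qed

lemma T_hat_le_J:
  assumes F: "adm F" and snd: "\<mu> \<bind> (\<lambda>x. mix \<mu>0 (\<lambda>y. F (x, y)) x) = \<nu>"
  shows "T_hat \<beta> \<gamma> \<mu>0 \<nu> \<mu> \<le> J F"
proof -
  define p where "p x = mix \<mu>0 (\<lambda>y. F (x, y)) x" for x
  have pk[measurable]: "p \<in> borel \<rightarrow>\<^sub>M prob_algebra borel"
    and psub: "p \<in> \<mu> \<rightarrow>\<^sub>M subprob_algebra borel"
    unfolding p_def by (rule adm_kernel[OF F])+
  have px: "prob_space (p x)" "sets (p x) = sets borel" "space (p x) = UNIV" for x
    using measurable_space[OF pk, of x] sets_eq_imp_space_eq[of "p x" borel] by (auto simp: space_prob_algebra)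
  \<comment> \<open>\<open>k x\<close> is the point mass at x times \<open>p x\<close>, so averaging
    it over \<mu> gives the joint law with first marginal \<mu> and kernel p.\<close>
  define k where "k x = distr (p x) borel2 (\<lambda>y. (x, y))" for x
  have kk: "k \<in> borel \<rightarrow>\<^sub>M prob_algebra borel2"
    unfolding k_def by (rule measurable_distr_prob_space2[OF pk]) measurable
  have ksub: "k \<in> \<mu> \<rightarrow>\<^sub>M subprob_algebra borel2"
    using measurable_prob_algebraD[OF kk] by measurable
  have kx: "prob_space (k x)" for x
    using measurable_space[OF kk, of x] by (auto simp: space_prob_algebra)
  define \<pi> where "\<pi> = \<mu> \<bind> k"
  have ek: "emeasure (k x) (A \<times> B) = emeasure (p x) B * indicator A x"
    if [measurable]: "A \<in> sets borel" "B \<in> sets borel" for x A B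
  proof -
    have "(\<lambda>y. (x, y)) \<in> p x \<rightarrow>\<^sub>M borel2" using px(2)[of x] by (simp cong: measurable_cong_sets)
    then have "emeasure (k x) (A \<times> B) = emeasure (p x) ((\<lambda>y. (x, y)) -` (A \<times> B) \<inter> space (p x))"
      unfolding k_def by (intro emeasure_distr) auto
    also have "(\<lambda>y. (x, y)) -` (A \<times> B) \<inter> space (p x) = (if x \<in> A then B else {})" using px(3) by auto
    finally show ?thesis by simp
  qed
  have e\<pi>: "emeasure \<pi> (A \<times> B) = (\<integral>\<^sup>+ x\<in>A. emeasure (p x) B \<partial>\<mu>)"
    if "A \<in> sets borel" "B \<in> sets borel" for A B
    unfolding \<pi>_def using that ek by (subst emeasure_bind[OF mu.not_empty ksub]) auto
  have s\<pi>: "sets \<pi> = sets borel2"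
    unfolding \<pi>_def by (rule sets_bind_measurable[OF ksub mu.not_empty])
  have sp\<pi>: "space \<pi> = UNIV" using sets_eq_imp_space_eq[OF s\<pi>] by (simp add: space_pair_measure)
  have pr\<pi>: "prob_space \<pi>"
    unfolding \<pi>_def by (rule mu.prob_space_bind[OF AE_I2 ksub]) (rule kx)
  have "distr \<pi> borel fst = \<mu>"
  proof (rule measure_eqI)
    fix A assume "A \<in> sets (distr \<pi> borel fst)"
    then have [measurable]: "A \<in> sets borel" by simp
    have "emeasure (distr \<pi> borel fst) A = emeasure \<pi> (fst -` A \<inter> space \<pi>)"
      by (intro emeasure_distr) (auto simp: measurable_cong_sets[OF s\<pi> refl])
    also have "fst -` A \<inter> space \<pi> = A \<times> UNIV" using sp\<pi> by auto
    also have "emeasure \<pi> (A \<times> UNIV) = (\<integral>\<^sup>+ x. indicator A x \<partial>\<mu>)"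
      using e\<pi>[of A UNIV] px prob_space.emeasure_space_1[OF px(1)] by (simp cong: nn_integral_cong)
    finally show "emeasure (distr \<pi> borel fst) A = emeasure \<mu> A" by (simp add: sets_mu)
  qed (simp add: sets_mu)
  moreover have "distr \<pi> borel snd = \<nu>"
  proof (rule measure_eqI)
    show "sets (distr \<pi> borel snd) = sets \<nu>"
      unfolding snd[symmetric] p_def[symmetric] using sets_bind_measurable[OF psub mu.not_empty] by simp
    fix B assume "B \<in> sets (distr \<pi> borel snd)"
    then have [measurable]: "B \<in> sets borel" by simp
    have "emeasure (distr \<pi> borel snd) B = emeasure \<pi> (snd -` B \<inter> space \<pi>)"
      by (intro emeasure_distr) (auto simp: measurable_cong_sets[OF s\<pi> refl])
    also have "snd -` B \<inter> space \<pi> = UNIV \<times> B" using sp\<pi> by auto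
    also have "emeasure \<pi> (UNIV \<times> B) = (\<integral>\<^sup>+ x. emeasure (p x) B \<partial>\<mu>)" using e\<pi>[of UNIV B] by simp
    also have "\<dots> = emeasure \<nu> B"
      unfolding snd[symmetric] p_def[symmetric] by (rule emeasure_bind[OF mu.not_empty psub, symmetric]) simp
    finally show "emeasure (distr \<pi> borel snd) B = emeasure \<nu> B" .
  qed
  ultimately have c: "\<pi> \<in> couplings \<mu> \<nu>" unfolding couplings_def using pr\<pi> s\<pi> by simp
  have d: "disintegrates \<pi> \<mu> p" unfolding disintegrates_def using pk e\<pi> by blast
  have "cost \<beta> \<gamma> \<mu>0 x (p x) = bint x (\<lambda>y. F (x, y))" for x
    unfolding cost_def p_def using mix_subdensity[OF admD(4)[OF F]] by simp
  then have "(\<integral>\<^sup>+ x. cost \<beta> \<gamma> \<mu>0 x (p x) \<partial>\<mu>) = J F" unfolding J_eq_bint[OF F] by simp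
  then show ?thesis unfolding T_hat_def using c d by (intro Inf_lower) force
qed


section \<open>Almost couplings from a bound on the dual values\<close>

lemma near_optimal_adm:
  assumes \<phi>: "\<phi> \<in> \<Phi>" and bnd: "\<And>x. \<bar>\<phi> x\<bar> \<le> c" and e: "0 < e"
  obtains F where "adm F" "J F < \<infinity>"
    "enn2real (J F) + (\<integral>x. \<phi> x \<partial>\<mu>) + shift \<phi> F \<le> (\<integral>x. Q_real \<phi> x \<partial>\<mu>) + e"
proof -
  note \<phi>m[measurable] = Phi_measurable[OF \<phi>]
  obtain F where F: "F \<in> borel_measurable borel2" "\<And>x. subdensity (\<lambda>y. F (x, y))"
    "\<And>x. bint x (\<lambda>y. F (x, y)) < \<infinity>" "\<And>x. free_energy \<phi> x (\<lambda>y. F (x, y)) \<le> Q_real \<phi> x + e"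
    using near_optimal_kernel[OF \<phi> e] by blast
  have adm: "adm F"
    unfolding adm_def using F(1) subdensityD(2,3)[OF F(2)] by auto
  have bnd2: "- c \<le> \<phi> x" for x using bnd[of x] by linarith
  define b where "b x = enn2real (bint x (\<lambda>y. F (x, y)))" for x
  define s where "s x = (\<integral>y. (\<phi> y - \<phi> x) * F (x, y) \<partial>\<mu>0)" for x
  have fe: "\<phi> x + s x + b x \<le> Q_real \<phi> x + e" for x
    using F(4)[of x] unfolding free_energy_def b_def s_def .
  have bm: "(\<lambda>x. bint x (\<lambda>y. F (x, y))) \<in> borel_measurable \<mu>"
    unfolding bint_def using \<mu>0.borel_measurable_nn_integral_fst[OF J_measurable_integrand[OF adm]] by simp
  have [measurable]: "b \<in> borel_measurable \<mu>" unfolding b_def using bm by measurable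
  have si: "integrable \<mu> s" unfolding s_def by (rule shift_fubini(2)[OF adm \<phi>m bnd])
  have \<phi>i: "integrable \<mu> \<phi>" by (rule Phi_integrable[OF \<phi> mu_P])
  have Qi: "integrable \<mu> (Q_real \<phi>)" by (rule Q_real_integrable[OF \<phi> mu_P])
  \<comment> \<open>That each \<open>bint\<close> is finite does not make its average finite; the
    near-optimality inequality \<open>fe\<close> does, since its other terms are integrable.\<close>
  have bi: "integrable \<mu> b"
  proof (rule Bochner_Integration.integrable_bound[of _ "\<lambda>x. \<bar>Q_real \<phi> x\<bar> + e + \<bar>\<phi> x\<bar> + \<bar>s x\<bar>"])
    show "integrable \<mu> (\<lambda>x. \<bar>Q_real \<phi> x\<bar> + e + \<bar>\<phi> x\<bar> + \<bar>s x\<bar>)" using si \<phi>i Qi by auto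
    show "AE x in \<mu>. norm (b x) \<le> norm (\<bar>Q_real \<phi> x\<bar> + e + \<bar>\<phi> x\<bar> + \<bar>s x\<bar>)"
    proof (rule AE_I2)
      fix x
      have "0 \<le> b x" unfolding b_def by simp
      then show "norm (b x) \<le> norm (\<bar>Q_real \<phi> x\<bar> + e + \<bar>\<phi> x\<bar> + \<bar>s x\<bar>)"
        using fe[of x] e unfolding real_norm_def by linarith
    qed
  qed measurable
  have JF: "J F = ennreal (\<integral>x. b x \<partial>\<mu>)"
  proof -
    have "J F = (\<integral>\<^sup>+ x. ennreal (b x) \<partial>\<mu>)"
      unfolding J_eq_bint[OF adm] b_def using F(3) by (intro nn_integral_cong) simp
    also have "\<dots> = ennreal (\<integral>x. b x \<partial>\<mu>)"
      using bi by (rule nn_integral_eq_integral) (simp add: b_def)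
    finally show ?thesis .
  qed
  have b0: "0 \<le> (\<integral>x. b x \<partial>\<mu>)" unfolding b_def by simp
  have "(\<integral>x. \<phi> x + s x + b x \<partial>\<mu>) \<le> (\<integral>x. Q_real \<phi> x + e \<partial>\<mu>)"
    using \<phi>i si bi Qi by (intro integral_mono fe) auto
  then have "(\<integral>x. \<phi> x \<partial>\<mu>) + (\<integral>x. s x \<partial>\<mu>) + (\<integral>x. b x \<partial>\<mu>) \<le> (\<integral>x. Q_real \<phi> x \<partial>\<mu>) + e"
    using \<phi>i si bi Qi by (simp add: mu.prob_space[unfolded space_mu])
  moreover have "(\<integral>x. s x \<partial>\<mu>) = shift \<phi> F" unfolding s_def shift_fubini(1)[OF adm \<phi>m bnd] ..
  ultimately show ?thesis using that[OF adm] JF b0 by simp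
qed

text \<open>The first-order condition at an approximate minimiser of \<open>J\<close> plus a quadratic penalty; the
  combination \<open>\<Sum>i<k. r * a F i * \<psi> i\<close> acts as the dual potential.\<close>

lemma quadratic_penalty:
  fixes a :: "('a \<times> 'a \<Rightarrow> real) \<Rightarrow> nat \<Rightarrow> real" and k :: nat and r \<eta> :: real
  assumes aff: "\<And>F G t i. adm F \<Longrightarrow> adm G \<Longrightarrow> i < k \<Longrightarrow>
      a (\<lambda>z. (1 - t) * F z + t * G z) i = (1 - t) * a F i + t * a G i"
    and bnd: "\<And>F i. adm F \<Longrightarrow> i < k \<Longrightarrow> \<bar>a F i\<bar> \<le> c" and r: "0 \<le> r" and \<eta>: "0 < \<eta>"
  obtains F where "adm F" "J F < \<infinity>"
    "\<And>G. adm G \<Longrightarrow> J G < \<infinity> \<Longrightarrow>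
       enn2real (J F) + r * (\<Sum>i<k. a F i * a F i) \<le> enn2real (J G) + r * (\<Sum>i<k. a F i * a G i) + \<eta>"
proof -
  \<comment> \<open>With the factor r / 2, differentiating the penalty produces the weights
    \<open>r * a F i\<close>.\<close>
  define E where "E F = enn2real (J F) + r / 2 * (\<Sum>i<k. (a F i)\<^sup>2)" for F
  define A where "A = {F. adm F \<and> J F < \<infinity>}"
  have E0: "0 \<le> E F" for F unfolding E_def using r by (intro add_nonneg_nonneg mult_nonneg_nonneg sum_nonneg) auto
  have A0: "A \<noteq> {}" unfolding A_def using adm_zero by auto
  have bdd: "bdd_below (E ` A)" using E0 by (intro bdd_belowI[where m = 0]) auto
  \<comment> \<open>F minimises \<open>E\<close> up to \<open>t * t\<close>, and a move of length t
    towards G has a quadratic remainder. Both together are at most \<open>t * t * B\<close>, hence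
    \<open>t * B\<close> after division by t, and t is chosen to make this at most \<eta>.\<close>
  define B where "B = r / 2 * (\<Sum>i<k. (2 * c)\<^sup>2) + 1"
  have B: "1 \<le> B" unfolding B_def using r by (simp add: sum_nonneg)
  define t where "t = min 1 (\<eta> / B)"
  have t: "0 < t" "t \<le> 1" "t * B \<le> \<eta>"
  proof -
    show "0 < t" "t \<le> 1" unfolding t_def using \<eta> B by auto
    have "t * B \<le> \<eta> / B * B" unfolding t_def using B by (intro mult_right_mono) auto
    then show "t * B \<le> \<eta>" using B by simp
  qed
  have "Inf (E ` A) < Inf (E ` A) + t * t" using t by simp
  then have "\<exists>y\<in>E ` A. y < Inf (E ` A) + t * t"
    by (rule cInf_less_iff[THEN iffD1, rotated 2]) (use A0 bdd in auto)
  then obtain F where F: "F \<in> A" "E F < Inf (E ` A) + t * t" by blast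
  have aF: "adm F" and jF: "J F < \<infinity>" using F unfolding A_def by auto
  have min: "E F \<le> E G + t * t" if "G \<in> A" for G
    using cInf_lower[OF imageI[OF that] bdd] F(2) by linarith
  show ?thesis
  proof (rule that[OF aF jF])
    fix G assume G: "adm G" "J G < \<infinity>"
    \<comment> \<open>F is compared with a short move towards G; the terms of first order in t are
      the claimed inequality.\<close>
    let ?H = "\<lambda>z. (1 - t) * F z + t * G z"
    have H: "adm ?H" using t by (intro adm_convex aF G) auto
    have J1: "J ?H \<le> ennreal ((1 - t) * enn2real (J F) + t * enn2real (J G))"
    proof -
      have "J ?H \<le> ennreal (1 - t) * J F + ennreal t * J G" using t by (intro J_convex aF G) auto
      also have "\<dots> = ennreal ((1 - t) * enn2real (J F) + t * enn2real (J G))"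
        using t jF G(2) by (simp add: ennreal_mult ennreal_plus)
      finally show ?thesis .
    qed
    then have J2: "J ?H < \<infinity>" by (rule le_less_trans) simp
    have J3: "enn2real (J ?H) \<le> (1 - t) * enn2real (J F) + t * enn2real (J G)"
      using J1 t by (intro enn2real_leI) auto
    have sq: "(a ?H i)\<^sup>2 \<le> (a F i)\<^sup>2 + 2 * t * (a F i * a G i - a F i * a F i) + t * t * (2 * c)\<^sup>2" if "i < k" for i
    proof -
      have "(a ?H i)\<^sup>2 = (a F i)\<^sup>2 + 2 * t * (a F i * a G i - a F i * a F i) + t * t * (a G i - a F i)\<^sup>2"
        unfolding aff[OF aF G(1) that] by (simp add: power2_eq_square algebra_simps)
      moreover have "(a G i - a F i)\<^sup>2 \<le> (2 * c)\<^sup>2"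
      proof (rule power2_le_iff_abs_le[THEN iffD2])
        show "0 \<le> 2 * c" using bnd[OF aF that] by linarith
        show "\<bar>a G i - a F i\<bar> \<le> 2 * c" using bnd[OF aF that] bnd[OF G(1) that] by linarith
      qed
      ultimately show ?thesis using t by (simp add: mult_left_mono)
    qed
    have "(\<Sum>i<k. (a ?H i)\<^sup>2) \<le> (\<Sum>i<k. (a F i)\<^sup>2 + 2 * t * (a F i * a G i - a F i * a F i) + t * t * (2 * c)\<^sup>2)"
      using sq by (intro sum_mono) auto
    also have "\<dots> = (\<Sum>i<k. (a F i)\<^sup>2) + 2 * t * ((\<Sum>i<k. a F i * a G i) - (\<Sum>i<k. a F i * a F i))
        + t * t * (\<Sum>i<k. (2 * c)\<^sup>2)"
      by (simp add: sum.distrib sum_subtractf flip: sum_distrib_left)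
    finally have S: "(\<Sum>i<k. (a ?H i)\<^sup>2) \<le> \<dots>" .
    have "E F \<le> E ?H + t * t" using H J2 unfolding A_def by (intro min) (simp add: A_def)
    then have "enn2real (J F) + r / 2 * (\<Sum>i<k. (a F i)\<^sup>2) \<le> (1 - t) * enn2real (J F) + t * enn2real (J G)
        + r / 2 * ((\<Sum>i<k. (a F i)\<^sup>2) + 2 * t * ((\<Sum>i<k. a F i * a G i) - (\<Sum>i<k. a F i * a F i))
        + t * t * (\<Sum>i<k. (2 * c)\<^sup>2)) + t * t"
      unfolding E_def using J3 mult_left_mono[OF S, of "r / 2"] r by linarith
    then have "t * (enn2real (J F) + r * (\<Sum>i<k. a F i * a F i))
        \<le> t * (enn2real (J G) + r * (\<Sum>i<k. a F i * a G i) + t * B)"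
      unfolding B_def by (simp add: algebra_simps)
    then have "enn2real (J F) + r * (\<Sum>i<k. a F i * a F i) \<le> enn2real (J G) + r * (\<Sum>i<k. a F i * a G i) + t * B"
      using t(1) by (simp only: mult_le_cancel_left_pos)
    then show "enn2real (J F) + r * (\<Sum>i<k. a F i * a F i) \<le> enn2real (J G) + r * (\<Sum>i<k. a F i * a G i) + \<eta>"
      using t(3) by linarith
  qed
qed

lemma bounded_in_Phi:
  assumes "continuous_on UNIV \<phi>" "\<And>x. \<bar>\<phi> x\<bar> \<le> c"
  shows "\<phi> \<in> \<Phi>"
proof -
  have "0 \<le> c" using assms(2)[of xo] by linarith
  moreover have "bdd_below (range \<phi>)"
    using assms(2) by (intro bdd_belowI[where m = "- c"]) (auto simp: abs_le_iff minus_le_iff)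
  ultimately show ?thesis
    unfolding Phi_gamma_b_def using assms
    by (intro CollectI conjI exI[of _ c] exI[of _ "0::real"]) auto
qed

definition defect :: "'a measure \<Rightarrow> ('a \<Rightarrow> real) \<Rightarrow> ('a \<times> 'a \<Rightarrow> real) \<Rightarrow> real" where
  "defect \<nu> \<phi> F = (\<integral>x. \<phi> x \<partial>\<mu>) + shift \<phi> F - (\<integral>y. \<phi> y \<partial>\<nu>)"

lemma shift_sum:
  assumes F: "adm F" and \<psi>: "\<And>i. \<psi> i \<in> borel_measurable borel" "\<And>i x. \<bar>\<psi> i x\<bar> \<le> 1"
  shows "shift (\<lambda>x. \<Sum>i<(k::nat). w i * \<psi> i x) F = (\<Sum>i<k. w i * shift (\<psi> i) F)"
proof -
  have "shift (\<lambda>x. \<Sum>i<k. w i * \<psi> i x) F = (\<integral>z. (\<Sum>i<k. w i * ((\<psi> i (snd z) - \<psi> i (fst z)) * F z)) \<partial>m)"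
    unfolding shift_def
    by (intro Bochner_Integration.integral_cong refl)
       (simp add: sum_distrib_right sum_subtractf[symmetric] left_diff_distrib right_diff_distrib mult.assoc)
  also have "\<dots> = (\<Sum>i<k. w i * shift (\<psi> i) F)"
    unfolding shift_def using shift_integrable[OF F \<psi>] by (subst Bochner_Integration.integral_sum) auto
  finally show ?thesis .
qed

text \<open>Let \<phi> be the combination of test functions weighted by r times the defects of F.
  Then the mixed sum in the first-order condition is the defect of G against \<phi>. As \<phi>
  depends on F only, G may be chosen near-optimal for it, and the right-hand side becomes a dual
  value plus e. This bounds the cost of F and its penalty at once.\<close>

lemma ex_almost_coupling:
  fixes \<psi> :: "nat \<Rightarrow> 'a \<Rightarrow> real"
  assumes \<nu>: "\<nu> \<in> \<P>" and D: "0 \<le> D"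
    and dual: "\<And>\<phi>. \<phi> \<in> \<Phi> \<Longrightarrow> (\<integral>x. Q_real \<phi> x \<partial>\<mu>) - (\<integral>y. \<phi> y \<partial>\<nu>) \<le> D"
    and \<psi>: "\<And>i. continuous_on UNIV (\<psi> i)" "\<And>i x. \<bar>\<psi> i x\<bar> \<le> 1" and e: "0 < e"
  obtains F where "adm F" "J F \<le> ennreal (D + e)" "\<And>i. i < k \<Longrightarrow> \<bar>defect \<nu> (\<psi> i) F\<bar> \<le> e"
proof -
  let ?a = "\<lambda>F i. defect \<nu> (\<psi> i) F"
  have \<psi>m: "\<psi> i \<in> borel_measurable borel" for i using \<psi>(1) by (rule borel_measurable_continuous_onI)
  have \<psi>\<Phi>: "\<psi> i \<in> \<Phi>" for i using \<psi> by (rule bounded_in_Phi)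
  \<comment> \<open>Chosen so that r times a squared defect being at most D + e forces that defect
    to be at most e.\<close>
  define r where "r = (D + e) / e\<^sup>2"
  have r0: "0 \<le> r" unfolding r_def using D e by simp
  have i1: "\<bar>\<integral>x. \<psi> i x \<partial>M\<bar> \<le> 1" if M: "M \<in> \<P>" for M i
  proof -
    interpret M: prob_space M by (rule P_gammaD(1)[OF M])
    have "\<bar>\<integral>x. \<psi> i x \<partial>M\<bar> \<le> (\<integral>x. \<bar>\<psi> i x\<bar> \<partial>M)" by (rule integral_abs_bound)
    also have "\<dots> \<le> (\<integral>x. 1 \<partial>M)" using Phi_integrable[OF \<psi>\<Phi> M] \<psi>(2) by (intro integral_mono) auto
    finally show ?thesis by (simp add: M.prob_space)
  qed
  have sb: "\<bar>shift (\<psi> i) F\<bar> \<le> 2" if F: "adm F" for F i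
  proof -
    have "\<bar>shift (\<psi> i) F\<bar> \<le> (\<integral>z. \<bar>(\<psi> i (snd z) - \<psi> i (fst z)) * F z\<bar> \<partial>m)"
      unfolding shift_def by (rule integral_abs_bound)
    also have "\<dots> \<le> (\<integral>z. 2 * F z \<partial>m)"
    proof (rule integral_mono)
      show "\<bar>(\<psi> i (snd z) - \<psi> i (fst z)) * F z\<bar> \<le> 2 * F z" for z
      proof -
        have "\<bar>\<psi> i (snd z) - \<psi> i (fst z)\<bar> \<le> 2" using \<psi>(2)[of i "snd z"] \<psi>(2)[of i "fst z"] by linarith
        then show ?thesis using admD(3)[OF F, of z] by (simp add: abs_mult mult_right_mono)
      qed
    qed (use shift_integrable[OF F \<psi>m \<psi>(2)] admD(6)[OF F] in auto)
    also have "\<dots> \<le> 2" using admD(7)[OF F] by simp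
    finally show ?thesis .
  qed
  obtain F where F: "adm F" "J F < \<infinity>" and opt: "\<And>G. adm G \<Longrightarrow> J G < \<infinity> \<Longrightarrow>
       enn2real (J F) + r * (\<Sum>i<k. ?a F i * ?a F i)
       \<le> enn2real (J G) + r * (\<Sum>i<k. ?a F i * ?a G i) + e / 2"
  \<comment> \<open>The bound 4 is 1 + 2 + 1: two integrals of a test function and one
    shift.\<close>
  proof (rule quadratic_penalty[of k ?a 4 r "e / 2"])
    show "defect \<nu> (\<psi> i) (\<lambda>z. (1 - t) * F z + t * G z) = (1 - t) * ?a F i + t * ?a G i"
      if "adm F" "adm G" for F G t i
      unfolding defect_def shift_affine[OF that \<psi>m \<psi>(2)] by (simp add: algebra_simps)
    show "\<bar>?a F i\<bar> \<le> 4" if "adm F" for F i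
      unfolding defect_def using i1[OF mu_P, of i] i1[OF \<nu>, of i] sb[OF that, of i] by linarith
  qed (use r0 e in auto)
  define w where "w i = r * ?a F i" for i
  define \<phi> where "\<phi> x = (\<Sum>i<k. w i * \<psi> i x)" for x
  have \<phi>c: "continuous_on UNIV \<phi>" unfolding \<phi>_def by (intro continuous_intros \<psi>)
  have \<phi>b: "\<bar>\<phi> x\<bar> \<le> (\<Sum>i<k. \<bar>w i\<bar>)" for x
  proof -
    have "\<bar>\<phi> x\<bar> \<le> (\<Sum>i<k. \<bar>w i * \<psi> i x\<bar>)" unfolding \<phi>_def by (rule sum_abs)
    also have "\<dots> \<le> (\<Sum>i<k. \<bar>w i\<bar>)"
      using \<psi>(2) by (intro sum_mono) (simp add: abs_mult mult_left_le)
    finally show ?thesis .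
  qed
  have \<phi>\<Phi>: "\<phi> \<in> \<Phi>" using \<phi>c \<phi>b by (rule bounded_in_Phi)
  obtain G where G: "adm G" "J G < \<infinity>"
    "enn2real (J G) + (\<integral>x. \<phi> x \<partial>\<mu>) + shift \<phi> G \<le> (\<integral>x. Q_real \<phi> x \<partial>\<mu>) + e / 2"
    using near_optimal_adm[OF \<phi>\<Phi> \<phi>b, of "e / 2"] e by auto
  have "defect \<nu> \<phi> G = (\<Sum>i<k. w i * ?a G i)"
  proof -
    have "(\<integral>x. \<phi> x \<partial>\<mu>) = (\<Sum>i<k. w i * (\<integral>x. \<psi> i x \<partial>\<mu>))"
      unfolding \<phi>_def using Phi_integrable[OF \<psi>\<Phi> mu_P] by (subst Bochner_Integration.integral_sum) auto
    moreover have "(\<integral>x. \<phi> x \<partial>\<nu>) = (\<Sum>i<k. w i * (\<integral>x. \<psi> i x \<partial>\<nu>))"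
      unfolding \<phi>_def using Phi_integrable[OF \<psi>\<Phi> \<nu>] by (subst Bochner_Integration.integral_sum) auto
    moreover have "shift \<phi> G = (\<Sum>i<k. w i * shift (\<psi> i) G)"
      unfolding \<phi>_def by (rule shift_sum[OF G(1) \<psi>m \<psi>(2)])
    ultimately show ?thesis unfolding defect_def by (simp add: sum.distrib sum_subtractf algebra_simps)
  qed
  also have "\<dots> = r * (\<Sum>i<k. ?a F i * ?a G i)"
    unfolding w_def by (simp add: sum_distrib_left mult.assoc)
  finally have dG: "r * (\<Sum>i<k. ?a F i * ?a G i) = (\<integral>x. \<phi> x \<partial>\<mu>) + shift \<phi> G - (\<integral>y. \<phi> y \<partial>\<nu>)"
    unfolding defect_def by simp
  let ?S = "\<Sum>i<k. ?a F i * ?a F i"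
  have main: "enn2real (J F) + r * ?S \<le> D + e"
    using opt[OF G(1,2)] G(3) dual[OF \<phi>\<Phi>] unfolding dG by linarith
  have S0: "0 \<le> ?S" by (intro sum_nonneg) simp
  have "enn2real (J F) \<le> D + e" using main mult_nonneg_nonneg[OF r0 S0] by linarith
  then have "J F \<le> ennreal (D + e)" using F(2) by (metis ennreal_enn2real ennreal_leI infinity_ennreal_def)
  moreover have "\<bar>?a F i\<bar> \<le> e" if "i < k" for i
  proof -
    have "?a F i * ?a F i \<le> ?S"
      using that by (intro member_le_sum) auto
    then have "r * (?a F i)\<^sup>2 \<le> r * ?S" using r0 by (simp add: power2_eq_square mult_left_mono)
    also have "\<dots> \<le> D + e" using main by (smt (verit) enn2real_nonneg)
    finally have "(D + e) * (?a F i)\<^sup>2 \<le> (D + e) * e\<^sup>2"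
      unfolding r_def using e by (simp add: field_simps)
    then have "(?a F i)\<^sup>2 \<le> e\<^sup>2" using D e by (simp add: mult_le_cancel_left_pos)
    then show ?thesis using e by (simp add: power2_le_iff_abs_le)
  qed
  ultimately show ?thesis using that F(1) by blast
qed

section \<open>Limits of admissible densities\<close>

lemma adm_AE_limit:
  assumes G: "\<And>k. adm (G k)" and conv: "AE z in m. convergent (\<lambda>k. exp (- G k z / 2))"
  obtains F where "adm F" "AE z in m. (\<lambda>k. G k z) \<longlonglongrightarrow> F z"
proof -
  note [measurable] = admD(1)[OF G]
  \<comment> \<open>The liminf exists everywhere, so Fatou gives the mass bound for every x and not
    only where the sequence converges.\<close>
  define L where "L z = liminf (\<lambda>k. ennreal (G k z))" for z
  have [measurable]: "L \<in> borel_measurable borel2" unfolding L_def by measurable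
  have Lm: "L \<in> borel_measurable m" using \<open>L \<in> borel_measurable borel2\<close> by (simp add: measurable_cong_sets[OF sets_m refl])
  have L1: "(\<integral>\<^sup>+ y. L (x, y) \<partial>\<mu>0) \<le> 1" for x
  proof -
    have "(\<integral>\<^sup>+ y. L (x, y) \<partial>\<mu>0) \<le> liminf (\<lambda>k. \<integral>\<^sup>+ y. G k (x, y) \<partial>\<mu>0)"
      unfolding L_def by (rule nn_integral_liminf) measurable
    also have "\<dots> \<le> liminf (\<lambda>k. 1 :: ennreal)"
      using subdensityD(3)[OF admD(4)[OF G]] by (intro Liminf_mono always_eventually) auto
    finally show ?thesis by (simp add: Liminf_const)
  qed
  have "(\<integral>\<^sup>+ z. L z \<partial>m) = (\<integral>\<^sup>+ x. \<integral>\<^sup>+ y. L (x, y) \<partial>\<mu>0 \<partial>\<mu>)"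
    by (rule \<mu>0.nn_integral_fst[symmetric, OF Lm])
  also have "\<dots> \<le> (\<integral>\<^sup>+ x. 1 \<partial>\<mu>)" by (intro nn_integral_mono L1)
  finally have "(\<integral>\<^sup>+ z. L z \<partial>m) \<le> 1" using mu.emeasure_space_1 by simp
  then have "(\<integral>\<^sup>+ z. L z \<partial>m) \<noteq> \<infinity>" by (metis ennreal_one_neq_top infinity_ennreal_def top.extremum_unique)
  then have Lfin: "AE z in m. L z \<noteq> \<infinity>" by (intro nn_integral_PInf_AE Lm)
  define F where "F z = enn2real (L z)" for z
  have "adm F"
    unfolding adm_def
  proof (intro conjI allI)
    show "F \<in> borel_measurable borel2" unfolding F_def by measurable
    show "0 \<le> F z" for z unfolding F_def by simp
    have "ennreal (F z) \<le> L z" for z unfolding F_def by (cases "L z") auto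
    then show "(\<integral>\<^sup>+ y. ennreal (F (x, y)) \<partial>\<mu>0) \<le> 1" for x
      using L1[of x] by (meson nn_integral_mono order_trans)
  qed
  moreover have "AE z in m. (\<lambda>k. G k z) \<longlonglongrightarrow> F z"
    using conv Lfin
  proof eventually_elim
    case (elim z)
    obtain h where h: "(\<lambda>k. exp (- G k z / 2)) \<longlonglongrightarrow> h" using elim(1) unfolding convergent_def by blast
    have h0: "0 \<le> h" using h by (rule LIMSEQ_le_const) auto
    \<comment> \<open>Convergence of the exponentials still allows \<open>G k z\<close> to tend to
      infinity; finiteness of \<open>L z\<close> excludes this.\<close>
    have "h \<noteq> 0"
    proof
      assume "h = 0"
      have unbounded: "ennreal n \<le> L z" if n: "0 \<le> n" for n :: real
      proof -
        have "\<forall>\<^sub>F k in sequentially. exp (- G k z / 2) < exp (- n / 2)"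
          using h \<open>h = 0\<close> by (intro order_tendstoD(2)) auto
        then have "\<forall>\<^sub>F k in sequentially. ennreal n \<le> ennreal (G k z)"
          by eventually_elim (auto intro: ennreal_leI)
        then have "liminf (\<lambda>k. ennreal n) \<le> liminf (\<lambda>k. ennreal (G k z))" by (rule Liminf_mono)
        then show ?thesis unfolding L_def by (simp add: Liminf_const)
      qed
      have le: "ennreal (enn2real (L z) + 1) \<le> L z" by (rule unbounded) simp
      show False
      proof (cases "L z")
        case (real l)
        then have "ennreal (l + 1) \<le> ennreal l" using le by (simp del: ennreal_plus)
        then show False using real(1) by simp
      qed (use elim(2) in simp)
    qed
    then have "0 < h" using h0 by simp
    then have "(\<lambda>k. - 2 * ln (exp (- G k z / 2))) \<longlonglongrightarrow> - 2 * ln h"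
      using h by (intro tendsto_intros) auto
    then have lim: "(\<lambda>k. G k z) \<longlonglongrightarrow> - 2 * ln h" by simp
    then have "L z = ennreal (- 2 * ln h)"
      unfolding L_def by (intro lim_imp_Liminf tendsto_ennrealI) auto
    moreover have "0 \<le> - 2 * ln h" using lim admD(3)[OF G] by (intro LIMSEQ_le_const[OF lim]) auto
    ultimately have "F z = - 2 * ln h" unfolding F_def by simp
    then show ?case using lim by simp
  qed
  ultimately show ?thesis using that by blast
qed

lemma J_le_liminf:
  assumes G: "\<And>k. adm (G k)" and F: "adm F" and lim: "AE z in m. (\<lambda>k. G k z) \<longlonglongrightarrow> F z"
  shows "J F \<le> liminf (\<lambda>k. J (G k))"
proof -
  have "J F \<le> (\<integral>\<^sup>+ z. liminf (\<lambda>k. \<beta> (\<gamma>d z * G k z)) \<partial>m)"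
    unfolding J_def
  proof (rule nn_integral_mono_AE)
    show "AE z in m. \<beta> (\<gamma>d z * F z) \<le> liminf (\<lambda>k. \<beta> (\<gamma>d z * G k z))"
      using lim
    proof eventually_elim
      case (elim z)
      show ?case
        by (rule beta_le_liminf) (auto intro!: tendsto_mult_left elim mult_nonneg_nonneg admD(3)[OF G])
    qed
  qed
  also have "\<dots> \<le> liminf (\<lambda>k. J (G k))"
    unfolding J_def by (intro nn_integral_liminf J_measurable_integrand G)
  finally show ?thesis .
qed


section \<open>Passage to the limit in the marginal constraints\<close>

definition off_diagonal :: "'a set \<Rightarrow> real \<Rightarrow> ('a \<times> 'a) set" where
  "off_diagonal K \<delta> = {z. fst z \<in> K \<and> snd z \<in> K \<and> \<delta> \<le> dist (fst z) (snd z)}"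

lemma off_diagonal_sets: "compact K \<Longrightarrow> off_diagonal K \<delta> \<in> sets m"
proof -
  assume "compact K"
  then have [measurable]: "K \<in> sets borel" by (simp add: compact_imp_closed)
  have "Measurable.pred borel2 (\<lambda>z. fst z \<in> K \<and> snd z \<in> K \<and> \<delta> \<le> dist (fst z) (snd z))" by measurable
  then show ?thesis unfolding off_diagonal_def sets_m pred_def by (simp add: space_pair_measure)
qed

text \<open>Away from the diagonal \<open>\<gamma>\<close> is bounded below, so a bound on \<open>J\<close> and the superlinearity of \<open>\<beta>\<close>
  give uniform integrability there.\<close>

lemma ex_truncation:
  assumes K: "compact (K :: 'a set)" and \<delta>: "0 < \<delta>" and D: "0 \<le> D" and e: "0 < e"
  obtains T where "0 \<le> T" "\<And>F. adm F \<Longrightarrow> J F \<le> ennreal D \<Longrightarrow>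
    (\<integral>\<^sup>+ z. ennreal (F z - min (F z) T) * indicator (off_diagonal K \<delta>) z \<partial>m) \<le> ennreal e"
proof -
  obtain c where c: "0 < c" "\<And>x y. x \<in> K \<Longrightarrow> y \<in> K \<Longrightarrow> \<delta> \<le> dist x y \<Longrightarrow> c \<le> \<gamma> (dist x y)"
    using gamma_dist_bounded_below[OF K \<delta>] by blast
  \<comment> \<open>For L = l + 1 / c the product L * c * e equals D + e, so a cost of at most D
    leaves at most e after division by L * c. The summand 1 / c keeps L positive when D = 0.\<close>
  define l where "l = D / (e * c)"
  have l: "0 \<le> l" unfolding l_def using D e c by simp
  obtain R where R: "0 < R" "\<And>t. R \<le> t \<Longrightarrow> ennreal ((l + 1 / c) * t) \<le> \<beta> t"
    using beta_superlinearD[of "l + 1 / c"] l c by auto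
  define L where "L = l + 1 / c"
  have L: "0 < L" "D \<le> L * c * e"
  proof -
    show "0 < L" unfolding L_def using l c by (simp add: add_nonneg_pos)
    have "L * c * e = D + e" unfolding L_def l_def using c e by (simp add: field_simps)
    then show "D \<le> L * c * e" using e by simp
  qed
  show ?thesis
  proof
    \<comment> \<open>Above the height R / c the argument of \<beta> is at least R on the
      off-diagonal set, so the linear lower bound for \<beta> applies there.\<close>
    show "0 \<le> R / c" using R c by simp
    fix F assume F: "adm F" and JF: "J F \<le> ennreal D"
    let ?A = "off_diagonal K \<delta>"
    have pw: "ennreal (L * c) * (ennreal (F z - min (F z) (R / c)) * indicator ?A z) \<le> \<beta> (\<gamma>d z * F z)" for z
    proof (cases "z \<in> ?A \<and> R / c < F z")
      case True
      let ?g = "\<gamma>d z"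
      have g: "c \<le> ?g" using True c(2) by (auto simp: off_diagonal_def)
      have F0: "0 \<le> F z" by (rule admD(3)[OF F])
      have "R \<le> c * F z" using True c(1) by (simp add: field_simps)
      also have "\<dots> \<le> ?g * F z" using g F0 by (rule mult_right_mono)
      finally have b: "ennreal (L * (?g * F z)) \<le> \<beta> (?g * F z)" using R(2) unfolding L_def by blast
      have "L * c * (F z - min (F z) (R / c)) \<le> L * c * F z"
        using L c R F0 by (intro mult_left_mono) auto
      also have "\<dots> \<le> L * (?g * F z)"
        using L g F0 by (simp add: mult.assoc mult_left_mono mult_right_mono)
      finally have "ennreal (L * c * (F z - min (F z) (R / c))) \<le> \<beta> (?g * F z)"
        using b by (meson ennreal_leI order_trans)
      then show ?thesis using True L c by (simp add: ennreal_mult)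
    next
      case False
      then show ?thesis by (auto split: split_indicator)
    qed
    have Am: "?A \<in> sets m" by (rule off_diagonal_sets[OF K])
    note [measurable] = admD(2)[OF F] Am
    have "ennreal (L * c) * (\<integral>\<^sup>+ z. ennreal (F z - min (F z) (R / c)) * indicator ?A z \<partial>m)
      = (\<integral>\<^sup>+ z. ennreal (L * c) * (ennreal (F z - min (F z) (R / c)) * indicator ?A z) \<partial>m)"
      by (rule nn_integral_cmult[symmetric]) measurable
    also have "\<dots> \<le> J F" unfolding J_def by (intro nn_integral_mono pw)
    also have "\<dots> \<le> ennreal (L * c * e)" using JF L(2) by (meson ennreal_leI order_trans)
    also have "\<dots> = ennreal (L * c) * ennreal e" using L c e by (simp add: ennreal_mult)
    finally show "(\<integral>\<^sup>+ z. ennreal (F z - min (F z) (R / c)) * indicator ?A z \<partial>m) \<le> ennreal e"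
      using L c by (subst (asm) ennreal_mult_le_mult_iff) auto
  qed
qed

text \<open>Mass that concentrates on the diagonal is harmless: there \<open>u y - u x\<close> vanishes uniformly.\<close>

lemma shift_tendsto:
  assumes G: "\<And>k. adm (G k)" and F: "adm F" and lim: "AE z in m. (\<lambda>k. G k z) \<longlonglongrightarrow> F z"
    and D: "0 \<le> D" "\<And>k. J (G k) \<le> ennreal D" "J F \<le> ennreal D"
    and tight: "\<And>e. 0 < e \<Longrightarrow> \<exists>K. compact K \<and> measure \<mu> (- K) \<le> e \<and>
        (\<forall>\<^sub>F k in sequentially. (\<integral>z. indicator (- K) (snd z) * G k z \<partial>m) \<le> e) \<and>
        (\<integral>z. indicator (- K) (snd z) * F z \<partial>m) \<le> e"
    and u: "continuous_on UNIV u" "\<And>x. 0 \<le> u x" "\<And>x. u x \<le> 1"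
  shows "(\<lambda>k. shift u (G k)) \<longlonglongrightarrow> shift u F"
proof (rule LIMSEQ_I)
  fix e0 :: real assume e0: "0 < e0"
  \<comment> \<open>The contributions below add up to 9 * e.\<close>
  define e where "e = e0 / 20"
  have e: "0 < e" unfolding e_def using e0 by simp
  have um[measurable]: "u \<in> borel_measurable borel" using u(1) by (rule borel_measurable_continuous_onI)
  have ub: "\<bar>u x\<bar> \<le> 1" for x using u(2,3)[of x] by simp
  have ud: "\<bar>u x - u y\<bar> \<le> 1" for x y using u(2,3)[of x] u(2,3)[of y] by linarith
  obtain K where K: "compact K" "measure \<mu> (- K) \<le> e"
    "\<forall>\<^sub>F k in sequentially. (\<integral>z. indicator (- K) (snd z) * G k z \<partial>m) \<le> e"
    "(\<integral>z. indicator (- K) (snd z) * F z \<partial>m) \<le> e"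
    using tight[OF e] by blast
  have Km[measurable]: "K \<in> sets borel" using K(1) by (simp add: compact_imp_closed)
  have "uniformly_continuous_on K u"
    using K(1) continuous_on_subset[OF u(1)] by (intro compact_uniformly_continuous) auto
  then obtain \<delta> where \<delta>: "0 < \<delta>" "\<And>x y. x \<in> K \<Longrightarrow> y \<in> K \<Longrightarrow> dist y x < \<delta> \<Longrightarrow> dist (u y) (u x) < e"
    unfolding uniformly_continuous_on_def using e by blast
  let ?A = "off_diagonal K \<delta>"
  have Am: "?A \<in> sets m" by (rule off_diagonal_sets[OF K(1)])
  obtain T where T: "0 \<le> T" "\<And>F. adm F \<Longrightarrow> J F \<le> ennreal D \<Longrightarrow>
    (\<integral>\<^sup>+ z. ennreal (F z - min (F z) T) * indicator ?A z \<partial>m) \<le> ennreal e"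
    using ex_truncation[OF K(1) \<delta>(1) D(1) e] by blast
  note [measurable] = admD(2)[OF F] admD(2)[OF G] Am
  have [measurable]: "(\<lambda>z. indicator (- K) (fst z) :: real) \<in> borel_measurable m" "(\<lambda>z. indicator (- K) (snd z) :: real) \<in> borel_measurable m"
    by measurable
  let ?l = "\<lambda>H z. indicator (- K) (fst z) * H z" and ?r = "\<lambda>H z. indicator (- K) (snd z) * H z"
    and ?t = "\<lambda>H z. indicator ?A z * (H z - min (H z) T)"
    and ?b = "\<lambda>k z. indicator ?A z * \<bar>min (G k z) T - min (F z) T\<bar>"
  have trunc: "(\<integral>z. ?t H z \<partial>m) \<le> e"
    "integrable m (\<lambda>z. ?t H z)" if H: "adm H" "J H \<le> ennreal D" for H
  proof -
    note [measurable] = admD(2)[OF H(1)]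
    show i: "integrable m (\<lambda>z. ?t H z)"
      by (rule Bochner_Integration.integrable_bound[OF admD(6)[OF H(1)]])
         (use T(1) admD(3)[OF H(1)] in \<open>auto split: split_indicator intro!: AE_I2\<close>)
    have "ennreal (\<integral>z. ?t H z \<partial>m) = (\<integral>\<^sup>+ z. ennreal (?t H z) \<partial>m)"
      using i by (intro nn_integral_eq_integral[symmetric]) (auto split: split_indicator)
    also have "\<dots> = (\<integral>\<^sup>+ z. ennreal (H z - min (H z) T) * indicator ?A z \<partial>m)"
      by (intro nn_integral_cong) (auto split: split_indicator)
    also have "\<dots> \<le> ennreal e" by (rule T(2)[OF H])
    finally show "(\<integral>z. ?t H z \<partial>m) \<le> e" using e by (simp add: ennreal_le_iff)
  qed
  \<comment> \<open>In the first coordinate \<mu> alone controls the tail, because H has mass at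
    most 1 on each fibre over x.\<close>
  have left: "(\<integral>z. ?l H z \<partial>m) \<le> e" if H: "adm H" for H
  proof -
    note [measurable] = admD(2)[OF H]
    have i: "integrable m (\<lambda>z. ?l H z)"
      by (rule adm_integrable_mult[OF H, where c = 1]) (auto split: split_indicator)
    have "ennreal (\<integral>z. ?l H z \<partial>m) = (\<integral>\<^sup>+ z. ennreal (?l H z) \<partial>m)"
      using i admD(3)[OF H] by (intro nn_integral_eq_integral[symmetric]) auto
    also have "\<dots> = (\<integral>\<^sup>+ x. \<integral>\<^sup>+ y. ennreal (indicator (- K) x * H (x, y)) \<partial>\<mu>0 \<partial>\<mu>)"
      by (subst \<mu>0.nn_integral_fst[symmetric]) auto
    also have "\<dots> \<le> (\<integral>\<^sup>+ x. indicator (- K) x \<partial>\<mu>)"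
    proof (rule nn_integral_mono)
      fix x
      show "(\<integral>\<^sup>+ y. ennreal (indicator (- K) x * H (x, y)) \<partial>\<mu>0) \<le> indicator (- K) x"
        using subdensityD(3)[OF admD(4)[OF H], of x] by (cases "x \<in> K") auto
    qed
    also have "\<dots> = ennreal (measure \<mu> (- K))" by (simp add: sets_mu mu.emeasure_eq_measure)
    also have "\<dots> \<le> ennreal e" using K(2) by (rule ennreal_leI)
    finally show ?thesis using e by (simp add: ennreal_le_iff)
  qed
  \<comment> \<open>Below the height T everything is bounded by a constant, so dominated convergence
    applies.\<close>
  define tr where "tr k = (\<integral>z. ?b k z \<partial>m)" for k
  have trb: "norm (?b k z) \<le> T" for k z
  proof -
    have "\<bar>min (G k z) T - min (F z) T\<bar> \<le> T"
      using T(1) admD(3)[OF F, of z] admD(3)[OF G, of k z] by (auto simp: min_def)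
    then show ?thesis using T(1) by (auto split: split_indicator)
  qed
  have tri: "integrable m (\<lambda>z. ?b k z)" for k
  proof (rule pr.P.integrable_const_bound[where B = "T"])
    show "AE z in m. norm (?b k z) \<le> T"
      using trb by simp
  qed measurable
  have "tr \<longlonglongrightarrow> (\<integral>z. 0 \<partial>m)"
    unfolding tr_def
  proof (rule integral_dominated_convergence[where w = "\<lambda>z. T"])
    show "AE z in m. (\<lambda>k. ?b k z) \<longlonglongrightarrow> 0"
      using lim
    proof eventually_elim
      case (elim z)
      have "(\<lambda>k. ?b k z) \<longlonglongrightarrow> indicator ?A z * \<bar>min (F z) T - min (F z) T\<bar>"
        by (intro tendsto_intros elim)
      then show ?case by simp
    qed
    show "AE z in m. norm (?b k z) \<le> T" for k
      using trb by simp
  qed (use pr.P.integrable_const in auto)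
  then have "\<forall>\<^sub>F k in sequentially. tr k < e" using e by (intro order_tendstoD(2)) auto
  then have "\<forall>\<^sub>F k in sequentially. norm (shift u (G k) - shift u F) < e0"
    using K(3)
  proof eventually_elim
    case (elim k)
    let ?d = "\<lambda>z. u (snd z) - u (fst z)"
    note iG = admD(6)[OF G, of k] and iF = admD(6)[OF F]
    note tG = trunc[OF G D(2), of k] and tF = trunc[OF F D(3)]
    have fG: "integrable m (\<lambda>z. ?l (G k) z)" "integrable m (\<lambda>z. ?r (G k) z)"
      by (rule adm_integrable_mult[OF G, where c = 1]; auto split: split_indicator)+
    have fF: "integrable m (\<lambda>z. ?l F z)" "integrable m (\<lambda>z. ?r F z)"
      by (rule adm_integrable_mult[OF F, where c = 1]; auto split: split_indicator)+
    \<comment> \<open>One group of terms per region. Near the diagonal uniform continuity gives the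
      factor e, and pairs that leave K in the first or the second coordinate are paid for by the
      tails. Off-diagonal pairs in K are paid for by the two truncation excesses and the difference
      of the truncated functions.\<close>
    define W where "W z = e * (G k z + F z) + (?l (G k) z + ?l F z)
      + (?r (G k) z + ?r F z)
      + (?t (G k) z + ?t F z)
      + ?b k z" for z
    have pw: "\<bar>?d z * G k z - ?d z * F z\<bar> \<le> W z" for z
    proof -
      let ?g = "\<bar>G k z - F z\<bar>"
      have G0: "0 \<le> G k z" and F0: "0 \<le> F z" by (rule admD(3)[OF G], rule admD(3)[OF F])
      have dle: "?g \<le> G k z + F z" using G0 F0 by linarith
      have eq: "\<bar>?d z * G k z - ?d z * F z\<bar> = \<bar>?d z\<bar> * ?g"
        by (simp flip: right_diff_distrib add: abs_mult)
      have le1: "\<bar>?d z\<bar> * ?g \<le> ?g" using ud[of "snd z" "fst z"] by (simp add: mult_left_le_one_le)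
      have p1: "0 \<le> e * (G k z + F z)" using e G0 F0 by simp
      have p2: "0 \<le> ?t (G k) z + ?t F z
          + ?b k z" by (auto split: split_indicator)
      have p3: "0 \<le> ?l (G k) z" "0 \<le> ?l F z"
        "0 \<le> ?r (G k) z" "0 \<le> ?r F z" using G0 F0 by auto
      consider "fst z \<notin> K" | "snd z \<notin> K" | "z \<in> ?A" | "fst z \<in> K" "snd z \<in> K" "dist (snd z) (fst z) < \<delta>"
        by (cases "\<delta> \<le> dist (fst z) (snd z)") (auto simp: dist_commute off_diagonal_def)
      then show ?thesis
      proof cases
        case 1
        then have "?l (G k) z + ?l F z = G k z + F z" by simp
        then show ?thesis unfolding eq W_def using le1 dle p1 p2 p3 by linarith
      next
        case 2
        then have "?r (G k) z + ?r F z = G k z + F z" by simp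
        then show ?thesis unfolding eq W_def using le1 dle p1 p2 p3 by linarith
      next
        case 3
        then have "indicator ?A z = (1::real)" by simp
        moreover have "?g \<le> (G k z - min (G k z) T) + (F z - min (F z) T) + \<bar>min (G k z) T - min (F z) T\<bar>"
          by (auto simp: min_def abs_if)
        ultimately show ?thesis unfolding eq W_def using le1 p1 p3 by simp
      next
        case 4
        then have "\<bar>?d z\<bar> \<le> e" using \<delta>(2)[of "fst z" "snd z"] by (simp add: dist_real_def)
        then have "\<bar>?d z\<bar> * ?g \<le> e * (G k z + F z)" using dle e by (intro mult_mono) auto
        then show ?thesis unfolding eq W_def using p2 p3 by linarith
      qed
    qed
    have Wi: "integrable m W" unfolding W_def using iG iF fG fF tG(2) tF(2) tri[of k] by auto
    have uG: "integrable m (\<lambda>z. ?d z * G k z)" "integrable m (\<lambda>z. ?d z * F z)"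
      by (rule shift_integrable[OF G um ub], rule shift_integrable[OF F um ub])
    have "\<bar>shift u (G k) - shift u F\<bar> = \<bar>\<integral>z. ?d z * G k z - ?d z * F z \<partial>m\<bar>"
      unfolding shift_def using uG by simp
    also have "\<dots> \<le> (\<integral>z. \<bar>?d z * G k z - ?d z * F z\<bar> \<partial>m)" by (rule integral_abs_bound)
    also have "\<dots> \<le> (\<integral>z. W z \<partial>m)" using uG Wi by (intro integral_mono pw) auto
    also have "\<dots> = e * ((\<integral>z. G k z \<partial>m) + (\<integral>z. F z \<partial>m))
        + ((\<integral>z. ?l (G k) z \<partial>m) + (\<integral>z. ?l F z \<partial>m))
        + ((\<integral>z. ?r (G k) z \<partial>m) + (\<integral>z. ?r F z \<partial>m))
        + ((\<integral>z. ?t (G k) z \<partial>m) + (\<integral>z. ?t F z \<partial>m))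
        + tr k"
      unfolding W_def tr_def using iG iF fG fF tG(2) tF(2) tri[of k]
      by (simp only: Bochner_Integration.integral_add Bochner_Integration.integral_mult_right
          Bochner_Integration.integrable_add Bochner_Integration.integrable_mult_right)
    also have "\<dots> \<le> e * (1 + 1) + (e + e) + (e + e) + (e + e) + e"
      using elim left[OF G] left[OF F] K(4) tG(1) tF(1) admD(7)[OF G] admD(7)[OF F] e
      by (intro add_mono mult_left_mono) auto
    also have "\<dots> < e0" unfolding e_def using e0 by simp
    finally show ?case by simp
  qed
  then show "\<exists>no. \<forall>n\<ge>no. norm (shift u (G n) - shift u F) < e0"
    unfolding eventually_sequentially .
qed


text \<open>\<open>shift\<close> is a first-coordinate integral minus a second-coordinate one, both
  against 1 - u, and the first is at most one minus the \<mu>-integral of u because fibres have mass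
  at most 1. For u vanishing off a compact set, the mass that F sends far away is thus bounded
  through the integral of u under the second marginal.\<close>

lemma tail_bound:
  assumes F: "adm F" and u: "continuous_on UNIV u" "\<And>x. 0 \<le> u x" "\<And>x. u x \<le> 1"
  shows "(\<integral>z. (1 - u (snd z)) * F z \<partial>m) \<le> 1 - ((\<integral>x. u x \<partial>\<mu>) + shift u F)"
    "integrable m (\<lambda>z. (1 - u (snd z)) * F z)"
proof -
  have um[measurable]: "u \<in> borel_measurable borel" using u(1) by (rule borel_measurable_continuous_onI)
  have ub: "\<bar>u x\<bar> \<le> 1" for x using u(2,3)[of x] by simp
  note [measurable] = admD(2)[OF F]
  have int: "integrable m (\<lambda>z. (1 - u (f z)) * F z)" if [measurable]: "f \<in> m \<rightarrow>\<^sub>M borel" for f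
    by (rule adm_integrable_mult[OF F, where c = 1]) (use u(2,3) in auto)
  have i1: "integrable m (\<lambda>z. (1 - u (fst z)) * F z)" by (rule int) measurable
  show i2: "integrable m (\<lambda>z. (1 - u (snd z)) * F z)" by (rule int) measurable
  have ui: "integrable \<mu> u" using bounded_in_Phi[OF u(1) ub] mu_P by (rule Phi_integrable)
  have "(\<integral>z. (1 - u (fst z)) * F z \<partial>m) = (\<integral>x. \<integral>y. (1 - u x) * F (x, y) \<partial>\<mu>0 \<partial>\<mu>)"
    using pr.integral_fst'[OF i1] by simp
  also have "\<dots> \<le> (\<integral>x. 1 - u x \<partial>\<mu>)"
  proof (rule integral_mono)
    show "integrable \<mu> (\<lambda>x. \<integral>y. (1 - u x) * F (x, y) \<partial>\<mu>0)" using pr.integrable_fst'[OF i1] by simp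
    show "(\<integral>y. (1 - u x) * F (x, y) \<partial>\<mu>0) \<le> 1 - u x" for x
      using subdensityD(5)[OF admD(4)[OF F], of x] u(3)[of x] by (simp add: mult_left_le)
  qed (use ui in auto)
  also have "\<dots> = 1 - (\<integral>x. u x \<partial>\<mu>)" using ui by (simp add: mu.prob_space[unfolded space_mu])
  finally have le: "(\<integral>z. (1 - u (fst z)) * F z \<partial>m) \<le> 1 - (\<integral>x. u x \<partial>\<mu>)" .
  have "shift u F = (\<integral>z. (1 - u (fst z)) * F z - (1 - u (snd z)) * F z \<partial>m)"
    unfolding shift_def by (intro Bochner_Integration.integral_cong refl) (simp add: algebra_simps)
  also have "\<dots> = (\<integral>z. (1 - u (fst z)) * F z \<partial>m) - (\<integral>z. (1 - u (snd z)) * F z \<partial>m)"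
    using i1 i2 by simp
  finally show "(\<integral>z. (1 - u (snd z)) * F z \<partial>m) \<le> 1 - ((\<integral>x. u x \<partial>\<mu>) + shift u F)" using le by linarith
qed

lemma integral_bind_mix:
  assumes F: "adm F" and u: "continuous_on UNIV u" "\<And>x. 0 \<le> u x" "\<And>x. u x \<le> 1"
  defines "N \<equiv> \<mu> \<bind> (\<lambda>x. mix \<mu>0 (\<lambda>y. F (x, y)) x)"
  shows "prob_space N" "sets N = sets borel" "(\<integral>y. u y \<partial>N) = (\<integral>x. u x \<partial>\<mu>) + shift u F"
proof -
  have um[measurable]: "u \<in> borel_measurable borel" using u(1) by (rule borel_measurable_continuous_onI)
  have ub: "\<bar>u x\<bar> \<le> 1" for x using u(2,3)[of x] by simp
  have u\<Phi>: "u \<in> \<Phi>" using bounded_in_Phi[OF u(1) ub] .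
  have ui: "integrable \<mu> u" using u\<Phi> mu_P by (rule Phi_integrable)
  let ?p = "\<lambda>x. mix \<mu>0 (\<lambda>y. F (x, y)) x"
  note S = subdensityD[OF admD(4)[OF F]]
  note psub = adm_kernel(2)[OF F]
  have px: "prob_space (?p x)" for x by (rule prob_space_mix[OF sets_\<mu>0 S(1,3)])
  show pN: "prob_space N" unfolding N_def by (rule mu.prob_space_bind[OF AE_I2 psub]) (rule px)
  show sN: "sets N = sets borel" unfolding N_def by (rule sets_bind_measurable[OF psub mu.not_empty])
  interpret N: prob_space N by (rule pN)
  note [measurable_cong] = sN
  define s where "s x = (\<integral>y. (u y - u x) * F (x, y) \<partial>\<mu>0)" for x
  have si: "integrable \<mu> s" unfolding s_def by (rule shift_fubini(2)[OF F um ub])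
  have inner: "(\<integral>\<^sup>+ y. ennreal (u y) \<partial>?p x) = ennreal (u x + s x)" "0 \<le> u x + s x" for x
  proof -
    interpret px: prob_space "?p x" by (rule px)
    have i: "integrable (?p x) u" using ub by (intro px.integrable_const_bound[where B = 1]) auto
    have eq: "(\<integral>y. u y \<partial>?p x) = u x + s x"
      unfolding s_def by (rule integral_mix(2)[OF sets_\<mu>0 S(1,2,3) um i])
    show "(\<integral>\<^sup>+ y. ennreal (u y) \<partial>?p x) = ennreal (u x + s x)"
      using i u(2) by (subst nn_integral_eq_integral) (auto simp: eq)
    have "0 \<le> (\<integral>y. u y \<partial>?p x)" using u(2) by simp
    then show "0 \<le> u x + s x" unfolding eq .
  qed
  have "ennreal (\<integral>y. u y \<partial>N) = (\<integral>\<^sup>+ y. ennreal (u y) \<partial>N)"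
    using u(2) ub by (intro nn_integral_eq_integral[symmetric] N.integrable_const_bound[where B = 1]) auto
  also have "\<dots> = (\<integral>\<^sup>+ x. \<integral>\<^sup>+ y. ennreal (u y) \<partial>?p x \<partial>\<mu>)"
    unfolding N_def by (rule nn_integral_bind[OF _ psub]) measurable
  also have "\<dots> = (\<integral>\<^sup>+ x. ennreal (u x + s x) \<partial>\<mu>)" unfolding inner(1) ..
  also have "\<dots> = ennreal (\<integral>x. u x + s x \<partial>\<mu>)"
    using ui si inner(2) by (intro nn_integral_eq_integral) auto
  finally have "(\<integral>y. u y \<partial>N) = (\<integral>x. u x + s x \<partial>\<mu>)"
    using u(2) inner(2) by (subst (asm) ennreal_inj) auto
  also have "\<dots> = (\<integral>x. u x \<partial>\<mu>) + shift u F"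
    unfolding shift_fubini(1)[OF F um ub] using ui si unfolding s_def by simp
  finally show "(\<integral>y. u y \<partial>N) = (\<integral>x. u x \<partial>\<mu>) + shift u F" .
qed

text \<open>The limit F meets every marginal constraint exactly and satisfies
  \<open>J F \<le> D\<close>, so it is a genuine competitor and no tolerance remains in the
  bound.\<close>

lemma strong_duality:
  assumes LC: "\<And>x::'a. \<exists>W. open W \<and> x \<in> W \<and> compact (closure W)"
    and \<nu>: "\<nu> \<in> \<P>" and D: "0 \<le> D"
    and dual: "\<And>\<phi>. \<phi> \<in> \<Phi> \<Longrightarrow> (\<integral>x. Q_real \<phi> x \<partial>\<mu>) - (\<integral>y. \<phi> y \<partial>\<nu>) \<le> D"
  shows "T_hat \<beta> \<gamma> \<mu>0 \<nu> \<mu> \<le> ennreal D"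
proof -
  obtain \<psi> :: "nat \<Rightarrow> 'a \<Rightarrow> real" where \<psi>: "\<And>i. continuous_on UNIV (\<psi> i)" "\<And>i x. 0 \<le> \<psi> i x" "\<And>i x. \<psi> i x \<le> 1"
    and det: "\<And>M N. prob_space M \<Longrightarrow> prob_space N \<Longrightarrow> sets M = sets borel \<Longrightarrow> sets N = sets borel \<Longrightarrow>
       (\<And>i. (\<integral>x. \<psi> i x \<partial>M) = (\<integral>x. \<psi> i x \<partial>N)) \<Longrightarrow> M = N"
    and tight: "\<And>M e. prob_space M \<Longrightarrow> sets M = sets borel \<Longrightarrow> 0 < e \<Longrightarrow>
       \<exists>K i. compact K \<and> (\<forall>x. x \<notin> K \<longrightarrow> \<psi> i x = 0) \<and> 1 - e < (\<integral>x. \<psi> i x \<partial>M)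
         \<and> measure M (- K) < e"
    by (rule ex_test_functions[OF LC]) blast
  have \<psi>m[measurable]: "\<psi> i \<in> borel_measurable borel" for i using \<psi>(1) by (rule borel_measurable_continuous_onI)
  have \<psi>b: "\<bar>\<psi> i x\<bar> \<le> 1" for i x using \<psi>(2,3)[of i x] by simp
  let ?e = "\<lambda>k. 1 / real (Suc k)"
  \<comment> \<open>Constraints grow and tolerances shrink, so the sets are nested. Convexity of
    \<open>J\<close> and affinity of the defect close them under midpoints, as the selection
    requires.\<close>
  define C where "C k = {F. adm F \<and> J F \<le> ennreal (D + ?e k) \<and>
      (\<forall>i<k. \<bar>defect \<nu> (\<psi> i) F\<bar> \<le> ?e k)}" for k
  obtain G where G: "\<And>k. G k \<in> C k" and conv: "AE z in m. convergent (\<lambda>k. exp (- G k z / 2))"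
  proof (rule pr.P.midpoint_convex_AE_convergent[of C])
    show "f \<in> borel_measurable m" if "f \<in> C k" for k f using that admD(2) unfolding C_def by blast
    show "0 \<le> f z" if "f \<in> C k" for k f z using that admD(3) unfolding C_def by blast
    show "C k \<noteq> {}" for k
    proof -
      obtain F where "adm F" "J F \<le> ennreal (D + ?e k)" "\<And>i. i < k \<Longrightarrow> \<bar>defect \<nu> (\<psi> i) F\<bar> \<le> ?e k"
        by (rule ex_almost_coupling[where \<psi> = \<psi> and k = k and e = "?e k", OF \<nu> D dual \<psi>(1) \<psi>b]) auto
      then show ?thesis unfolding C_def by blast
    qed
    show "C (Suc k) \<subseteq> C k" for k
    proof -
      have le: "?e (Suc k) \<le> ?e k" by (intro divide_left_mono) auto
      then have "ennreal (D + ?e (Suc k)) \<le> ennreal (D + ?e k)" by (intro ennreal_leI) simp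
      then show ?thesis unfolding C_def using le by (auto intro: order_trans less_SucI)
    qed
    show "(\<lambda>z. (f z + g z) / 2) \<in> C k" if f: "f \<in> C k" and g: "g \<in> C k" for k f g
    proof -
      have af: "adm f" and ag: "adm g" using f g unfolding C_def by auto
      let ?h = "\<lambda>z. (1 - 1/2) * f z + 1/2 * g z"
      have half: "(\<lambda>z. (f z + g z) / 2) = ?h" by (auto simp: field_simps)
      have "adm ?h" by (rule adm_convex[OF af ag]) auto
      moreover have "J ?h \<le> ennreal (D + ?e k)"
      proof -
        have "J ?h \<le> ennreal (1 - 1/2) * J f + ennreal (1/2) * J g"
          by (rule J_convex[OF af ag]) auto
        also have "\<dots> \<le> ennreal (1 - 1/2) * ennreal (D + ?e k) + ennreal (1/2) * ennreal (D + ?e k)"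
          using f g unfolding C_def by (intro add_mono mult_left_mono) auto
        also have "\<dots> = (ennreal (1 - 1/2) + ennreal (1/2)) * ennreal (D + ?e k)"
          by (rule distrib_right[symmetric])
        also have "ennreal (1 - 1/2) + ennreal (1/2) = ennreal (1 - 1/2 + 1/2)"
          by (rule ennreal_plus[symmetric]) auto
        also have "\<dots> = 1" by simp
        finally show ?thesis by (simp only: mult_1_left)
      qed
      moreover have "\<bar>defect \<nu> (\<psi> i) ?h\<bar> \<le> ?e k" if "i < k" for i
      proof -
        have mid: "\<bar>(a + b) / 2\<bar> \<le> r" if "\<bar>a\<bar> \<le> r" "\<bar>b\<bar> \<le> r" for a b r :: real
          using that by (simp add: abs_le_iff)
        have eq: "defect \<nu> (\<psi> i) ?h = (defect \<nu> (\<psi> i) f + defect \<nu> (\<psi> i) g) / 2"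
          unfolding defect_def shift_affine[OF af ag \<psi>m \<psi>b] by (simp add: field_simps)
        have "\<bar>defect \<nu> (\<psi> i) f\<bar> \<le> ?e k" "\<bar>defect \<nu> (\<psi> i) g\<bar> \<le> ?e k"
          using f g that unfolding C_def by auto
        then show ?thesis unfolding eq by (rule mid)
      qed
      ultimately show ?thesis unfolding C_def half by blast
    qed
  qed blast
  have Ga: "adm (G k)" and GJ: "J (G k) \<le> ennreal (D + ?e k)"
    and Gd: "i < k \<Longrightarrow> \<bar>defect \<nu> (\<psi> i) (G k)\<bar> \<le> ?e k" for k i
    using G[of k] unfolding C_def by auto
  obtain F where F: "adm F" and lim: "AE z in m. (\<lambda>k. G k z) \<longlonglongrightarrow> F z"
    using adm_AE_limit[OF Ga conv] by blast
  have inv0: "?e \<longlonglongrightarrow> 0" by (rule LIMSEQ_Suc[OF lim_1_over_n])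
  have JF: "J F \<le> ennreal D"
  proof -
    have "J F \<le> liminf (\<lambda>k. J (G k))" by (rule J_le_liminf[OF Ga F lim])
    also have "\<dots> \<le> liminf (\<lambda>k. ennreal (D + ?e k))"
      using GJ by (intro Liminf_mono always_eventually) auto
    also have "\<dots> = ennreal (D + 0)"
      using inv0 by (intro lim_imp_Liminf tendsto_ennrealI tendsto_add tendsto_const) auto
    finally show ?thesis by simp
  qed
  have d0: "(\<lambda>k. defect \<nu> (\<psi> i) (G k)) \<longlonglongrightarrow> 0" for i
  proof (rule tendsto_rabs_zero_cancel, rule tendsto_sandwich[OF _ _ tendsto_const inv0])
    show "\<forall>\<^sub>F k in sequentially. \<bar>defect \<nu> (\<psi> i) (G k)\<bar> \<le> ?e k"
      using eventually_gt_at_top[of i] by eventually_elim (rule Gd)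
  qed auto
  have tightK: "\<exists>K. compact K \<and> measure \<mu> (- K) \<le> e \<and>
        (\<forall>\<^sub>F k in sequentially. (\<integral>z. indicator (- K) (snd z) * G k z \<partial>m) \<le> e) \<and>
        (\<integral>z. indicator (- K) (snd z) * F z \<partial>m) \<le> e" if e: "0 < e" for e
  proof -
    \<comment> \<open>A single test function, vanishing off \<open>K1\<close> and of \<nu>-integral
      above 1 - e / 2, controls the tails of all late \<open>G k\<close>: by
      \<open>tail_bound\<close> it suffices that its defect exceeds - e / 2. The set
      \<open>K2\<close> serves \<mu>.\<close>
    obtain K1 i where K1: "compact K1" "\<And>x. x \<notin> K1 \<Longrightarrow> \<psi> i x = 0" "1 - e / 2 < (\<integral>x. \<psi> i x \<partial>\<nu>)"
      using tight[OF P_gammaD(1,2)[OF \<nu>], of "e / 2"] e by auto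
    obtain K2 where K2: "compact K2" "measure \<mu> (- K2) < e"
      using tight[OF P_gammaD(1,2)[OF mu_P] e] by auto
    define K where "K = K1 \<union> K2"
    let ?r = "\<lambda>H z. indicator (- K) (snd z) * H z"
    have K: "compact K" unfolding K_def using K1 K2 by auto
    have sub: "x \<notin> K \<Longrightarrow> x \<notin> K1" for x unfolding K_def by auto
    have Km[measurable]: "K \<in> sets borel" using K by (simp add: compact_imp_closed)
    have "measure \<mu> (- K) \<le> measure \<mu> (- K2)"
      using K2(1) by (intro mu.finite_measure_mono) (auto simp: K_def sets_mu compact_imp_closed)
    then have "measure \<mu> (- K) \<le> e" using K2(2) by linarith
    moreover have ev: "\<forall>\<^sub>F k in sequentially. (\<integral>z. ?r (G k) z \<partial>m) \<le> e"
    proof -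
      have "\<forall>\<^sub>F k in sequentially. - (e / 2) < defect \<nu> (\<psi> i) (G k)"
        using e by (intro order_tendstoD(1)[OF d0]) auto
      then show ?thesis
      proof eventually_elim
        case (elim k)
        note T = tail_bound[OF Ga \<psi>, of i k]
        have "(\<integral>z. ?r (G k) z \<partial>m) \<le> (\<integral>z. (1 - \<psi> i (snd z)) * G k z \<partial>m)"
        proof (rule integral_mono[OF _ T(2)])
          note [measurable] = admD(2)[OF Ga]
          have [measurable]: "(\<lambda>z. indicator (- K) (snd z) :: real) \<in> borel_measurable m" by measurable
          show "integrable m (\<lambda>z. ?r (G k) z)"
            by (rule adm_integrable_mult[OF Ga, where c = 1]) (auto split: split_indicator)
          show "?r (G k) z \<le> (1 - \<psi> i (snd z)) * G k z" for z
            using K1(2)[OF sub, of "snd z"] \<psi>(3)[of i "snd z"] admD(3)[OF Ga, of k z]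
            by (intro mult_right_mono) (auto split: split_indicator)
        qed
        also have "\<dots> \<le> e" using T(1) elim K1(3) unfolding defect_def by linarith
        finally show ?case .
      qed
    qed
    \<comment> \<open>The defect of F is not yet known, so \<open>tail_bound\<close> gives nothing
      for F; the bound is inherited from the sequence by Fatou.\<close>
    moreover have "(\<integral>z. ?r F z \<partial>m) \<le> e"
    proof -
      have [measurable]: "(\<lambda>z. indicator (- K) (snd z) :: real) \<in> borel_measurable m" by measurable
      note [measurable] = admD(2)[OF Ga] admD(2)[OF F]
      have eq: "ennreal (\<integral>z. ?r H z \<partial>m) = (\<integral>\<^sup>+ z. ennreal (?r H z) \<partial>m)"
        if H: "adm H" for H
      proof (rule nn_integral_eq_integral[symmetric])
        show "integrable m (\<lambda>z. ?r H z)"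
          by (rule adm_integrable_mult[OF H, where c = 1]) (auto split: split_indicator)
      qed (use admD(3)[OF H] in auto)
      have "(\<integral>\<^sup>+ z. ennreal (?r F z) \<partial>m)
          \<le> (\<integral>\<^sup>+ z. liminf (\<lambda>k. ennreal (?r (G k) z)) \<partial>m)"
      proof (rule nn_integral_mono_AE)
        show "AE z in m. ennreal (?r F z) \<le> liminf (\<lambda>k. ennreal (?r (G k) z))"
          using lim
        proof eventually_elim
          case (elim z)
          have "liminf (\<lambda>k. ennreal (?r (G k) z)) = ennreal (?r F z)"
            by (intro lim_imp_Liminf tendsto_ennrealI tendsto_mult_left elim) auto
          then show ?case by simp
        qed
      qed
      also have "\<dots> \<le> liminf (\<lambda>k. \<integral>\<^sup>+ z. ennreal (?r (G k) z) \<partial>m)"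
        by (rule nn_integral_liminf) measurable
      also have "\<dots> \<le> liminf (\<lambda>k. ennreal e)"
      proof (rule Liminf_mono)
        show "\<forall>\<^sub>F k in sequentially. (\<integral>\<^sup>+ z. ennreal (?r (G k) z) \<partial>m) \<le> ennreal e"
          using ev by eventually_elim (simp only: eq[OF Ga, symmetric] ennreal_leI)
      qed
      also have "\<dots> = ennreal e" by (simp add: Liminf_const)
      finally show ?thesis unfolding eq[OF F, symmetric] using e by (simp add: ennreal_le_iff)
    qed
    ultimately show ?thesis using K by blast
  qed
  have D1: "J (G k) \<le> ennreal (D + 1)" for k
  proof -
    have "?e k \<le> 1" by simp
    then have "ennreal (D + ?e k) \<le> ennreal (D + 1)" by (intro ennreal_leI) linarith
    then show ?thesis using GJ order_trans by blast
  qed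
  have DF: "J F \<le> ennreal (D + 1)" using JF by (rule order_trans) (intro ennreal_leI, simp)
  have D1': "0 \<le> D + 1" using D by simp
  have "defect \<nu> (\<psi> i) F = 0" for i
  proof (rule LIMSEQ_unique[OF _ d0])
    show "(\<lambda>k. defect \<nu> (\<psi> i) (G k)) \<longlonglongrightarrow> defect \<nu> (\<psi> i) F"
      unfolding defect_def
      by (intro tendsto_intros shift_tendsto[OF Ga F lim D1' D1 DF tightK \<psi>])
  qed
  then have "\<mu> \<bind> (\<lambda>x. mix \<mu>0 (\<lambda>y. F (x, y)) x) = \<nu>"
    using integral_bind_mix[OF F \<psi>] P_gammaD(1,2)[OF \<nu>]
    by (intro det) (auto simp: defect_def)
  then have "T_hat \<beta> \<gamma> \<mu>0 \<nu> \<mu> \<le> J F" by (rule T_hat_le_J[OF F])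
  also have "\<dots> \<le> ennreal D" by (rule JF)
  finally show ?thesis .
qed

end

text \<open>\<open>ennreal\<close> maps negative numbers to 0, so for negative r both sides are
  true.\<close>

lemma ereal_le_enn2ereal_iff: "ereal r \<le> enn2ereal s \<longleftrightarrow> ennreal r \<le> s"
proof (cases s)
  case (real t)
  then show ?thesis by (simp add: enn2ereal_ennreal ennreal_le_iff)
qed simp

section \<open>The duality formula\<close>

lemma ex_open_compact_closure:
  assumes "compact (UNIV :: 'a::polish_space set) \<or> (countable (UNIV :: 'a set) \<and> (\<forall>x::'a. x isolated_in UNIV))"
  shows "\<exists>W. open W \<and> (x::'a) \<in> W \<and> compact (closure W)"
proof (cases "compact (UNIV :: 'a set)")
  case True
  then show ?thesis by (intro exI[of _ UNIV]) simp
next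
  case False
  then have "x isolated_in UNIV" using assms by blast
  then have "open {x}" unfolding isolated_in_def by auto
  then show ?thesis by (intro exI[of _ "{x}"]) simp
qed

theorem theorem2p14:
  fixes \<beta> :: "real \<Rightarrow> ennreal" and \<gamma> :: "real \<Rightarrow> real" and C :: real
    and \<mu>0 \<mu> \<nu> :: "'a::polish_space measure" and xo :: 'a
  assumes space_X: "compact (UNIV :: 'a set) \<or> (countable (UNIV :: 'a set) \<and> (\<forall>x::'a. x isolated_in UNIV))"
    and beta_lsc: "lsc_on {0..} \<beta>"
    and beta_convex: "ennreal_convex_on {0..} \<beta>"
    and beta_0: "\<beta> 0 = 0"
    and beta_superlinear: "((\<lambda>x. \<beta> x / ennreal x) \<longlongrightarrow> \<infinity>) at_top"
    and gamma_nonneg: "\<And>u. u \<ge> 0 \<Longrightarrow> \<gamma> u \<ge> 0"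
    and gamma_lsc: "lsc_on {0..} \<gamma>"
    and gamma_0: "\<gamma> 0 = 0"
    and gamma_pos: "\<And>u. u > 0 \<Longrightarrow> \<gamma> u > 0"
    and gamma_add: "\<And>u v. u \<ge> 0 \<Longrightarrow> v \<ge> 0 \<Longrightarrow> \<gamma> (u + v) \<le> C * (\<gamma> u + \<gamma> v)"
    and mu0: "prob_space \<mu>0" "sets \<mu>0 = sets borel"
    and mu: "\<mu> \<in> P_gamma \<gamma> xo" "absolutely_continuous \<mu>0 \<mu>"
    and nu: "\<nu> \<in> P_gamma \<gamma> xo" "absolutely_continuous \<mu>0 \<nu>"
  shows "enn2ereal (T_hat \<beta> \<gamma> \<mu>0 \<nu> \<mu>) =
    (SUP \<phi>\<in>Phi_gamma_b \<gamma> xo.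
       ereal ((\<integral> x. real_of_ereal (Q_hat \<beta> \<gamma> \<mu>0 xo \<phi> x) \<partial>\<mu>) - (\<integral> y. \<phi> y \<partial>\<nu>)))"
proof -
  interpret weak_transport_source \<beta> \<gamma> \<mu>0 xo \<mu>
    by (intro weak_transport_source.intro weak_transport.intro weak_transport_source_axioms.intro)
      (fact beta_lsc beta_convex beta_0 beta_superlinear gamma_nonneg gamma_lsc gamma_0 gamma_pos mu0 mu(1))+
  define v where "v \<phi> = (\<integral>x. Q_real \<phi> x \<partial>\<mu>) - (\<integral>y. \<phi> y \<partial>\<nu>)" for \<phi>
  let ?S = "SUP \<phi>\<in>Phi_gamma_b \<gamma> xo. ereal (v \<phi>)"
  have "enn2ereal (T_hat \<beta> \<gamma> \<mu>0 \<nu> \<mu>) = ?S"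
  proof (rule antisym)
    show "?S \<le> enn2ereal (T_hat \<beta> \<gamma> \<mu>0 \<nu> \<mu>)"
    proof (rule SUP_least)
      fix \<phi> assume \<phi>: "\<phi> \<in> Phi_gamma_b \<gamma> xo"
      have "ennreal (v \<phi>) \<le> T_hat \<beta> \<gamma> \<mu>0 \<nu> \<mu>"
        unfolding T_hat_def v_def
        using weak_duality[OF \<phi> mu(1) nu(1)] by (intro Inf_greatest) (auto simp: ereal_le_enn2ereal_iff)
      then show "ereal (v \<phi>) \<le> enn2ereal (T_hat \<beta> \<gamma> \<mu>0 \<nu> \<mu>)" by (simp add: ereal_le_enn2ereal_iff)
    qed
    have up: "ereal (v \<phi>) \<le> ?S" if "\<phi> \<in> \<Phi>" for \<phi> using that by (rule SUP_upper)
    \<comment> \<open>The zero potential makes the supremum nonnegative. If finite, it is then a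
      legitimate bound D for \<open>strong_duality\<close>; if infinite, nothing is left to
      show.\<close>
    have z: "(\<lambda>x. 0) \<in> \<Phi>" by (rule bounded_in_Phi[of _ 0]) auto
    have "0 \<le> v (\<lambda>x. 0)"
      unfolding v_def using Q_hat_bounds(4)[OF z, of 0] by simp
    then have S0: "0 \<le> ?S" using up[OF z] by (meson ereal_less_eq(5) order_trans)
    show "enn2ereal (T_hat \<beta> \<gamma> \<mu>0 \<nu> \<mu>) \<le> ?S"
    proof (cases ?S)
      case (real D)
      have D: "0 \<le> D" using S0 unfolding real by simp
      have "T_hat \<beta> \<gamma> \<mu>0 \<nu> \<mu> \<le> ennreal D"
        using up[unfolded real] unfolding v_def
        by (intro strong_duality ex_open_compact_closure[OF space_X] nu(1) D) auto
      then have "enn2ereal (T_hat \<beta> \<gamma> \<mu>0 \<nu> \<mu>) \<le> enn2ereal (ennreal D)" by (simp add: less_eq_ennreal.rep_eq)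
      then show ?thesis unfolding real using D by (simp add: enn2ereal_ennreal)
    qed (use S0 in auto)
  qed
  then show ?thesis unfolding v_def Q_real_def .
qed

end
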